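(* Let $T>0$ be a rational multiple of $\pi$, let $S^1=\mathbb R/T\mathbb Z$ and $\Omega=[0,\pi]\times S^1$, and let $f:\Omega\times\mathbb R\to\mathbb R$ satisfy the following two conditions. $(f_1)$ $f\in C(\Omega\times\mathbb R,\mathbb R)$, and there exist $b\neq0$ and $l_F\in(0,|b|)$ such that, with $f_b(x,t,u):=f(x,t,u)-bu$, $$|f_b(x,t,u+v)-f_b(x,t,u)|\le l_F|v|\qquad\forall(x,t)\in\Omega,\ u,v\in\mathbb R.$$ $(f_2)$ With $A:=\Box-b\cdot I$, there exist $g_1,g_2\in L^\infty(\Omega,\mathbb R)\cap\mathcal L_s(\mathbf H,-|b|,|b|)$ and $g\in L^\infty(\Omega\times\mathbb R,\mathbb R)$ with $$g_1\le g_2,\quad i_A(g_1)=i_A(g_2),\quad\nu_A(g_2)=0,$$ $$g_1(x,t)\le g(x,t,u)\le g_2(x,t)\quad\text{for a.e. }(x,t,u)\in\Omega\times\mathbb R,$$ such that $f_b(x,t,u)-g(x,t,u)u=o(|u|)$ as $|u|\to\infty$, uniformly for $(x,t)\in\Omega$. Then the problem $$u_{tt}-u_{xx}=f(x,t,u),\qquad u(0,t)=u(\pi,t)=0,\qquad u(x,t+T)=u(x,t)$$ has a weak solution.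
   Context: Write $T=2\pi q/p$ with coprime integers $p,q$. $\mathbf H=L^2$ is the real Hilbert space of functions on $\Omega$ of the form $u=\sum_{j\ge1,k\in\mathbb Z}u_{j,k}\sin(jx)\exp(ik\tfrac pq t)$ with $u_{j,k}\in\mathbb C$, $u_{j,k}=\overline{u_{j,-k}}$ and $\|u\|_2^2=\sum|u_{j,k}|^2<\infty$. $\Box$ is the unbounded self-adjoint operator $u_{tt}-u_{xx}$ on $\mathbf H$, acting on the Fourier mode $\sin(jx)\exp(ik\frac pq t)$ by multiplication with $j^2-p^2k^2/q^2$; its only essential spectrum point is $0$, so $A=\Box-bI$ satisfies $\sigma_e(A)\cap(-|b|,|b|)=\emptyset$. A weak solution is $u\in D(\Box)\subset\mathbf H$ with $\Box u=f(\cdot,\cdot,u)$ in $\mathbf H$. $\mathcal L_s(\mathbf H,-|b|,|b|)$ is the set of bounded self-adjoint operators $B$ on $\mathbf H$ with $-|b|I<B<|b|I$, where $B<|b|I$ means that $(|b|-\delta)I-B$ is positive definite for some $\delta>0$, and $B>-|b|I$ is understood similarly. A function $g\in L^\infty(\Omega,\mathbb R)$ is identified with the multiplication operator $u\mapsto gu$ on $\mathbf H$; $g_1\le g_2$ means $g_1(x,t)\le g_2(x,t)$ for a.e. $(x,t)\in\Omega$. For $B\in\mathcal L_s(\mathbf H,-|b|,|b|)$: $\nu_A(B)=\dim\ker(A-B)$, and $i_A(B)\in\mathbb Z$ is the relative Morse index, i.e. the Fredholm index ($\dim\ker-\dim\mathrm{coker}$) of the map $V^-(A-B)\to V^-(A)$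 obtained by restricting the orthogonal projection onto $V^-(A)$, where $V^-(S)$ is the range of the spectral projection of a self-adjoint operator $S$ for $(-\infty,0)$. *)

theory Defs
  imports "HOL-Analysis.Analysis" "HOL-Library.Extended_Nat"
begin

section \<open>Real square-integrable functions on the plane modulo equality almost everywhere\<close>

definition square_integrable :: "('a::euclidean_space \<Rightarrow> real) \<Rightarrow> bool" where
  "square_integrable f \<longleftrightarrow> f \<in> borel_measurable lebesgue \<and> integrable lebesgue (\<lambda>z. (f z)\<^sup>2)"

lemma square_integrable_0 [simp]: "square_integrable (\<lambda>_. 0)"
  by (simp add: square_integrable_def)

lemma square_integrable_mult:
  assumes "square_integrable f" "square_integrable g"
  shows "integrable lebesgue (\<lambda>z. f z * g z)"
proof (rule Bochner_Integration.integrable_bound)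
  show "integrable lebesgue (\<lambda>z. (f z)\<^sup>2 + (g z)\<^sup>2)"
    using assms by (simp add: square_integrable_def)
  show "(\<lambda>z. f z * g z) \<in> borel_measurable lebesgue"
    using assms unfolding square_integrable_def by (intro borel_measurable_times) blast+
  have "\<bar>a * b\<bar> \<le> a\<^sup>2 + b\<^sup>2" for a b :: real
  proof -
    have "2 * (\<bar>a\<bar> * \<bar>b\<bar>) \<le> a\<^sup>2 + b\<^sup>2"
      using sum_squares_bound[of "\<bar>a\<bar>" "\<bar>b\<bar>"] by (simp add: mult.assoc)
    moreover have "0 \<le> \<bar>a\<bar> * \<bar>b\<bar>" by simp
    ultimately show ?thesis unfolding abs_mult by linarith
  qed
  then show "AE z in lebesgue. norm (f z * g z) \<le> norm ((f z)\<^sup>2 + (g z)\<^sup>2)"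
    by simp
qed

lemma square_integrable_add:
  assumes "square_integrable f" "square_integrable g"
  shows "square_integrable (\<lambda>z. f z + g z)"
  using assms square_integrable_mult[OF assms] borel_measurable_add[of f lebesgue g]
  by (simp add: square_integrable_def power2_sum mult.assoc)

lemma square_integrable_scale:
  assumes "square_integrable f"
  shows "square_integrable (\<lambda>z. c * f z)"
  using assms borel_measurable_times[of "\<lambda>_. c" lebesgue f]
  by (simp add: square_integrable_def power_mult_distrib)

quotient_type L2 = "real \<times> real \<Rightarrow> real" / partial:
  "\<lambda>f g. square_integrable f \<and> square_integrable g \<and> (AE z in lebesgue. f z = g z)"
  morphisms L2_rep L2_class
proof (rule part_equivpI)
  show "\<exists>f::real \<times> real \<Rightarrow> real. square_integrable f \<and> square_integrable f \<and> (AE z in lebesgue. f z = f z)"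
    by (rule exI[of _ "\<lambda>_. 0"]) simp
qed (auto simp: symp_def transp_def)

instantiation L2 :: real_inner
begin

lift_definition zero_L2 :: L2 is "\<lambda>_. 0" by simp

lift_definition plus_L2 :: "L2 \<Rightarrow> L2 \<Rightarrow> L2" is "\<lambda>f g z. f z + g z"
  by (auto intro: square_integrable_add)

lift_definition scaleR_L2 :: "real \<Rightarrow> L2 \<Rightarrow> L2" is "\<lambda>c f z. c * f z"
  by (auto intro: square_integrable_scale)

lift_definition inner_L2 :: "L2 \<Rightarrow> L2 \<Rightarrow> real" is "\<lambda>f g. LINT z|lebesgue. f z * g z"
  by (rule integral_cong_AE) (auto simp: square_integrable_def)

definition "uminus u = (-1) *\<^sub>R u" for u :: L2
definition "u - v = u + - v" for u v :: L2
definition "norm u = sqrt (inner u u)" for u :: L2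
definition "sgn u = inverse (norm u) *\<^sub>R u" for u :: L2
definition "dist u v = norm (u - v)" for u v :: L2
definition "(uniformity :: (L2 \<times> L2) filter) = (INF e\<in>{0<..}. principal {(x, y). dist x y < e})"
definition "open (U :: L2 set) = (\<forall>x\<in>U. eventually (\<lambda>(x', y). x' = x \<longrightarrow> y \<in> U) uniformity)"

instance
proof
  fix u v w :: L2 and r s :: real
  show "u + v + w = u + (v + w)"
    by transfer (auto intro!: square_integrable_add simp: add.assoc)
  show "u + v = v + u"
    by transfer (auto intro!: square_integrable_add simp: add.commute)
  show "0 + u = u" by transfer auto
  show "- u + u = 0"
    unfolding uminus_L2_def by transfer (auto intro!: square_integrable_add square_integrable_scale)
  show "u - v = u + - v" by (simp add: minus_L2_def)
  show "r *\<^sub>R (u + v) = r *\<^sub>R u + r *\<^sub>R v"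
    by transfer (auto intro!: square_integrable_add square_integrable_scale simp: algebra_simps)
  show "(r + s) *\<^sub>R u = r *\<^sub>R u + s *\<^sub>R u"
    by transfer (auto intro!: square_integrable_add square_integrable_scale simp: algebra_simps)
  show "r *\<^sub>R s *\<^sub>R u = (r * s) *\<^sub>R u"
    by transfer (auto intro!: square_integrable_scale simp: mult.assoc)
  show "1 *\<^sub>R u = u" by transfer auto
  show "inner u v = inner v u" by transfer (simp add: mult.commute)
  show "inner (u + v) w = inner u w + inner v w"
    by transfer (simp add: distrib_right square_integrable_mult)
  show "inner (r *\<^sub>R u) v = r * inner u v"
    by transfer (simp add: mult.assoc)
  show "0 \<le> inner u u" by transfer simp
  show "inner u u = 0 \<longleftrightarrow> u = 0"
  proof transfer
    fix f :: "real \<times> real \<Rightarrow> real"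
    assume "square_integrable f \<and> square_integrable f \<and> (AE z in lebesgue. f z = f z)"
    then have f: "square_integrable f" by simp
    then have "integrable lebesgue (\<lambda>z. f z * f z)" by (intro square_integrable_mult)
    then have "(LINT z|lebesgue. f z * f z) = 0 \<longleftrightarrow> (AE z in lebesgue. f z * f z = 0)"
      by (rule integral_nonneg_eq_0_iff_AE) simp
    then show "((LINT z|lebesgue. f z * f z) = 0) \<longleftrightarrow>
        square_integrable f \<and> square_integrable (\<lambda>_::real \<times> real. 0) \<and> (AE z in lebesgue. f z = 0)"
      using f by simp
  qed
qed (simp_all add: norm_L2_def sgn_L2_def dist_L2_def uniformity_L2_def open_L2_def)

end

section \<open>Operators in a real Hilbert space\<close>

text \<open>
  The Hilbert space is a closed subspace \<open>H\<close> of the ambient type. An unbounded operator is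
  represented by its graph, a bounded one by a function that is only relevant on \<open>H\<close>.
\<close>

definition op_minus :: "('h \<times> 'h) set \<Rightarrow> ('h \<Rightarrow> 'h) \<Rightarrow> ('h \<times> 'h::real_inner) set" where
  "op_minus S B = {(u, v - B u) |u v. (u, v) \<in> S}"

definition self_adjoint_on :: "'h::real_inner set \<Rightarrow> ('h \<times> 'h) set \<Rightarrow> bool" where
  "self_adjoint_on H S \<longleftrightarrow> S \<subseteq> H \<times> H \<and> H \<subseteq> closure (Domain S) \<and>
     S = {(v, w) \<in> H \<times> H. \<forall>(u, s)\<in>S. inner s v = inner u w}"

definition bounded_self_adjoint_on :: "'h::real_inner set \<Rightarrow> ('h \<Rightarrow> 'h) \<Rightarrow> bool" where
  "bounded_self_adjoint_on H B \<longleftrightarrow>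
     (\<forall>u\<in>H. B u \<in> H) \<and>
     (\<forall>u\<in>H. \<forall>v\<in>H. B (u + v) = B u + B v) \<and>
     (\<forall>c. \<forall>u\<in>H. B (c *\<^sub>R u) = c *\<^sub>R B u) \<and>
     (\<exists>C. \<forall>u\<in>H. norm (B u) \<le> C * norm u) \<and>
     (\<forall>u\<in>H. \<forall>v\<in>H. inner (B u) v = inner u (B v))"

definition positive_definite_on :: "'h::real_inner set \<Rightarrow> ('h \<Rightarrow> 'h) \<Rightarrow> bool" where
  "positive_definite_on H B \<longleftrightarrow> (\<forall>u\<in>H. u \<noteq> 0 \<longrightarrow> 0 < inner (B u) u)"

definition Ls :: "'h::real_inner set \<Rightarrow> real \<Rightarrow> real \<Rightarrow> ('h \<Rightarrow> 'h) set" where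
  "Ls H \<alpha> \<beta> = {B. bounded_self_adjoint_on H B \<and>
     (\<exists>\<delta>>0. positive_definite_on H (\<lambda>u. (\<beta> - \<delta>) *\<^sub>R u - B u)) \<and>
     (\<exists>\<delta>>0. positive_definite_on H (\<lambda>u. B u - (\<alpha> + \<delta>) *\<^sub>R u))}"

definition projection_valued_measure ::
  "'h::real_inner set \<Rightarrow> (real set \<Rightarrow> 'h \<Rightarrow> 'h) \<Rightarrow> bool" where
  "projection_valued_measure H E \<longleftrightarrow>
     (\<forall>M\<in>sets borel. bounded_self_adjoint_on H (E M) \<and> (\<forall>u\<in>H. E M (E M u) = E M u)) \<and>
     (\<forall>u\<in>H. E UNIV u = u) \<and>
     (\<forall>M :: nat \<Rightarrow> real set. range M \<subseteq> sets borel \<and> disjoint_family M \<longrightarrow>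
        (\<forall>u\<in>H. (\<lambda>n. E (M n) u) sums E (\<Union>n. M n) u))"

definition scalar_spectral_measure ::
  "(real set \<Rightarrow> 'h \<Rightarrow> 'h) \<Rightarrow> 'h::real_inner \<Rightarrow> real measure" where
  "scalar_spectral_measure E u = measure_of UNIV (sets borel) (\<lambda>M. ennreal (inner (E M u) u))"

text \<open>
  \<open>S = \<integral> \<lambda> dE(\<lambda>)\<close>: the domain of the integral consists of the \<open>u\<close> with
  \<open>\<integral> \<lambda>\<^sup>2 d\<langle>E u, u\<rangle> < \<infinity>\<close>, and \<open>\<langle>S u, u\<rangle> = \<integral> \<lambda> d\<langle>E u, u\<rangle>\<close>; for
  symmetric \<open>S\<close> this quadratic form determines \<open>S\<close> by polarization. By the spectral
  theorem every self-adjoint \<open>S\<close> has exactly one such \<open>E\<close> (up to values outside \<open>H\<close> and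
  on non-Borel sets).
\<close>

definition spectral_resolution ::
  "'h::real_inner set \<Rightarrow> ('h \<times> 'h) set \<Rightarrow> (real set \<Rightarrow> 'h \<Rightarrow> 'h) \<Rightarrow> bool" where
  "spectral_resolution H S E \<longleftrightarrow>
     self_adjoint_on H S \<and> projection_valued_measure H E \<and>
     Domain S = {u \<in> H. integrable (scalar_spectral_measure E u) (\<lambda>x. x\<^sup>2)} \<and>
     (\<forall>(u, v)\<in>S. inner v u = (LINT x|scalar_spectral_measure E u. x))"

text \<open>The library's \<open>dim\<close> is \<open>0\<close> for infinite-dimensional spaces, hence the case distinction.\<close>

definition edim :: "'v::real_vector set \<Rightarrow> enat" where
  "edim V = (if \<exists>F. finite F \<and> V \<subseteq> span F then enat (dim V) else \<infinity>)"

text \<open>Dimension of the quotient \<open>V/W\<close>, as the least size of a set spanning \<open>V\<close> modulo \<open>W\<close>.\<close>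

definition quotient_edim :: "'v::real_vector set \<Rightarrow> 'v set \<Rightarrow> enat" where
  "quotient_edim V W = (INF F\<in>{F. finite F \<and> F \<subseteq> V \<and> V \<subseteq> span (W \<union> F)}. enat (card F))"

definition has_fredholm_index ::
  "('v::real_vector \<Rightarrow> 'w::real_vector) \<Rightarrow> 'v set \<Rightarrow> 'w set \<Rightarrow> int \<Rightarrow> bool" where
  "has_fredholm_index P V W n \<longleftrightarrow>
     (\<exists>k c. edim {u \<in> V. P u = 0} = enat k \<and> quotient_edim W (P ` V) = enat c \<and> n = int k - int c)"

text \<open>
  \<open>i\<^sub>A(B) = n\<close>. With \<open>E\<close> and \<open>E'\<close> the spectral resolutions of \<open>A\<close> and \<open>A - B\<close>, the
  projection onto \<open>V\<^sup>-(A)\<close> is \<open>E {..<0}\<close> and \<open>V\<^sup>-(A - B)\<close> is the range of \<open>E' {..<0}\<close>.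
\<close>

definition has_relative_morse_index ::
  "'h::real_inner set \<Rightarrow> ('h \<times> 'h) set \<Rightarrow> ('h \<Rightarrow> 'h) \<Rightarrow> int \<Rightarrow> bool" where
  "has_relative_morse_index H A B n \<longleftrightarrow>
     (\<exists>E E'. spectral_resolution H A E \<and> spectral_resolution H (op_minus A B) E' \<and>
        has_fredholm_index (E {..<0}) (E' {..<0} ` H) (E {..<0} ` H) n)"

definition nullity :: "('h \<times> 'h) set \<Rightarrow> ('h \<Rightarrow> 'h::real_inner) \<Rightarrow> enat" where
  "nullity A B = edim {u. (u, 0) \<in> op_minus A B}"

section \<open>The wave operator\<close>

text \<open>
  Points \<open>(x, t)\<close> of \<open>[0,\<pi>] \<times> \<real>/T\<int>\<close> are represented in the fundamental domain
  \<open>[0,\<pi>] \<times> [0,T)\<close>, and \<open>L\<^sup>2\<close> of this set is the space of classes in \<open>L\<^sup>2(\<real>\<^sup>2)\<close> that vanish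
  outside it. The inner product \<open>\<integral> u v\<close> is \<open>\<pi> T / 2\<close> times the one with norm
  \<open>\<Sum> \<bar>u\<^sub>j\<^sub>k\<bar>\<^sup>2\<close> in the Fourier coefficients below.
\<close>

definition Omega :: "real \<Rightarrow> (real \<times> real) set" where
  "Omega T = {0..pi} \<times> {0..<T}"

definition HL2 :: "real \<Rightarrow> L2 set" where
  "HL2 T = {u. AE z in lebesgue. z \<notin> Omega T \<longrightarrow> L2_rep u z = 0}"

text \<open>
  Coefficient of \<open>sin (j x) exp (i k \<omega> t)\<close>, where \<open>\<omega> = 2 \<pi> / T\<close>; for \<open>T = 2 \<pi> q / p\<close>
  this is \<open>\<omega> = p / q\<close>.
\<close>

definition fourier_coeff :: "real \<Rightarrow> L2 \<Rightarrow> nat \<Rightarrow> int \<Rightarrow> complex" where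
  "fourier_coeff T u j k =
     2 / (pi * T) * (LINT z|lebesgue_on (Omega T).
       L2_rep u z * sin (j * fst z) * cis (- (k * (2 * pi / T) * snd z)))"

definition wave_op :: "real \<Rightarrow> (L2 \<times> L2) set" where
  "wave_op T = {(u, v). u \<in> HL2 T \<and> v \<in> HL2 T \<and>
     (\<forall>j\<ge>1. \<forall>k. fourier_coeff T v j k =
        complex_of_real ((real j)\<^sup>2 - (2 * pi / T)\<^sup>2 * (real_of_int k)\<^sup>2) * fourier_coeff T u j k)}"

definition Linfty :: "'a measure \<Rightarrow> ('a \<Rightarrow> real) set" where
  "Linfty M = {h. h \<in> borel_measurable M \<and> (\<exists>C. AE z in M. \<bar>h z\<bar> \<le> C)}"

definition mult_op :: "real \<Rightarrow> (real \<times> real \<Rightarrow> real) \<Rightarrow> L2 \<Rightarrow> L2" where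
  "mult_op T g u = L2_class (\<lambda>z. if z \<in> Omega T then g z * L2_rep u z else 0)"

definition weak_solution :: "real \<Rightarrow> (real \<times> real \<Rightarrow> real \<Rightarrow> real) \<Rightarrow> L2 \<Rightarrow> bool" where
  "weak_solution T f u \<longleftrightarrow>
     (\<exists>v. (u, v) \<in> wave_op T \<and> (AE z in lebesgue_on (Omega T). L2_rep v z = f z (L2_rep u z)))"

end

theory Submission
  imports Defs "HOL-Homology.Homology"
begin

text \<open>
  Put \<open>\<beta> = \<bar>b\<bar>\<close> and split \<open>H = Y\<^sup>- \<oplus> X \<oplus> Y\<^sup>+\<close> into the spectral subspaces of \<open>A\<close> for
  \<open>\<lambda> \<le> -\<beta>\<close>, \<open>\<bar>\<lambda>\<bar> < \<beta>\<close> and \<open>\<lambda> \<ge> \<beta>\<close>. The eigenvalue \<open>-b\<close> of infinite multiplicity belongs to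
  \<open>Y\<^sup>-\<close> or \<open>Y\<^sup>+\<close>, so \<open>X\<close> has finite dimension, and since the nonlinearity has Lipschitz constant
  less than \<open>\<beta>\<close>, a contraction solves the \<open>Y\<close>-component of the equation for every given
  \<open>X\<close>-component.

  Write \<open>C\<^sub>i = A - g\<^sub>i\<close>. The finite-dimensional space
  \<open>L\<^sub>1 = C\<^sub>1\<^sup>-\<^sup>1 (V\<^sup>-(C\<^sub>1) \<inter> (X \<oplus> Y\<^sup>+))\<close> is in the domain and \<open>C\<^sub>1 L\<^sub>1\<close> is orthogonal to \<open>Y\<^sup>-\<close>, so \<open>C\<^sub>1\<close> is
  negative definite on \<open>L\<^sub>1 \<oplus> Y\<^sup>-\<close>; likewise \<open>C\<^sub>2\<close> is positive definite on \<open>L\<^sub>2 \<oplus> Y\<^sup>+\<close> with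
  \<open>L\<^sub>2 = C\<^sub>2\<^sup>-\<^sup>1 (V\<^sup>+(C\<^sub>2) \<inter> (X \<oplus> Y\<^sup>-))\<close>. Equality of the two relative Morse indices makes
  \<open>dim L\<^sub>1 + dim L\<^sub>2 \<ge> dim X\<close>, hence these two spaces span the domain. Testing \<open>(A - h) w\<close> with the
  difference of the two components of \<open>w\<close> gives \<open>\<parallel>(A - h) w\<parallel> \<ge> c \<parallel>w\<parallel>\<close> for all \<open>g\<^sub>1 \<le> h \<le> g\<^sub>2\<close>, and
  thereby an a priori bound along the homotopy from \<open>g\<^sub>2\<close> to the nonlinearity. Brouwer's
  theorem on \<open>X\<close> then yields the solution.
\<close>

section \<open>Self-adjoint operators and their spectral resolutions\<close>

text \<open>Nothing here constructs a spectral resolution: those of \<open>A\<close> and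
  \<open>A - g\<^sub>i\<close> come with the relative Morse indices. The index enters as two counts:
  if \<open>X\<^sup>-\<close> and \<open>X\<^sup>+\<close> are the parts of \<open>X\<close> for
  \<open>\<lambda> < 0\<close> and \<open>\<lambda> \<ge> 0\<close>, then
  \<open>dim L\<^sub>1 \<ge> n + dim X\<^sup>-\<close> and
  \<open>dim L\<^sub>2 \<ge> dim X\<^sup>+ - n\<close>, and the common index \<open>n\<close>
  cancels. The first count is linear algebra with the kernel and cokernel of the index map. The
  second concerns vectors outside \<open>V\<^sup>-(C\<^sub>2)\<close>, which that map never meets;
  it rests on an estimate showing that the \<open>Y\<^sup>+\<close>-component of a vector of
  \<open>V\<^sup>-(C\<^sub>2)\<close> is smaller than the vector by a factor below 1. The inverse in
  \<open>L\<^sub>i\<close> is there because spectral subspaces need not lie in the domain, and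
  because it makes the mixed terms of the form between \<open>L\<^sub>i\<close> and
  \<open>Y\<^sup>-\<close> or \<open>Y\<^sup>+\<close> vanish. At infinity the nonlinearity is not
  close to a single linear operator, only, for each \<open>u\<close>, to multiplication by some
  \<open>h\<close> depending on \<open>u\<close>; hence \<open>c\<close> must be uniform in
  \<open>h\<close>.\<close>

locale selfadj =
  fixes H :: "'h::real_inner set" and S :: "('h \<times> 'h) set"
  assumes sub: "subspace H" and sa: "self_adjoint_on H S"
begin

lemma graph_iff:
  "(v, w) \<in> S \<longleftrightarrow> v \<in> H \<and> w \<in> H \<and> (\<forall>(u, s)\<in>S. inner s v = inner u w)"
proof -
  have "S = {(v, w) \<in> H \<times> H. \<forall>(u, s)\<in>S. inner s v = inner u w}"
    using sa unfolding self_adjoint_on_def by (elim conjE)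
  then have "(v, w) \<in> S \<longleftrightarrow> (v, w) \<in> {(v, w) \<in> H \<times> H. \<forall>(u, s)\<in>S. inner s v = inner u w}"
    by (rule arg_cong)
  then show ?thesis by (simp only: mem_Collect_eq case_prod_conv mem_Sigma_iff conj_assoc)
qed

lemma graph_in: "(u, v) \<in> S \<Longrightarrow> u \<in> H \<and> v \<in> H"
  using graph_iff[of u v] by blast

lemma sym:
  assumes "(u, v) \<in> S" "(u', v') \<in> S" shows "inner v u' = inner u v'"
  using graph_iff[THEN iffD1, OF assms(2)] assms(1) by fast

text \<open>Maximality of a self-adjoint graph. This direction puts eigenvectors, limits and vectors
  orthogonal to a range into \<open>S\<close> without an explicit description of its domain.\<close>

lemma memI:
  assumes "v \<in> H" "w \<in> H" "\<And>u s. (u, s) \<in> S \<Longrightarrow> inner s v = inner u w"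
  shows "(v, w) \<in> S"
  using assms by (intro graph_iff[THEN iffD2]) auto

text \<open>Density of the domain; vectors of \<open>H\<close> are shown to vanish below by pairing
  them with domain vectors only.\<close>

lemma orth_dom:
  assumes "w \<in> H" "\<And>u v. (u, v) \<in> S \<Longrightarrow> inner w u = 0"
  shows "w = 0"
proof -
  have "w \<in> closure (Domain S)"
    using sa assms(1) unfolding self_adjoint_on_def by (elim conjE) (rule subsetD)
  moreover have "closure (Domain S) \<subseteq> {x. inner w x = 0}"
    by (rule closure_minimal) (auto simp: assms(2) intro: closed_hyperplane)
  ultimately show "w = 0" by auto
qed

lemma graph_0: "(0, v) \<in> S \<longleftrightarrow> v = 0"
proof
  assume v: "(0, v) \<in> S"
  show "v = 0"
  proof (rule orth_dom)
    show "inner v u = 0" if "(u, w) \<in> S" for u w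
      using sym[OF v that] by simp
  qed (use graph_in[OF v] in blast)
next
  assume "v = 0"
  then show "(0, v) \<in> S"
    using subspace_0[OF sub] memI[of 0 0] by simp
qed

lemma graph_add: "(u, v) \<in> S \<Longrightarrow> (u', v') \<in> S \<Longrightarrow> (u + u', v + v') \<in> S"
proof (rule memI)
  assume "(u, v) \<in> S" "(u', v') \<in> S"
  note * = this
  show "u + u' \<in> H" "v + v' \<in> H"
    using subspace_add[OF sub] graph_in[OF *(1)] graph_in[OF *(2)] by auto
  show "inner s (u + u') = inner w (v + v')" if "(w, s) \<in> S" for w s
    using sym[OF that *(1)] sym[OF that *(2)] by (simp add: inner_right_distrib)
qed

lemma graph_scale: "(u, v) \<in> S \<Longrightarrow> (c *\<^sub>R u, c *\<^sub>R v) \<in> S"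
proof (rule memI)
  assume *: "(u, v) \<in> S"
  show "c *\<^sub>R u \<in> H" "c *\<^sub>R v \<in> H"
    using subspace_scale[OF sub] graph_in[OF *] by auto
  show "inner s (c *\<^sub>R u) = inner w (c *\<^sub>R v)" if "(w, s) \<in> S" for w s
    using sym[OF that *] by simp
qed

lemma graph_minus: "(u, v) \<in> S \<Longrightarrow> (- u, - v) \<in> S"
  using graph_scale[of u v "-1"] by simp

lemma graph_diff: "(u, v) \<in> S \<Longrightarrow> (u', v') \<in> S \<Longrightarrow> (u - u', v - v') \<in> S"
  using graph_add[of u v "- u'" "- v'"] graph_minus[of u' v'] by simp

lemma graph_unique: "(u, v) \<in> S \<Longrightarrow> (u, v') \<in> S \<Longrightarrow> v = v'"
  using graph_diff[of u v u v'] graph_0[of "v - v'"] by simp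

text \<open>The adjoint condition consists of inner products with fixed pairs \<open>(p, s)\<close>,
  so it survives limits.\<close>

lemma graph_closed:
  assumes "\<And>n. (u n, v n) \<in> S" "u \<longlonglongrightarrow> a" "v \<longlonglongrightarrow> b" "a \<in> H" "b \<in> H"
  shows "(a, b) \<in> S"
proof (rule memI)
  fix p s assume ps: "(p, s) \<in> S"
  have "(\<lambda>n. inner s (u n)) \<longlonglongrightarrow> inner s a" "(\<lambda>n. inner p (v n)) \<longlonglongrightarrow> inner p b"
    by (intro tendsto_intros assms)+
  moreover have "inner s (u n) = inner p (v n)" for n
    using sym[OF ps assms(1)] .
  ultimately show "inner s a = inner p b"
    using LIMSEQ_unique by auto
qed (use assms in auto)

end

section \<open>Spectral projections and the quadratic form of a resolved operator\<close>

locale resolved = selfadj H S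
  for H :: "'h::real_inner set" and S :: "('h \<times> 'h) set" +
  fixes E :: "real set \<Rightarrow> 'h \<Rightarrow> 'h"
  assumes res: "spectral_resolution H S E"
begin

abbreviation \<mu> where "\<mu> \<equiv> scalar_spectral_measure E"

lemma bsa: "M \<in> sets borel \<Longrightarrow> bounded_self_adjoint_on H (E M)"
  using res unfolding spectral_resolution_def projection_valued_measure_def by blast

lemma E_in: "M \<in> sets borel \<Longrightarrow> u \<in> H \<Longrightarrow> E M u \<in> H"
  and E_add: "M \<in> sets borel \<Longrightarrow> u \<in> H \<Longrightarrow> v \<in> H \<Longrightarrow> E M (u + v) = E M u + E M v"
  and E_scale: "M \<in> sets borel \<Longrightarrow> u \<in> H \<Longrightarrow> E M (c *\<^sub>R u) = c *\<^sub>R E M u"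
  and E_sym: "M \<in> sets borel \<Longrightarrow> u \<in> H \<Longrightarrow> v \<in> H \<Longrightarrow> inner (E M u) v = inner u (E M v)"
  using bsa[of M] unfolding bounded_self_adjoint_on_def by auto

lemma E_zero: "M \<in> sets borel \<Longrightarrow> E M 0 = 0"
  using E_scale[of M 0 0] subspace_0[OF sub] by simp

lemma E_diff: "M \<in> sets borel \<Longrightarrow> u \<in> H \<Longrightarrow> v \<in> H \<Longrightarrow> E M (u - v) = E M u - E M v"
  using E_add[of M u "-v"] E_scale[of M v "-1"] subspace_neg[OF sub] by simp

lemma E_idem: "M \<in> sets borel \<Longrightarrow> u \<in> H \<Longrightarrow> E M (E M u) = E M u"
  and E_UNIV: "u \<in> H \<Longrightarrow> E UNIV u = u"
  and E_sums: "range N \<subseteq> sets borel \<Longrightarrow> disjoint_family N \<Longrightarrow> u \<in> H \<Longrightarrow>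
      (\<lambda>n::nat. E (N n) u) sums E (\<Union>n. N n) u"
  using res unfolding spectral_resolution_def projection_valued_measure_def by auto

text \<open>A constant family of empty sets is disjoint with empty union, so countable additivity
  makes a constant series converge, which forces its term to be 0.\<close>

lemma E_empty: assumes "u \<in> H" shows "E {} u = 0"
proof -
  have "(\<lambda>n::nat. E {} u) sums E (\<Union>n::nat. {}) u"
    by (rule E_sums) (auto simp: disjoint_family_on_def assms)
  then have "(\<lambda>n::nat. E {} u) \<longlonglongrightarrow> 0"
    using sums_summable summable_LIMSEQ_zero by blast
  then show ?thesis
    using LIMSEQ_unique tendsto_const by blast
qed

lemma E_Un:
  assumes [measurable]: "M \<in> sets borel" "N \<in> sets borel" and "M \<inter> N = {}" "u \<in> H"
  shows "E (M \<union> N) u = E M u + E N u"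
proof -
  let ?F = "\<lambda>n::nat. if n = 0 then M else if n = 1 then N else {}"
  have "(\<lambda>n. E (?F n) u) sums E (\<Union>n. ?F n) u"
    by (rule E_sums) (use assms in \<open>auto simp: disjoint_family_on_def\<close>)
  moreover have "(\<Union>n. ?F n) = M \<union> N"
    by (auto split: if_splits)
  moreover have "(\<lambda>n. E (?F n) u) sums (\<Sum>n\<in>{0,1}. E (?F n) u)"
    by (rule sums_finite) (use assms E_empty in auto)
  ultimately show ?thesis
    using sums_unique2 by fastforce
qed

lemma E_inner: "M \<in> sets borel \<Longrightarrow> u \<in> H \<Longrightarrow> inner (E M u) u = (norm (E M u))\<^sup>2"
  by (metis E_idem E_in E_sym power2_norm_eq_inner)

text \<open>Multiplicativity has to be extracted from additivity. Since
  \<open>E (M \<union> N)\<close> is a projection, \<open>inner (E (M \<union> N) w) w\<close> is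
  both the squared norm of the sum \<open>E M w + E N w\<close> and the sum of the two squared
  norms, so the mixed term vanishes; then take \<open>w = E N u\<close>.\<close>

lemma E_disj:
  assumes [measurable]: "M \<in> sets borel" "N \<in> sets borel" and d: "M \<inter> N = {}" and u: "u \<in> H"
  shows "E M (E N u) = 0"
proof -
  have *: "inner (E M w) (E N w) = 0" if w: "w \<in> H" for w
  proof -
    have "inner (E (M \<union> N) w) w = (norm (E M w + E N w))\<^sup>2"
      using E_inner[of "M \<union> N" w] w E_Un[OF assms(1,2) d w] by auto
    then show ?thesis
      using E_Un[OF assms(1,2) d w] E_inner[of M w] E_inner[of N w] w
      by (simp add: inner_left_distrib power2_norm_eq_inner inner_right_distrib inner_commute)
  qed
  have "inner (E M (E N u)) (E N (E N u)) = 0"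
    using * E_in u by auto
  then have "(norm (E M (E N u)))\<^sup>2 = 0"
    using E_idem E_inner u E_in by auto
  then show ?thesis by simp
qed

lemma E_Int:
  assumes [measurable]: "M \<in> sets borel" "N \<in> sets borel" and u: "u \<in> H"
  shows "E M (E N u) = E (M \<inter> N) u"
proof -
  have "E N u = E (M \<inter> N) u + E (N - M) u"
    using E_Un[of "M \<inter> N" "N - M" u] u
    by (metis (no_types, lifting) Diff_Diff_Int Diff_disjoint Int_Diff_Un Int_commute
        assms(1) assms(2) sets.Diff Int_Diff_disjoint)
  then have "E M (E N u) = E M (E (M \<inter> N) u) + E M (E (N - M) u)"
    using u by (simp add: E_add E_in)
  also have "E M (E (N - M) u) = 0"
    using u by (intro E_disj) auto
  also have "E M (E (M \<inter> N) u) = E (M \<inter> N) (E (M \<inter> N) u) + E (M - N) (E (M \<inter> N) u)"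
    using E_Un[of "M \<inter> N" "M - N" "E (M \<inter> N) u"] u
    by (metis (no_types, lifting) E_in Int_Diff_Un Int_Diff_disjoint assms(1,2) sets.Diff sets.Int)
  also have "E (M - N) (E (M \<inter> N) u) = 0"
    using u by (intro E_disj) auto
  finally show ?thesis using u by (simp add: E_idem)
qed

lemma E_Compl:
  assumes "M \<in> sets borel" "u \<in> H"
  shows "u = E M u + E (- M) u"
  using E_Un[of M "-M" u] assms E_UNIV[of u] by (simp add: borel_comp)

lemma E_norm_le: assumes "M \<in> sets borel" "u \<in> H" shows "norm (E M u) \<le> norm u"
proof -
  have "(norm (E M u))\<^sup>2 \<le> norm (E M u) * norm u"
    using E_inner[OF assms] norm_cauchy_schwarz[of "E M u" u] by simp
  then show ?thesis
    by (cases "norm (E M u) = 0") (auto simp: power2_eq_square)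
qed

lemma E_orth:
  assumes "M \<in> sets borel" "N \<in> sets borel" "M \<inter> N = {}" "u \<in> H" "v \<in> H"
  shows "inner (E M u) (E N v) = 0"
  using assms by (metis E_in E_sym E_disj inner_zero_right)

lemma space_\<mu> [simp]: "space (\<mu> u) = UNIV"
  and sets_\<mu> [simp, measurable_cong]: "sets (\<mu> u) = sets borel"
  unfolding scalar_spectral_measure_def
  by (auto simp: space_measure_of_conv sets_measure_of_conv sets.sigma_sets_eq[of borel, simplified])

lemma emeasure_\<mu>:
  assumes "u \<in> H" "M \<in> sets borel"
  shows "emeasure (\<mu> u) M = ennreal ((norm (E M u))\<^sup>2)"
proof -
  have "emeasure (\<mu> u) M = ennreal (inner (E M u) u)"
  proof (rule emeasure_measure_of[OF scalar_spectral_measure_def])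
    show "positive (sets (\<mu> u)) (\<lambda>M. ennreal (inner (E M u) u))"
      using assms E_empty by (auto simp: positive_def)
    show "countably_additive (sets (\<mu> u)) (\<lambda>M. ennreal (inner (E M u) u))"
    proof (rule countably_additiveI)
      fix N :: "nat \<Rightarrow> real set"
      assume N: "range N \<subseteq> sets (\<mu> u)" "disjoint_family N"
      have "(\<lambda>n. inner (E (N n) u) u) sums inner (E (\<Union>n. N n) u) u"
        using bounded_linear.sums[OF bounded_linear_inner_left E_sums] N assms by auto
      moreover have "0 \<le> inner (E (N n) u) u" for n
        using E_inner[of "N n" u] N assms by auto
      ultimately show "suminf (\<lambda>n. ennreal (inner (E (N n) u) u)) = ennreal (inner (E (\<Union>n. N n) u) u)"
        by (simp add: suminf_ennreal2 sums_unique[symmetric] sums_summable)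
    qed
  qed (use assms in auto)
  then show ?thesis using E_inner assms by simp
qed

lemma finite_\<mu>: "u \<in> H \<Longrightarrow> finite_measure (\<mu> u)"
  by (rule finite_measureI) (simp add: emeasure_\<mu>)

lemma measure_\<mu>: "u \<in> H \<Longrightarrow> measure (\<mu> u) UNIV = (norm u)\<^sup>2"
  by (simp add: measure_def emeasure_\<mu> E_UNIV)

lemma AE_\<mu>:
  assumes "u \<in> H" "M \<in> sets borel" "E M u = u"
  shows "AE x in \<mu> u. x \<in> M"
proof (rule AE_I)
  have "E (- M) u = 0"
    using E_disj[of "-M" M u] assms by (simp add: borel_comp)
  then show "emeasure (\<mu> u) (-M) = 0"
    using assms by (simp add: emeasure_\<mu> borel_comp)
qed (use assms in \<open>auto simp: borel_comp\<close>)

lemma dom_iff: "u \<in> Domain S \<longleftrightarrow> u \<in> H \<and> integrable (\<mu> u) (\<lambda>x. x\<^sup>2)"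
  using res unfolding spectral_resolution_def by auto

lemma form_eq: "(u, v) \<in> S \<Longrightarrow> inner v u = (LINT x|\<mu> u. x)"
  using res unfolding spectral_resolution_def by auto

lemma integrable_\<mu>:
  assumes "(u, v) \<in> S" shows "integrable (\<mu> u) (\<lambda>x. x)"
proof (rule Bochner_Integration.integrable_bound)
  have u: "u \<in> H" "integrable (\<mu> u) (\<lambda>x. x\<^sup>2)" using assms dom_iff by auto
  interpret finite_measure "\<mu> u" by (rule finite_\<mu>) fact
  show "integrable (\<mu> u) (\<lambda>x. x\<^sup>2 + 1)" using u by simp
  have "\<bar>x\<bar> \<le> x\<^sup>2 + 1" for x :: real
    using sum_squares_bound[of "\<bar>x\<bar>" 1] by auto
  then show "AE x in \<mu> u. norm x \<le> norm (x\<^sup>2 + 1)" by simp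
qed simp

lemma form_ge:
  assumes "(u, v) \<in> S" "M \<in> sets borel" "E M u = u" "\<And>x. x \<in> M \<Longrightarrow> c \<le> x"
  shows "c * (norm u)\<^sup>2 \<le> inner v u"
proof -
  have u: "u \<in> H" using assms graph_in by auto
  interpret finite_measure "\<mu> u" by (rule finite_\<mu>) fact
  have "(LINT x|\<mu> u. c) \<le> (LINT x|\<mu> u. x)"
    using AE_\<mu>[OF u assms(2,3)] assms(4) integrable_\<mu>[OF assms(1)]
    by (intro integral_mono_AE) auto
  then show ?thesis using form_eq[OF assms(1)] measure_\<mu>[OF u] by (simp add: mult.commute)
qed

text \<open>The sign \<open>s\<close> selects the side of \<open>c\<close> on which \<open>M\<close>
  lies. Strictness holds because an integrand that is positive almost everywhere has integral 0 only
  for the zero measure, and the total mass is \<open>(norm u)\<^sup>2\<close>.\<close>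

lemma form_pos:
  assumes "(u, v) \<in> S" "M \<in> sets borel" "E M u = u" "\<And>x. x \<in> M \<Longrightarrow> 0 < s * (x - c)" "u \<noteq> 0"
  shows "0 < s * (inner v u - c * (norm u)\<^sup>2)"
proof -
  have u: "u \<in> H" using assms graph_in by auto
  interpret finite_measure "\<mu> u" by (rule finite_\<mu>) fact
  have i: "integrable (\<mu> u) (\<lambda>x. s * (x - c))" using integrable_\<mu>[OF assms(1)] by auto
  have ae: "AE x in \<mu> u. 0 < s * (x - c)" using AE_\<mu>[OF u assms(2,3)] assms(4) by auto
  have "0 \<le> (LINT x|\<mu> u. s * (x - c))"
    by (rule integral_nonneg_AE) (use ae in auto)
  moreover have "(LINT x|\<mu> u. s * (x - c)) \<noteq> 0"
  proof
    assume "(LINT x|\<mu> u. s * (x - c)) = 0"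
    then have "AE x in \<mu> u. s * (x - c) = 0"
      using ae by (subst (asm) integral_nonneg_eq_0_iff_AE[OF i]) auto
    with ae have "AE x in \<mu> u. False" by eventually_elim auto
    then have "emeasure (\<mu> u) {x \<in> space (\<mu> u). \<not> False} = 0"
      by (rule AE_E2)
    then have "emeasure (\<mu> u) UNIV = 0" by simp
    then show False using u assms(5) by (simp add: emeasure_\<mu> E_UNIV)
  qed
  moreover have "(LINT x|\<mu> u. s * (x - c)) = s * (inner v u - c * (norm u)\<^sup>2)"
    using form_eq[OF assms(1)] measure_\<mu>[OF u] integrable_\<mu>[OF assms(1)] by (simp add: mult.commute)
  ultimately show ?thesis by linarith
qed

lemma form_less:
  assumes "(u, v) \<in> S" "M \<in> sets borel" "E M u = u" "\<And>x. x \<in> M \<Longrightarrow> x < c" "u \<noteq> 0"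
  shows "inner v u < c * (norm u)\<^sup>2"
  using form_pos[OF assms(1-3), of "-1" c] assms(4,5) by simp

lemma dom_bounded:
  assumes "u \<in> H" "M \<in> sets borel" "\<And>x. x \<in> M \<Longrightarrow> \<bar>x\<bar> \<le> R"
  shows "E M u \<in> Domain S"
proof -
  have m: "E M u \<in> H" "E M (E M u) = E M u" using assms by (auto simp: E_in E_idem)
  interpret finite_measure "\<mu> (E M u)" by (rule finite_\<mu>) fact
  have "AE x in \<mu> (E M u). norm (x\<^sup>2) \<le> R\<^sup>2"
    using AE_\<mu>[OF m(1) assms(2) m(2)]
  proof eventually_elim
    case (elim x)
    then have "\<bar>x\<bar> \<le> \<bar>R\<bar>" using assms(3)[of x] by linarith
    then show ?case by (simp add: abs_le_square_iff)
  qed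
  then have "integrable (\<mu> (E M u)) (\<lambda>x. x\<^sup>2)"
    by (rule integrable_const_bound) simp
  then show ?thesis using dom_iff m by blast
qed

text \<open>The scalar spectral measure of \<open>E M u\<close> is that of \<open>u\<close>
  restricted to \<open>M\<close>, so the second moment stays finite.\<close>

lemma E_dom:
  assumes M[measurable]: "M \<in> sets borel" and "u \<in> Domain S"
  shows "E M u \<in> Domain S"
proof -
  have u: "u \<in> H" "integrable (\<mu> u) (\<lambda>x. x\<^sup>2)" using assms dom_iff by auto
  have "\<mu> (E M u) = density (\<mu> u) (indicator M)"
  proof (rule measure_eqI)
    fix N assume "N \<in> sets (\<mu> (E M u))"
    then have [measurable]: "N \<in> sets borel" by simp
    show "emeasure (\<mu> (E M u)) N = emeasure (density (\<mu> u) (indicator M)) N"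
      using u by (simp add: emeasure_restricted emeasure_\<mu> E_in E_Int Int_commute)
  qed simp
  moreover have "integrable (density (\<mu> u) (\<lambda>x. ennreal (indicator M x))) (\<lambda>x. x\<^sup>2)"
    using u integrable_mult_indicator[of M "\<mu> u" "\<lambda>x. x\<^sup>2"] by (subst integrable_density) simp_all
  ultimately have "integrable (\<mu> (E M u)) (\<lambda>x. x\<^sup>2)"
    by (simp add: ennreal_indicator)
  then show ?thesis using dom_iff E_in u M by blast
qed

text \<open>Vectors in the ranges of \<open>E M\<close> and \<open>E (- M)\<close> do not interact, because
  \<open>u + w\<close> and \<open>u - w\<close> have the same scalar spectral measure.\<close>

lemma form_orth:
  assumes "(u, v) \<in> S" "(w, z) \<in> S" and M[measurable]: "M \<in> sets borel"
    and "E M u = u" "E (- M) w = w"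
  shows "inner v w = 0"
proof -
  have uw: "u \<in> H" "w \<in> H" using assms graph_in by auto
  have o: "inner (E N u) (E N w) = 0" if [measurable]: "N \<in> sets borel" for N
    using E_orth[of "N \<inter> M" "N \<inter> - M" u w] E_Int[of N M u] E_Int[of N "- M" w] uw assms(4,5)
    by (auto simp: borel_comp)
  have "\<mu> (u + w) = \<mu> (u - w)"
  proof (rule measure_eqI)
    fix N assume "N \<in> sets (\<mu> (u + w))"
    then have N: "N \<in> sets borel" by simp
    show "emeasure (\<mu> (u + w)) N = emeasure (\<mu> (u - w)) N"
      using uw N sub o[OF N]
      by (simp add: emeasure_\<mu> subspace_add subspace_diff E_add E_diff power2_norm_eq_inner
          inner_diff inner_add inner_commute)
  qed simp
  then have "inner (v + z) (u + w) = inner (v - z) (u - w)"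
    using form_eq[OF graph_add[OF assms(1,2)]] form_eq[OF graph_diff[OF assms(1,2)]] by simp
  then have "inner v w + inner z u = 0"
    by (simp add: inner_diff inner_add)
  then show ?thesis using sym[OF assms(1,2)] by (simp add: inner_commute)
qed

text \<open>\<open>spectral_resolution\<close> describes \<open>S\<close> only by its domain and its
  quadratic form, so it has to be proved that \<open>E M\<close> commutes with \<open>S\<close>.
  Split \<open>u\<close> by \<open>M\<close> and \<open>- M\<close>: each half is in the domain, and
  its image stays in the corresponding range.\<close>

lemma E_graph:
  assumes "(u, v) \<in> S" and M: "M \<in> sets borel"
  shows "(E M u, E M v) \<in> S"
proof -
  \<comment> \<open>By \<open>form_orth\<close> the image \<open>a\<close> is orthogonal to all
    domain vectors in the range of \<open>E (- N)\<close>; symmetry of \<open>E (- N)\<close> and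
    density of the domain do the rest.\<close>
  have key: "E (- N) a = 0" if N: "N \<in> sets borel" and a: "(E N u, a) \<in> S" for N a
  proof -
    have N': "- N \<in> sets borel" using N by (simp add: borel_comp)
    have uH: "u \<in> H" "a \<in> H" using assms a graph_in by auto
    show ?thesis
    proof (rule orth_dom)
      fix w z assume wz: "(w, z) \<in> S"
      then have "E (- N) w \<in> Domain S" using E_dom N' by blast
      then obtain z' where z': "(E (- N) w, z') \<in> S" by auto
      have "inner a (E (- N) w) = 0"
        by (rule form_orth[OF a z' N]) (use wz graph_in uH N N' E_idem in auto)
      then show "inner (E (- N) a) w = 0"
        using E_sym N' uH wz graph_in by metis
    qed (use uH N' E_in in auto)
  qed
  have M': "- M \<in> sets borel" using M by (simp add: borel_comp)
  have uv: "u \<in> H" "v \<in> H" using assms graph_in by auto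
  obtain a where a: "(E M u, a) \<in> S" using E_dom[of M u] assms by auto
  obtain a' where a': "(E (- M) u, a') \<in> S" using E_dom[of "- M" u] assms M' by auto
  have aH: "a \<in> H" "a' \<in> H" using a a' graph_in by auto
  have "v = a + a'"
    using graph_unique[OF assms(1)] graph_add[OF a a'] E_Compl[OF M uv(1)] by auto
  then have "E M v = E M a + E M a'" using aH M E_add by auto
  also have "E M a' = 0" using key[OF M' a'] by simp
  also have "E M a = a" using key[OF M a] E_Compl[OF M aH(1)] by simp
  finally show ?thesis using a by simp
qed

text \<open>On the truncated parts the operator is bounded; this limit transfers estimates proved
  there to the whole negative subspace.\<close>

lemma E_lim:
  assumes "u \<in> H"
  shows "(\<lambda>m. E {- real m..<0} u) \<longlonglongrightarrow> E {..<0} u"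
proof -
  let ?N = "\<lambda>n::nat. {- real (Suc n)..<- real n}"
  have "(\<lambda>n. E (?N n) u) sums E (\<Union>n. ?N n) u"
  proof (rule E_sums)
    show "disjoint_family ?N"
      unfolding disjoint_family_on_def
    proof (intro ballI impI)
      fix m n :: nat assume "m \<noteq> n"
      then consider "Suc m \<le> n" | "Suc n \<le> m" by linarith
      then show "?N m \<inter> ?N n = {}" by cases auto
    qed
  qed (use assms in auto)
  moreover have "(\<Union>n. ?N n) = {..<0}"
  proof (intro Set.set_eqI iffI)
    fix x :: real assume "x \<in> {..<0}"
    \<comment> \<open>\<open>- real (n + 1) \<le> x < - real n\<close> says
      \<open>n < - x \<le> n + 1\<close>, that is,
      \<open>\<lceil>- x\<rceil> = n + 1\<close>.\<close>
    then have "x \<in> ?N (nat (\<lceil>- x\<rceil> - 1))"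
      by (auto; linarith)
    then show "x \<in> (\<Union>n. ?N n)" by blast
  qed (auto; linarith)
  moreover have "(\<Sum>n<m. E (?N n) u) = E {- real m..<0} u" for m
  proof (induction m)
    case (Suc m)
    have "{- real (Suc m)..<0} = {- real m..<0} \<union> ?N m" by auto
    moreover have "{- real m..<0} \<inter> ?N m = {}" by auto
    ultimately show ?case
      using Suc E_Un[of "{- real m..<0}" "?N m" u] assms by simp
  qed (use assms E_empty in simp)
  ultimately show ?thesis unfolding sums_def by simp
qed

end

section \<open>Tools from Hilbert space geometry, linear algebra and topology\<close>

text \<open>The nearest point argument: a minimizing sequence is Cauchy by the parallelogram
  identity. Completeness is asked of \<open>M\<close> alone, since the lemma is applied to the range
  of an operator inside an arbitrary inner product space.\<close>

lemma orthogonal_projection_exists: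
  fixes M :: "'a::real_inner set"
  assumes "complete M" "subspace M"
  obtains m where "m \<in> M" "\<And>x. x \<in> M \<Longrightarrow> inner (w - m) x = 0"
proof -
  define d where "d = Inf ((\<lambda>x. (norm (w - x))\<^sup>2) ` M)"
  have ne: "M \<noteq> {}" using subspace_0[OF assms(2)] by auto
  have d_le: "d \<le> (norm (w - x))\<^sup>2" if "x \<in> M" for x
    unfolding d_def by (rule cINF_lower) (use that in \<open>auto intro!: bdd_belowI[of _ 0]\<close>)
  have "\<exists>x\<in>M. (norm (w - x))\<^sup>2 < d + 1 / real (Suc n)" for n
  proof -
    have "\<exists>y\<in>(\<lambda>x. (norm (w - x))\<^sup>2) ` M. y < d + 1 / real (Suc n)"
      unfolding d_def by (rule cInf_lessD) (use ne in auto)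
    then show ?thesis by auto
  qed
  then obtain m where mM: "\<And>n. m n \<in> M" and m: "\<And>n. (norm (w - m n))\<^sup>2 < d + 1 / real (Suc n)"
    by metis
  have close: "(norm (m n - m k))\<^sup>2 \<le> 2 / real (Suc n) + 2 / real (Suc k)" for n k
  proof -
    have "(1/2) *\<^sub>R (m n + m k) \<in> M"
      by (intro subspace_scale subspace_add assms mM)
    then have "d \<le> (norm (w - (1/2) *\<^sub>R (m n + m k)))\<^sup>2" by (rule d_le)
    moreover have "(norm (m n - m k))\<^sup>2 + 4 * (norm (w - (1/2) *\<^sub>R (m n + m k)))\<^sup>2
        = 2 * (norm (w - m n))\<^sup>2 + 2 * (norm (w - m k))\<^sup>2"
      unfolding power2_norm_eq_inner
      by (simp add: inner_diff_left inner_diff_right inner_add_left inner_add_right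
          inner_commute algebra_simps)
    ultimately show ?thesis using m[of n] m[of k] by linarith
  qed
  have "Cauchy m"
  proof (rule metric_CauchyI)
    fix e :: real assume e: "0 < e"
    obtain N where N: "4 / e\<^sup>2 < real (Suc N)"
      by (meson Suc_n_not_le_n less_le_trans of_nat_le_iff not_less reals_Archimedean2 order.strict_trans of_nat_less_iff lessI)
    have "dist (m n) (m k) < e" if "N \<le> n" "N \<le> k" for n k
    proof -
      have "2 / real (Suc n) \<le> 2 / real (Suc N)" "2 / real (Suc k) \<le> 2 / real (Suc N)"
        using that by (auto intro!: divide_left_mono)
      then have "(norm (m n - m k))\<^sup>2 \<le> 4 / real (Suc N)" using close[of n k] by simp
      also have "\<dots> < e\<^sup>2" using N e by (simp add: field_simps)
      finally show ?thesis using e by (simp add: dist_norm power_less_imp_less_base)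
    qed
    then show "\<exists>N. \<forall>n\<ge>N. \<forall>k\<ge>N. dist (m n) (m k) < e" by blast
  qed
  then obtain a where a: "a \<in> M" "m \<longlonglongrightarrow> a"
    using assms(1) mM unfolding complete_def by metis
  have "(norm (w - a))\<^sup>2 \<le> d"
  proof (rule LIMSEQ_le)
    show "(\<lambda>n. (norm (w - m n))\<^sup>2) \<longlonglongrightarrow> (norm (w - a))\<^sup>2" by (intro tendsto_intros a)
    show "(\<lambda>n. d + 1 / real (Suc n)) \<longlonglongrightarrow> d"
      using tendsto_add[OF tendsto_const[of d] LIMSEQ_inverse_real_of_nat] by (simp add: inverse_eq_divide)
  qed (use m in \<open>auto intro: less_imp_le\<close>)
  then have min: "(norm (w - a))\<^sup>2 \<le> (norm (w - x))\<^sup>2" if "x \<in> M" for x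
    using d_le[OF that] by linarith
  show ?thesis
  proof (rule that[OF a(1)])
    fix x assume x: "x \<in> M"
    show "inner (w - a) x = 0"
    proof (cases "x = 0")
      case False
      \<comment> \<open>Moving from \<open>a\<close> by this optimal multiple of \<open>x\<close>
        shortens the squared distance to \<open>w\<close> by
        \<open>(inner (w - a) x)\<^sup>2 / inner x x\<close>, which must therefore be 0.\<close>
      define t where "t = inner (w - a) x / inner x x"
      have gen: "(norm (v - (inner v x / inner x x) *\<^sub>R x))\<^sup>2 = (norm v)\<^sup>2 - (inner v x)\<^sup>2 / inner x x" for v
      proof -
        have "(norm (v - c *\<^sub>R x))\<^sup>2 = (norm v)\<^sup>2 - 2 * c * inner v x + c * (c * inner x x)" for c
          unfolding power2_norm_eq_inner
          by (simp add: inner_diff_left inner_diff_right inner_commute[of x v] algebra_simps)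
        from this[of "inner v x / inner x x"] show ?thesis
          using False by (simp add: power2_eq_square)
      qed
      have "a + t *\<^sub>R x \<in> M" by (intro subspace_scale subspace_add assms a x)
      then have "(norm (w - a))\<^sup>2 \<le> (norm ((w - a) - t *\<^sub>R x))\<^sup>2"
        using min[of "a + t *\<^sub>R x"] by (simp add: diff_diff_add)
      also have "\<dots> = (norm (w - a))\<^sup>2 - (inner (w - a) x)\<^sup>2 / inner x x"
        unfolding t_def by (rule gen)
      finally have "(inner (w - a) x)\<^sup>2 / inner x x \<le> 0" by simp
      moreover have "inner x x > 0" using False by simp
      ultimately have "(inner (w - a) x)\<^sup>2 \<le> 0" by (simp add: divide_le_0_iff)
      then show ?thesis by simp
    qed simp
  qed
qed

text \<open>Steinitz exchange modulo \<open>B\<close>, which may be infinite. A finite part of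
  \<open>T\<close> needs only a finite \<open>B0 \<subseteq> B\<close> besides \<open>F\<close>; the
  usual count with \<open>B0\<close> on both sides then cancels \<open>card B0\<close>.\<close>

lemma independent_mod_card:
  fixes B T F :: "'a::real_vector set"
  assumes ind: "independent (B \<union> T)" and d: "B \<inter> T = {}" and sp: "T \<subseteq> span (B \<union> F)" and F: "finite F"
  shows "finite T \<and> card T \<le> card F"
proof -
  have *: "card T' \<le> card F" if T': "finite T'" "T' \<subseteq> T" for T'
  proof -
    have "\<exists>B0. finite B0 \<and> B0 \<subseteq> B \<and> T' \<subseteq> span (B0 \<union> F)"
      using T'
    proof (induction T' rule: finite_induct)
      case (insert x T')
      then obtain B0 where B0: "finite B0" "B0 \<subseteq> B" "T' \<subseteq> span (B0 \<union> F)" by auto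
      obtain t r where t: "finite t" "t \<subseteq> B \<union> F" "x = (\<Sum>a\<in>t. r a *\<^sub>R a)"
      proof -
        have "x \<in> span (B \<union> F)" using sp insert.prems by (simp add: subset_iff)
        then show thesis using that unfolding span_explicit by auto
      qed
      let ?B = "(B0 \<union> (t \<inter> B)) \<union> F"
      have "x \<in> span t"
        by (subst t(3), rule span_sum, rule span_scale, rule span_base)
      moreover have "t \<subseteq> ?B" "B0 \<union> F \<subseteq> ?B" using t(2) by auto
      then have "span t \<subseteq> span ?B" "span (B0 \<union> F) \<subseteq> span ?B" by (simp_all only: span_mono)
      ultimately have "insert x T' \<subseteq> span ?B"
        using B0(3) by (simp add: subset_iff)
      then show ?case using B0 t by (intro exI[of _ "B0 \<union> (t \<inter> B)"] conjI) simp_all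
    qed auto
    then obtain B0 where B0: "finite B0" "B0 \<subseteq> B" "T' \<subseteq> span (B0 \<union> F)" by auto
    have "independent (B0 \<union> T')"
      using ind by (rule independent_mono) (use B0 T' in auto)
    moreover have "B0 \<union> T' \<subseteq> span (B0 \<union> F)"
      using B0(3) span_superset by blast
    ultimately have "card (B0 \<union> T') \<le> card (B0 \<union> F)"
      using independent_span_bound[of "B0 \<union> F" "B0 \<union> T'"] B0 F by auto
    moreover have "card (B0 \<union> T') = card B0 + card T'"
      by (rule card_Un_disjoint) (use B0 T' d in auto)
    moreover have "card (B0 \<union> F) \<le> card B0 + card F" by (rule card_Un_le)
    ultimately show ?thesis by simp
  qed
  have "finite T"
  proof (rule ccontr)
    assume "infinite T"
    then obtain T' where "T' \<subseteq> T" "finite T'" "card T' = Suc (card F)"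
      by (metis infinite_arbitrarily_large)
    then show False using *[of T'] by simp
  qed
  then show ?thesis using *[of T] by simp
qed

text \<open>The form is a parameter because the argument is applied to the inner product and, on
  finite-dimensional subspaces of the domain, to \<open>\<sigma> * inner (C.app x) y\<close> with a
  sign \<open>\<sigma>\<close>.\<close>

locale posdef_form =
  fixes V :: "'a::real_inner set" and q :: "'a \<Rightarrow> 'a \<Rightarrow> real"
  assumes V: "subspace V"
    and q_add: "\<And>x y z. x \<in> V \<Longrightarrow> y \<in> V \<Longrightarrow> z \<in> V \<Longrightarrow> q (x + y) z = q x z + q y z"
    and q_scale: "\<And>c x y. x \<in> V \<Longrightarrow> y \<in> V \<Longrightarrow> q (c *\<^sub>R x) y = c * q x y"
    and q_sym: "\<And>x y. x \<in> V \<Longrightarrow> y \<in> V \<Longrightarrow> q x y = q y x"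
    and q_pos: "\<And>x. x \<in> V \<Longrightarrow> x \<noteq> 0 \<Longrightarrow> 0 < q x x"
begin

lemma q_sum:
  assumes "finite B" "B \<subseteq> V" "y \<in> V"
  shows "q (\<Sum>b\<in>B. \<alpha> b *\<^sub>R b) y = (\<Sum>b\<in>B. \<alpha> b * q b y)"
  using assms(1,2)
proof (induction B rule: finite_induct)
  case empty
  show ?case using q_scale[of 0 y 0] subspace_0[OF V] assms(3) by simp
next
  case (insert x B)
  then show ?case
    using assms(3) by (simp add: q_add q_scale V subspace_scale subspace_sum subset_iff)
qed

lemma orthonormal_basis:
  assumes "finite F" "F \<subseteq> V"
  obtains B where "finite B" "B \<subseteq> V" "span B = span F"
    "\<And>b. b \<in> B \<Longrightarrow> q b b = 1" "\<And>b c. b \<in> B \<Longrightarrow> c \<in> B \<Longrightarrow> b \<noteq> c \<Longrightarrow> q b c = 0"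
proof -
  have "\<exists>B. finite B \<and> B \<subseteq> V \<and> span B = span F \<and> (\<forall>b\<in>B. q b b = 1) \<and>
      (\<forall>b\<in>B. \<forall>c\<in>B. b \<noteq> c \<longrightarrow> q b c = 0)"
    using assms
  proof (induction F rule: finite_induct)
    case empty
    show ?case by (rule exI[of _ "{}"]) auto
  next
    case (insert a F)
    then obtain B where B: "finite B" "B \<subseteq> V" "span B = span F" "\<And>b. b \<in> B \<Longrightarrow> q b b = 1"
      "\<And>b c. b \<in> B \<Longrightarrow> c \<in> B \<Longrightarrow> b \<noteq> c \<Longrightarrow> q b c = 0" by auto
    have aV: "a \<in> V" using insert by auto
    define p where "p = (\<Sum>b\<in>B. q a b *\<^sub>R b)"
    define r where "r = a - p"
    have pB: "p \<in> span B" unfolding p_def by (intro span_sum span_scale span_base)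
    have pV: "p \<in> V" unfolding p_def using B V by (intro subspace_sum subspace_scale) auto
    have rV: "r \<in> V" unfolding r_def using aV pV V by (rule subspace_diff[rotated])
    have rb: "q r b = 0" if "b \<in> B" for b
    proof -
      have "q p b = (\<Sum>c\<in>B. q a c * q c b)"
        unfolding p_def using B that by (intro q_sum) auto
      also have "\<dots> = (\<Sum>c\<in>B. if c = b then q a b else 0)"
        using B(4,5) that by (intro sum.cong) auto
      also have "\<dots> = q a b" using B(1) that by simp
      finally have "q p b = q a b" .
      moreover have "q a b = q r b + q p b"
        using q_add[OF rV pV, of b] that B(2) unfolding r_def by auto
      ultimately show ?thesis by simp
    qed
    have sp: "span (insert r B) = span (insert a F)"
    proof -
      have "span (insert r B) = span (insert a B)"
        by (rule eq_span_insert_eq) (use span_neg[OF pB] in \<open>simp add: r_def\<close>)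
      also have "\<dots> = span (insert a F)" using B(3) by (simp add: span_insert)
      finally show ?thesis .
    qed
    show ?case
    proof (cases "r = 0")
      case True
      then have "span B = span (insert a F)" using sp by simp
      then show ?thesis using B by (intro exI[of _ B]) auto
    next
      case False
      define s where "s = (1 / sqrt (q r r)) *\<^sub>R r"
      have qr: "0 < q r r" using q_pos[OF rV False] .
      have sV: "s \<in> V" unfolding s_def using rV V by (rule subspace_scale[rotated])
      have "q s s = (1 / sqrt (q r r)) * q r s" unfolding s_def using q_scale rV sV s_def by simp
      also have "q r s = (1 / sqrt (q r r)) * q r r"
        using q_sym[OF rV sV] q_scale[OF rV rV] s_def by simp
      finally have ss: "q s s = 1" using qr by (simp add: field_simps)
      have sb: "q s b = 0" if "b \<in> B" for b
        unfolding s_def using q_scale[of r b] rV rb[OF that] B(2) that by auto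
      have bs: "q b s = 0" if "b \<in> B" for b
        using q_sym[OF sV, of b] sb[OF that] B(2) that by auto
      have "span (insert s B) = span (insert r B)"
      proof (intro subset_antisym span_minimal subspace_span insert_subsetI)
        show "s \<in> span (insert r B)" unfolding s_def by (intro span_scale span_base) auto
        have "r = sqrt (q r r) *\<^sub>R s" unfolding s_def using qr by simp
        then show "r \<in> span (insert s B)" by (metis span_scale span_base insertI1)
      qed (auto intro: span_base)
      then have "span (insert s B) = span (insert a F)" using sp by simp
      then show ?thesis using B ss sb bs sV by (intro exI[of _ "insert s B"]) auto
    qed
  qed
  then show ?thesis using that by auto
qed

lemma bounded_below:
  assumes "finite F" "F \<subseteq> V"
  obtains c where "0 < c" "\<And>x. x \<in> span F \<Longrightarrow> c * (norm x)\<^sup>2 \<le> q x x"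
proof -
  obtain B where B: "finite B" "B \<subseteq> V" "span B = span F" "\<And>b. b \<in> B \<Longrightarrow> q b b = 1"
    "\<And>b c. b \<in> B \<Longrightarrow> c \<in> B \<Longrightarrow> b \<noteq> c \<Longrightarrow> q b c = 0"
    using orthonormal_basis[OF assms] by metis
  \<comment> \<open>In \<open>q\<close>-orthonormal coordinates \<open>q x x\<close> is the sum of
    the squared coefficients, and Cauchy-Schwarz gives \<open>(norm x)\<^sup>2 \<le> q x x *
    (\<Sum>b\<in>B. (norm b)\<^sup>2)\<close>; the 1 keeps \<open>K\<close> positive when
    \<open>B\<close> is empty.\<close>
  define K where "K = 1 + (\<Sum>b\<in>B. (norm b)\<^sup>2)"
  have K: "K > 0" unfolding K_def by (intro add_pos_nonneg sum_nonneg) auto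
  have "(1 / K) * (norm x)\<^sup>2 \<le> q x x" if "x \<in> span F" for x
  proof -
    have "x \<in> range (\<lambda>\<alpha>. \<Sum>b\<in>B. \<alpha> b *\<^sub>R b)"
      using that B(3) span_finite[OF B(1)] by simp
    then obtain \<alpha> where x: "x = (\<Sum>b\<in>B. \<alpha> b *\<^sub>R b)"
      by (rule rangeE)
    have xV: "x \<in> V" unfolding x using B V by (intro subspace_sum subspace_scale) auto
    have qb: "q b x = \<alpha> b" if b: "b \<in> B" for b
    proof -
      have "q b x = q x b" using q_sym xV B b by auto
      also have "\<dots> = (\<Sum>c\<in>B. \<alpha> c * q c b)" unfolding x using B b by (intro q_sum) auto
      also have "\<dots> = (\<Sum>c\<in>B. if c = b then \<alpha> b else 0)"
        using B b by (intro sum.cong) auto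
      also have "\<dots> = \<alpha> b" using B(1) b by simp
      finally show ?thesis .
    qed
    have "q x x = (\<Sum>b\<in>B. \<alpha> b * q b x)" by (subst x) (use q_sum B xV in auto)
    also have "\<dots> = (\<Sum>b\<in>B. (\<alpha> b)\<^sup>2)" using qb by (auto simp: power2_eq_square)
    finally have q: "q x x = (\<Sum>b\<in>B. (\<alpha> b)\<^sup>2)" .
    have "norm x \<le> (\<Sum>b\<in>B. \<bar>\<alpha> b\<bar> * norm b)"
      unfolding x by (rule order_trans[OF norm_sum]) simp
    also have "\<dots> \<le> L2_set \<alpha> B * L2_set norm B"
      using L2_set_mult_ineq[of \<alpha> norm B] by simp
    finally have "(norm x)\<^sup>2 \<le> (L2_set \<alpha> B * L2_set norm B)\<^sup>2" by (simp add: power_mono)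
    also have "\<dots> = q x x * (\<Sum>b\<in>B. (norm b)\<^sup>2)"
      unfolding q by (simp add: power_mult_distrib L2_set_def sum_nonneg)
    also have "\<dots> \<le> q x x * K"
      unfolding K_def q by (intro mult_left_mono sum_nonneg) auto
    finally show ?thesis using K by (simp add: field_simps)
  qed
  then show ?thesis using that[of "1 / K"] K by auto
qed

end

text \<open>Without a fixed point the identity of the sphere would be homotopic to a constant map,
  through normalized values of \<open>y - s \<phi>(y)\<close>: first the radius of \<open>y\<close>
  grows from 0 to \<open>R\<close> with \<open>s = 1\<close>, then \<open>s\<close> falls to 0 at
  radius \<open>R\<close>.\<close>

lemma brouwer_Euclidean_space:
  fixes \<phi> :: "(nat \<Rightarrow> real) \<Rightarrow> nat \<Rightarrow> real"
  assumes cont: "continuous_on (topspace (Euclidean_space n)) \<phi>"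
    and maps: "\<And>x. x \<in> topspace (Euclidean_space n) \<Longrightarrow> \<phi> x \<in> topspace (Euclidean_space n)"
    and bd: "\<And>x. x \<in> topspace (Euclidean_space n) \<Longrightarrow> (\<Sum>i<n. (\<phi> x i)\<^sup>2) < R\<^sup>2"
    and R: "R > 0"
  obtains x where "x \<in> topspace (Euclidean_space n)" "\<phi> x = x"
proof (cases n)
  \<comment> \<open>\<open>nsphere p\<close> lies in \<open>Suc p\<close> coordinates, so the sphere
    argument needs \<open>n > 0\<close>; for \<open>n = 0\<close> the space is a single
    point.\<close>
  case 0
  then show ?thesis
    using that maps by (force simp: topspace_Euclidean_space)
next
  case (Suc p)
  show ?thesis
  proof (rule ccontr)
    assume "\<not> thesis"
    then have nofix: "\<phi> x \<noteq> x" if "x \<in> topspace (Euclidean_space n)" for x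
      using that \<open>\<not> thesis\<close> \<open>\<And>x. x \<in> topspace (Euclidean_space n) \<Longrightarrow> \<phi> x = x \<Longrightarrow> thesis\<close> by blast
    let ?E = "{x::nat \<Rightarrow> real. \<forall>i\<ge>n. x i = 0}"
    define S where "S = {x::nat \<Rightarrow> real. (\<Sum>i\<le>p. (x i)\<^sup>2) = 1 \<and> (\<forall>i>p. x i = 0)}"
    have E: "topspace (Euclidean_space n) = ?E" by (simp add: topspace_Euclidean_space)
    have sph: "nsphere p = top_of_set S"
      unfolding nsphere S_def euclidean_product_topology ..
    define P where "P = {0..1::real} \<times> S"
    define y where "y z i = R * min 1 (2 * fst z) * snd z i" for z :: "real \<times> (nat \<Rightarrow> real)" and i :: nat
    define K where "K z i = y z i - min 1 (2 - 2 * fst z) * \<phi> (y z) i" for z i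
    define N where "N z = sqrt (\<Sum>i\<le>p. (K z i)\<^sup>2)" for z
    define h where "h z i = K z i / N z" for z i
    have yE: "y z \<in> ?E" if "z \<in> P" for z
      using that Suc by (auto simp: y_def P_def S_def)
    have cy: "continuous_on P y"
      unfolding y_def
      by (intro continuous_on_coordinatewise_then_product continuous_intros
          continuous_on_compose2[OF continuous_on_product_coordinates continuous_on_snd[OF continuous_on_id]]) auto
    have c\<phi>: "continuous_on P (\<lambda>z. \<phi> (y z) i)" for i
      by (rule continuous_on_compose2[OF continuous_on_product_coordinates], 
          rule continuous_on_compose2[OF cont cy]) (use yE E in auto)
    have cyi: "continuous_on P (\<lambda>z. y z i)" for i
      by (rule continuous_on_compose2[OF continuous_on_product_coordinates cy]) auto
    have cK: "continuous_on P (\<lambda>z. K z i)" for i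
      unfolding K_def by (intro continuous_intros c\<phi> cyi)
    have KE: "K z \<in> ?E" if "z \<in> P" for z
      using yE[OF that] maps[of "y z"] E by (auto simp: K_def)
    have K0: "K z \<noteq> (\<lambda>i. 0)" if z: "z \<in> P" for z
    proof
      assume eq: "K z = (\<lambda>i. 0)"
      show False
      proof (cases "fst z \<le> 1/2")
        case True
        then have "\<phi> (y z) = y z"
          using eq by (auto simp: K_def fun_eq_iff min_def split: if_splits)
        then show False using nofix yE[OF z] E by auto
      next
        case False
        \<comment> \<open>At radius \<open>R\<close> the vector \<open>y z\<close> is longer than
          every value of \<open>\<phi>\<close>, so it is not a multiple \<open>s \<phi>(y z)\<close>
          with \<open>0 \<le> s \<le> 1\<close>.\<close>
        then have yz: "y z = (\<lambda>i. R * snd z i)" by (auto simp: y_def)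
        define s where "s = min 1 (2 - 2 * fst z)"
        have s: "0 \<le> s" "s \<le> 1" using z by (auto simp: s_def P_def)
        have "y z i = s * \<phi> (y z) i" for i
          using fun_cong[OF eq, of i] by (simp add: K_def s_def)
        then have "(\<Sum>i<n. (y z i)\<^sup>2) = s\<^sup>2 * (\<Sum>i<n. (\<phi> (y z) i)\<^sup>2)"
          by (simp add: sum_distrib_left power_mult_distrib)
        also have "\<dots> \<le> 1 * (\<Sum>i<n. (\<phi> (y z) i)\<^sup>2)"
          using s by (intro mult_right_mono sum_nonneg) (auto simp: power_le_one)
        also have "\<dots> < R\<^sup>2" using bd[of "y z"] yE[OF z] E by auto
        also have "R\<^sup>2 = (\<Sum>i<n. (y z i)\<^sup>2)"
          using z Suc unfolding yz P_def S_def
          by (auto simp: power_mult_distrib sum_distrib_left[symmetric] lessThan_Suc_atMost)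
        finally show False by simp
      qed
    qed
    have Npos: "N z > 0" if z: "z \<in> P" for z
    proof -
      obtain i where i: "K z i \<noteq> 0" using K0[OF z] by auto
      then have "i \<le> p" using KE[OF z] Suc by (metis (mono_tags, lifting) mem_Collect_eq not_less_eq_eq)
      then have "(\<Sum>i\<le>p. (K z i)\<^sup>2) > 0" using i by (intro sum_pos2[of _ i]) auto
      then show ?thesis by (simp add: N_def)
    qed
    have ch: "continuous_on P h"
      unfolding h_def
    proof (intro continuous_on_coordinatewise_then_product continuous_on_divide cK)
      show "continuous_on P N" unfolding N_def by (intro continuous_intros cK)
      show "\<forall>z\<in>P. N z \<noteq> 0" using Npos by force
    qed
    have hS: "h z \<in> S" if z: "z \<in> P" for z
    proof -
      have "(\<Sum>i\<le>p. (h z i)\<^sup>2) = (\<Sum>i\<le>p. (K z i)\<^sup>2) / (N z)\<^sup>2"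
        by (simp add: h_def power_divide sum_divide_distrib)
      also have "(N z)\<^sup>2 = (\<Sum>i\<le>p. (K z i)\<^sup>2)" by (simp add: N_def sum_nonneg)
      finally have "(\<Sum>i\<le>p. (h z i)\<^sup>2) = 1"
        using Npos[OF z] by (simp add: N_def)
      moreover have "\<forall>i>p. h z i = 0" using KE[OF z] Suc by (auto simp: h_def)
      ultimately show ?thesis by (simp add: S_def)
    qed
    have h1: "h (1, x) = x" if x: "x \<in> S" for x
    proof -
      have "K (1, x) = (\<lambda>i. R * x i)" by (auto simp: K_def y_def)
      moreover from this have "N (1, x) = R"
        using x R by (simp add: N_def power_mult_distrib sum_distrib_left[symmetric] S_def)
      ultimately show ?thesis using R by (auto simp: h_def)
    qed
    have h0: "h (0, x) = h (0, x')" for x x'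
    proof -
      have "y (0, x) = y (0, x')" by (simp add: y_def fun_eq_iff)
      then have "K (0, x) = K (0, x')" by (auto simp: K_def)
      then show ?thesis by (auto simp: h_def N_def)
    qed
    have "homotopic_with (\<lambda>x. True) (nsphere p) (nsphere p) (\<lambda>x. h (0, \<lambda>_. 0)) id"
    proof (subst homotopic_with)
      show "\<exists>k. continuous_map (prod_topology (top_of_set {0..1::real}) (nsphere p)) (nsphere p) k \<and>
        (\<forall>x\<in>topspace (nsphere p). k (0, x) = h (0, \<lambda>_. 0)) \<and>
        (\<forall>x\<in>topspace (nsphere p). k (1, x) = id x) \<and> (\<forall>t\<in>{0..1::real}. True)"
      proof (intro exI conjI)
        show "continuous_map (prod_topology (top_of_set {0..1::real}) (nsphere p)) (nsphere p) h"
          unfolding sph prod_topology_subtopology_eu using ch hS by (auto simp: P_def)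
        show "\<forall>x\<in>topspace (nsphere p). h (0, x) = h (0, \<lambda>_. 0)" using h0 by blast
        show "\<forall>x\<in>topspace (nsphere p). h (1, x) = id x" using h1 by (simp add: sph)
      qed auto
    qed auto
    then have "contractible_space (nsphere p)"
      unfolding contractible_space_def using homotopic_with_symD by blast
    then show False using non_contractible_space_nsphere by blast
  qed
qed

section \<open>Maps that are linear on a subspace and arbitrary outside it\<close>

definition linear_within :: "'a::real_vector set \<Rightarrow> ('a \<Rightarrow> 'b::real_vector) \<Rightarrow> bool" where
  "linear_within V f \<longleftrightarrow> subspace V \<and> (\<forall>x\<in>V. \<forall>y\<in>V. f (x + y) = f x + f y) \<and>
     (\<forall>c. \<forall>x\<in>V. f (c *\<^sub>R x) = c *\<^sub>R f x)"

context
  fixes V :: "'a::real_vector set" and f :: "'a \<Rightarrow> 'b::real_vector"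
  assumes lin: "linear_within V f"
begin

lemma linear_within_subspace: "subspace V"
  and linear_within_add: "x \<in> V \<Longrightarrow> y \<in> V \<Longrightarrow> f (x + y) = f x + f y"
  and linear_within_scale: "x \<in> V \<Longrightarrow> f (c *\<^sub>R x) = c *\<^sub>R f x"
  using lin unfolding linear_within_def by blast+

lemma linear_within_0: "f 0 = 0"
  using linear_within_scale[OF subspace_0[OF linear_within_subspace], of 0] by simp

lemma linear_within_diff: "x \<in> V \<Longrightarrow> y \<in> V \<Longrightarrow> f (x - y) = f x - f y"
  using linear_within_add[of x "-1 *\<^sub>R y"] linear_within_scale[of y "-1"]
    subspace_scale[OF linear_within_subspace, of y "-1"] by simp

lemma linear_within_sum:
  assumes "finite S" "g ` S \<subseteq> V"
  shows "f (\<Sum>s\<in>S. \<alpha> s *\<^sub>R g s) = (\<Sum>s\<in>S. \<alpha> s *\<^sub>R f (g s))"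
  using assms
proof (induction S rule: finite_induct)
  case (insert x S)
  have "(\<Sum>s\<in>S. \<alpha> s *\<^sub>R g s) \<in> V" "\<alpha> x *\<^sub>R g x \<in> V" "g x \<in> V"
    using insert.prems linear_within_subspace
    by (auto intro!: subspace_sum subspace_scale)
  then show ?case
    using insert by (simp add: linear_within_add linear_within_scale)
qed (simp add: linear_within_0)

lemma linear_within_span:
  assumes "S \<subseteq> V" "x \<in> span S"
  shows "f x \<in> span (f ` S)"
proof -
  have "x \<in> V \<and> f x \<in> span (f ` S)"
    using assms(2)
  proof (induction rule: span_induct_alt)
    case base
    show ?case using linear_within_0 linear_within_subspace subspace_0 span_0 by metis
  next
    case (step c x y)
    have x: "x \<in> V" using step(1) assms(1) by (rule subsetD[rotated])
    have "c *\<^sub>R x \<in> V" using linear_within_subspace x by (rule subspace_scale)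
    then show ?case
      using step x linear_within_subspace
      by (simp add: linear_within_add linear_within_scale subspace_add span_add span_scale span_base)
  qed
  then show ?thesis ..
qed

lemma linear_within_span_surj:
  assumes "S \<subseteq> V" "y \<in> span (f ` S)"
  obtains x where "x \<in> span S" "f x = y"
proof -
  have sV: "span S \<subseteq> V" using assms(1) linear_within_subspace by (rule span_minimal)
  have "\<exists>x\<in>span S. f x = y"
    using assms(2)
  proof (induction rule: span_induct_alt)
    case base
    show ?case using linear_within_0 span_0 by (intro bexI[of _ 0])
  next
    case (step c z y)
    obtain s where s: "s \<in> S" "z = f s" using step(1) by (rule imageE)
    obtain x where x: "x \<in> span S" "f x = y" using step(2) by (elim bexE)
    have "c *\<^sub>R s \<in> span S" using s by (intro span_scale span_base)
    moreover have "s \<in> V" "c *\<^sub>R s \<in> V" "x \<in> V"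
      using sV x(1) s(1) assms(1) calculation by (simp_all add: subset_iff)
    ultimately show ?case
      using s x by (intro bexI[of _ "c *\<^sub>R s + x"]) (simp_all add: linear_within_add linear_within_scale span_add)
  qed
  then show ?thesis using that by (elim bexE)
qed

lemma linear_within_image_subspace:
  assumes "subspace U" "U \<subseteq> V" shows "subspace (f ` U)"
  unfolding subspace_def
proof (intro conjI ballI allI)
  show "0 \<in> f ` U"
    by (rule image_eqI[of _ f 0]) (simp_all add: linear_within_0 subspace_0[OF assms(1)])
  show "x + y \<in> f ` U" if x: "x \<in> f ` U" and y: "y \<in> f ` U" for x y
  proof -
    obtain p q where pq: "p \<in> U" "q \<in> U" "x = f p" "y = f q" using x y by auto
    then have "x + y = f (p + q)"
      using linear_within_add[OF subsetD[OF assms(2) pq(1)] subsetD[OF assms(2) pq(2)]] by simp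
    then show ?thesis using subspace_add[OF assms(1) pq(1,2)] by simp
  qed
  show "c *\<^sub>R x \<in> f ` U" if x: "x \<in> f ` U" for c x
  proof -
    obtain p where p: "p \<in> U" "x = f p" using x by auto
    then have "c *\<^sub>R x = f (c *\<^sub>R p)"
      using linear_within_scale[OF subsetD[OF assms(2) p(1)]] by simp
    then show ?thesis using subspace_scale[OF assms(1) p(1)] by simp
  qed
qed

lemma linear_within_independent_image:
  assumes "finite S" "S \<subseteq> V" "independent S" "\<And>x. x \<in> span S \<Longrightarrow> f x = 0 \<Longrightarrow> x = 0"
  shows "independent (f ` S) \<and> card (f ` S) = card S"
proof -
  have sV: "span S \<subseteq> V" using assms(2) linear_within_subspace by (rule span_minimal)
  have inj: "inj_on f S"
  proof (rule inj_onI)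
    fix x y assume xy: "x \<in> S" "y \<in> S" "f x = f y"
    then have "x \<in> V" "y \<in> V" using assms(2) by (simp_all add: subset_iff)
    then have "f (x - y) = 0" using xy(3) by (simp add: linear_within_diff)
    moreover have "x - y \<in> span S" using xy by (intro span_diff span_base)
    ultimately show "x = y" using assms(4)[of "x - y"] by simp
  qed
  have "independent (f ` S)"
  proof
    assume "dependent (f ` S)"
    then obtain u v where u: "v \<in> f ` S" "u v \<noteq> 0" "(\<Sum>v\<in>f ` S. u v *\<^sub>R v) = 0"
      using dependent_finite[of "f ` S"] assms(1) by auto
    have "(\<Sum>v\<in>f ` S. u v *\<^sub>R v) = (\<Sum>s\<in>S. u (f s) *\<^sub>R f s)"
      using inj by (simp add: sum.reindex)
    then have "f (\<Sum>s\<in>S. u (f s) *\<^sub>R s) = 0"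
      using u(3) linear_within_sum[OF assms(1), of "\<lambda>s. s" "\<lambda>s. u (f s)"] assms(2) by simp
    moreover have "(\<Sum>s\<in>S. u (f s) *\<^sub>R s) \<in> span S" by (intro span_sum span_scale) (rule span_base)
    ultimately have "(\<Sum>s\<in>S. u (f s) *\<^sub>R s) = 0" using assms(4) by simp
    then have "\<forall>s\<in>S. u (f s) = 0"
      using assms(3) dependent_finite[OF assms(1)] by auto
    then show False using u(1,2) by auto
  qed
  then show ?thesis using card_image[OF inj] by simp
qed

end

lemma independent_Un_direct:
  fixes S T :: "'a::real_vector set"
  assumes "finite S" "finite T" "independent S" "independent T"
    and "\<And>x y. x \<in> span S \<Longrightarrow> y \<in> span T \<Longrightarrow> x + y = 0 \<Longrightarrow> x = 0 \<and> y = 0"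
  shows "independent (S \<union> T) \<and> S \<inter> T = {}"
proof -
  have d: "S \<inter> T = {}"
  proof (rule ccontr)
    assume "S \<inter> T \<noteq> {}"
    then obtain x where x: "x \<in> S" "x \<in> T" by auto
    then have "x = 0" using assms(5)[of x "-x"] by (simp add: span_base span_neg)
    then show False using x assms(3) dependent_zero by auto
  qed
  have "independent (S \<union> T)"
  proof
    assume "dependent (S \<union> T)"
    then obtain u v where u: "v \<in> S \<union> T" "u v \<noteq> 0" "(\<Sum>v\<in>S \<union> T. u v *\<^sub>R v) = 0"
      using dependent_finite[of "S \<union> T"] assms(1,2) by auto
    have "(\<Sum>v\<in>S. u v *\<^sub>R v) + (\<Sum>v\<in>T. u v *\<^sub>R v) = 0"
      using u(3) d assms(1,2) by (simp add: sum.union_disjoint)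
    moreover have "(\<Sum>v\<in>S. u v *\<^sub>R v) \<in> span S" "(\<Sum>v\<in>T. u v *\<^sub>R v) \<in> span T"
      by (intro span_sum span_scale, rule span_base, assumption)+
    ultimately have "(\<Sum>v\<in>S. u v *\<^sub>R v) = 0 \<and> (\<Sum>v\<in>T. u v *\<^sub>R v) = 0"
      using assms(5) by blast
    then have "\<forall>v\<in>S. u v = 0" "\<forall>v\<in>T. u v = 0"
      using assms(3,4) dependent_finite[OF assms(1)] dependent_finite[OF assms(2)] by auto
    then show False using u(1,2) by auto
  qed
  then show ?thesis using d by simp
qed

lemma span_projection_exists:
  fixes F :: "'a::real_inner set"
  assumes "finite F"
  obtains m where "m \<in> span F" "\<And>x. x \<in> span F \<Longrightarrow> inner (w - m) x = 0"
proof -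
  interpret posdef_form UNIV "inner :: 'a \<Rightarrow> 'a \<Rightarrow> real"
    by standard (auto simp: inner_add_left intro: inner_commute)
  obtain B where B: "finite B" "span B = span F" "\<And>b. b \<in> B \<Longrightarrow> inner b b = 1"
    "\<And>b c. b \<in> B \<Longrightarrow> c \<in> B \<Longrightarrow> b \<noteq> c \<Longrightarrow> inner b c = 0"
    using orthonormal_basis[OF assms] by (metis UNIV_I subsetI)
  let ?m = "\<Sum>b\<in>B. inner w b *\<^sub>R b"
  show ?thesis
  proof (rule that)
    have "?m \<in> span B" by (intro span_sum span_scale) (rule span_base)
    then show "?m \<in> span F" using B(2) by simp
    fix x assume "x \<in> span F"
    then have "x \<in> span B" using B(2) by simp
    then show "inner (w - ?m) x = 0"
    proof (induction rule: span_induct_alt)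
      case (step c x y)
      have "inner ?m x = (\<Sum>b\<in>B. inner w b * inner b x)" by (simp add: inner_sum_left)
      also have "\<dots> = (\<Sum>b\<in>B. if b = x then inner w x else 0)"
        using B(3,4) step(1) by (intro sum.cong) auto
      also have "\<dots> = inner w x" using B(1) step(1) by simp
      finally have "inner ?m x = inner w x" .
      then show ?case using step(2) by (simp add: inner_diff_left inner_add_right)
    qed simp
  qed
qed

text \<open>Polarization: with \<open>y\<close> the multiple of \<open>f x\<close> of length
  \<open>norm x\<close>, \<open>4 * inner (f x) y\<close> is the difference of the quadratic form at
  \<open>x + y\<close> and at \<open>x - y\<close>, and the parallelogram identity bounds
  it.\<close>

lemma symmetric_norm_bound:
  fixes f :: "'a::real_inner \<Rightarrow> 'a"
  assumes lin: "linear_within V f" and fV: "\<And>x. x \<in> V \<Longrightarrow> f x \<in> V"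
    and sym: "\<And>x y. x \<in> V \<Longrightarrow> y \<in> V \<Longrightarrow> inner (f x) y = inner x (f y)"
    and bd: "\<And>x. x \<in> V \<Longrightarrow> \<bar>inner (f x) x\<bar> \<le> K * (norm x)\<^sup>2"
    and x: "x \<in> V"
  shows "norm (f x) \<le> K * norm x"
proof (cases "x = 0 \<or> f x = 0")
  case True
  have "0 \<le> K * norm x"
  proof (cases "x = 0")
    case False
    then have "0 \<le> K * (norm x)\<^sup>2" using bd[OF x] by linarith
    then show ?thesis using False by (simp add: zero_le_mult_iff)
  qed simp
  then show ?thesis using True linear_within_0[OF lin] by auto
next
  case False
  define y where "y = (norm x / norm (f x)) *\<^sub>R f x"
  have V: "subspace V" using linear_within_subspace[OF lin] .
  have y: "y \<in> V" unfolding y_def using V fV[OF x] by (rule subspace_scale)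
  have ny: "norm y = norm x" unfolding y_def using False by simp
  have xy: "x + y \<in> V" "x - y \<in> V" using V x y by (simp_all add: subspace_add subspace_diff)
  have "4 * inner (f x) y = inner (f (x + y)) (x + y) - inner (f (x - y)) (x - y)"
    using sym[OF x y] linear_within_add[OF lin x y] linear_within_diff[OF lin x y]
    by (simp add: inner_add_left inner_add_right inner_diff_left inner_diff_right inner_commute)
  also have "\<dots> \<le> K * (norm (x + y))\<^sup>2 + K * (norm (x - y))\<^sup>2"
    using bd[OF xy(1)] bd[OF xy(2)] by linarith
  also have "\<dots> = K * (2 * (norm x)\<^sup>2 + 2 * (norm y)\<^sup>2)"
    unfolding power2_norm_eq_inner
    by (simp add: inner_add_left inner_add_right inner_diff_left inner_diff_right algebra_simps)
  finally have "inner (f x) y \<le> K * (norm x)\<^sup>2" using ny by simp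
  moreover have "inner (f x) y = norm x * norm (f x)"
    unfolding y_def using False by (simp add: power2_norm_eq_inner[symmetric] power2_eq_square)
  ultimately show ?thesis using False by (simp add: power2_eq_square mult.assoc mult.left_commute)
qed

lemma bounded_self_adjoint_linear:
  assumes "subspace H" "bounded_self_adjoint_on H B"
  shows "linear_within H B"
  using assms unfolding bounded_self_adjoint_on_def linear_within_def by (elim conjE) (intro conjI)

lemma Ls_norm_bound:
  assumes H: "subspace H" and B: "B \<in> Ls H (- \<beta>) \<beta>" and "\<beta> > 0"
  obtains \<kappa> where "0 \<le> \<kappa>" "\<kappa> < \<beta>" "\<And>u. u \<in> H \<Longrightarrow> norm (B u) \<le> \<kappa> * norm u"
proof -
  obtain d e where d: "d > 0" "positive_definite_on H (\<lambda>u. (\<beta> - d) *\<^sub>R u - B u)"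
    and e: "e > 0" "positive_definite_on H (\<lambda>u. B u - (- \<beta> + e) *\<^sub>R u)"
    and sa: "bounded_self_adjoint_on H B"
    using B unfolding Ls_def by auto
  \<comment> \<open>The smaller of the two margins works on both sides; the maximum with 0 keeps
    \<open>\<kappa>\<close> nonnegative when the margins exceed \<open>\<beta>\<close>.\<close>
  define \<kappa> where "\<kappa> = max 0 (\<beta> - min d e)"
  have lin: "linear_within H B" using bounded_self_adjoint_linear[OF H sa] .
  have bd: "\<bar>inner (B u) u\<bar> \<le> \<kappa> * (norm u)\<^sup>2" if "u \<in> H" for u
  proof (cases "u = 0")
    case False
    have "inner (B u) u < (\<beta> - d) * (norm u)\<^sup>2" "(- \<beta> + e) * (norm u)\<^sup>2 < inner (B u) u"
      using d(2) e(2) that False unfolding positive_definite_on_def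
      by (simp_all add: inner_diff_left power2_norm_eq_inner)
    moreover have "(\<beta> - d) * (norm u)\<^sup>2 \<le> \<kappa> * (norm u)\<^sup>2" "(\<beta> - e) * (norm u)\<^sup>2 \<le> \<kappa> * (norm u)\<^sup>2"
      unfolding \<kappa>_def by (intro mult_right_mono; simp)+
    ultimately show ?thesis by (simp add: abs_le_iff algebra_simps)
  qed simp
  have BH: "B u \<in> H" if "u \<in> H" for u
    using sa that unfolding bounded_self_adjoint_on_def by simp
  have Bs: "inner (B u) v = inner u (B v)" if "u \<in> H" "v \<in> H" for u v
    using sa that unfolding bounded_self_adjoint_on_def by simp
  show ?thesis
  proof (rule that)
    show "norm (B u) \<le> \<kappa> * norm u" if "u \<in> H" for u
      using symmetric_norm_bound[OF lin BH Bs bd that] by simp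
  qed (use assms(3) d(1) e(1) in \<open>auto simp: \<kappa>_def\<close>)
qed

section \<open>Values of a self-adjoint operator and its bounded spectral parts\<close>

context selfadj
begin

definition app :: "'h \<Rightarrow> 'h" where
  "app u = (THE v. (u, v) \<in> S)"

lemma app_eq: "(u, v) \<in> S \<Longrightarrow> app u = v"
  unfolding app_def by (rule the_equality) (auto dest: graph_unique)

lemma app_graph: "u \<in> Domain S \<Longrightarrow> (u, app u) \<in> S"
  using app_eq by auto

lemma dom_in: "u \<in> Domain S \<Longrightarrow> u \<in> H"
  and app_in: "u \<in> Domain S \<Longrightarrow> app u \<in> H"
  using graph_in[OF app_graph] by auto

lemma app_sym: "u \<in> Domain S \<Longrightarrow> v \<in> Domain S \<Longrightarrow> inner (app u) v = inner u (app v)"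
  using sym[OF app_graph app_graph] .

lemma app_linear: "linear_within (Domain S) app"
  unfolding linear_within_def
proof (intro conjI ballI allI)
  show "subspace (Domain S)"
    unfolding subspace_def using graph_0[of 0] graph_add graph_scale by fast
  show "app (u + v) = app u + app v" if "u \<in> Domain S" "v \<in> Domain S" for u v
    using graph_add[OF that[THEN app_graph]] by (rule app_eq)
  show "app (c *\<^sub>R u) = c *\<^sub>R app u" if "u \<in> Domain S" for c u
    using graph_scale[OF that[THEN app_graph]] by (rule app_eq)
qed

lemmas dom_subspace = linear_within_subspace[OF app_linear]
  and app_add = linear_within_add[OF app_linear]
  and app_diff = linear_within_diff[OF app_linear]
  and app_scale = linear_within_scale[OF app_linear]
  and app_0 = linear_within_0[OF app_linear]

lemmas dom_add = subspace_add[OF dom_subspace]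
  and dom_diff = subspace_diff[OF dom_subspace]
  and dom_scale = subspace_scale[OF dom_subspace]
  and H_add = subspace_add[OF sub]
  and H_diff = subspace_diff[OF sub]

end

context resolved
begin

lemma app_E: "M \<in> sets borel \<Longrightarrow> u \<in> Domain S \<Longrightarrow> app (E M u) = E M (app u)"
  using E_graph[OF app_graph] by (intro app_eq)

lemma E_linear: "M \<in> sets borel \<Longrightarrow> linear_within H (E M)"
  using sub bsa by (rule bounded_self_adjoint_linear)

lemma E_range_subspace: "M \<in> sets borel \<Longrightarrow> subspace (E M ` H)"
proof -
  assume M: "M \<in> sets borel"
  have "E M ` H = {u \<in> H. E M u = u}"
    using E_in[OF M] E_idem[OF M] by force
  then show ?thesis using sub M by (auto simp: subspace_def E_zero E_add E_scale)
qed

lemma E_fix_orth: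
  assumes "M \<in> sets borel" "N \<in> sets borel" "M \<inter> N = {}" "u \<in> H" "v \<in> H" "E M u = u" "E N v = v"
  shows "inner u v = 0"
  using E_orth[OF assms(1-5)] assms(6,7) by simp

lemma E_lim_fix:
  assumes M: "M \<in> sets borel" and "\<And>n. u n \<in> H" "\<And>n. E M (u n) = u n" "u \<longlonglongrightarrow> a" "a \<in> H"
  shows "E M a = a"
proof -
  have "(\<lambda>n. norm (E M (u n - a))) \<longlonglongrightarrow> 0"
  proof (rule tendsto_sandwich[OF _ _ tendsto_const])
    show "(\<lambda>n. norm (u n - a)) \<longlonglongrightarrow> 0"
      using assms(4) by (simp add: LIM_zero tendsto_norm_zero)
    show "\<forall>\<^sub>F n in sequentially. norm (E M (u n - a)) \<le> norm (u n - a)"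
      using E_norm_le[OF M] assms(2,5) H_diff by simp
  qed simp
  then have "(\<lambda>n. u n - E M a) \<longlonglongrightarrow> 0"
    using E_diff[OF M assms(2,5)] assms(3) by (simp add: tendsto_norm_zero_iff)
  then have "u \<longlonglongrightarrow> E M a" by (rule LIM_zero_cancel)
  then show ?thesis using assms(4) LIMSEQ_unique by auto
qed

lemma range_complete:
  assumes "complete H" and M: "M \<in> sets borel"
  shows "complete {u \<in> H. E M u = u}"
  unfolding complete_def
proof (intro allI impI)
  fix s assume s: "(\<forall>n. s n \<in> {u \<in> H. E M u = u}) \<and> Cauchy s"
  then obtain l where "l \<in> H" "s \<longlonglongrightarrow> l"
    using assms(1) unfolding complete_def by (metis (no_types, lifting) mem_Collect_eq)
  then show "\<exists>l\<in>{u \<in> H. E M u = u}. s \<longlonglongrightarrow> l"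
    using E_lim_fix[OF M, of s l] s by auto
qed

text \<open>The range of \<open>E M\<close> is invariant and the form on it is bounded by
  \<open>R\<close>, so \<open>symmetric_norm_bound\<close> turns the form bound into a norm
  bound.\<close>

lemma bounded_part:
  assumes "u \<in> H" "M \<in> sets borel" "\<And>x. x \<in> M \<Longrightarrow> \<bar>x\<bar> \<le> R" "E M u = u"
  shows "u \<in> Domain S" "norm (app u) \<le> R * norm u"
proof -
  have dom: "v \<in> Domain S" if "v \<in> H" "E M v = v" for v
    using dom_bounded[OF that(1) assms(2,3)] that(2) by simp
  show "u \<in> Domain S" using dom assms by simp
  let ?V = "{u \<in> H. E M u = u}"
  have lin: "linear_within ?V app"
    unfolding linear_within_def
  proof (intro conjI ballI allI)
    show "subspace ?V"
      using sub assms(2) unfolding subspace_def by (simp add: E_add E_scale E_zero)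
  qed (use dom app_add app_scale in auto)
  show "norm (app u) \<le> R * norm u"
  proof (rule symmetric_norm_bound[OF lin])
    show "app x \<in> ?V" if "x \<in> ?V" for x
      using that app_E[OF assms(2), of x] dom[of x] app_in by auto
    show "inner (app x) y = inner x (app y)" if "x \<in> ?V" "y \<in> ?V" for x y
      using that dom app_sym by auto
    show "\<bar>inner (app x) x\<bar> \<le> R * (norm x)\<^sup>2" if x: "x \<in> ?V" for x
    proof -
      have g: "(x, app x) \<in> S" using x dom app_graph by auto
      have "- R \<le> y" if "y \<in> M" for y using assms(3)[OF that] by linarith
      then have "- R * (norm x)\<^sup>2 \<le> inner (app x) x"
        using form_ge[OF g assms(2), of "- R"] x by auto
      moreover have "inner (app x) x \<le> R * (norm x)\<^sup>2"
      proof -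
        have "inner (app x) x < c * (norm x)\<^sup>2" if "R < c" "x \<noteq> 0" for c
        proof -
          have "y < c" if "y \<in> M" for y using assms(3)[OF that] \<open>R < c\<close> by linarith
          then show ?thesis using form_less[OF g assms(2)] x that(2) by auto
        qed
        then have *: "inner (app x) x \<le> (R + e) * (norm x)\<^sup>2" if "e > 0" for e
          using that by (cases "x = 0") (auto intro: less_imp_le)
        \<comment> \<open>\<open>form_less\<close> asks for points strictly below its constant, so
          only constants above \<open>R\<close> are available; dividing \<open>e\<close> by
          \<open>1 + (norm x)\<^sup>2\<close> keeps the resulting error below
          \<open>e\<close>.\<close>
        show ?thesis
        proof (rule field_le_epsilon)
          fix e :: real assume e: "e > 0"
          have "inner (app x) x \<le> (R + e / (1 + (norm x)\<^sup>2)) * (norm x)\<^sup>2"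
            using e by (intro * divide_pos_pos) (auto simp: add_pos_nonneg)
          also have "\<dots> = R * (norm x)\<^sup>2 + e * ((norm x)\<^sup>2 / (1 + (norm x)\<^sup>2))"
            by (simp add: distrib_right)
          also have "e * ((norm x)\<^sup>2 / (1 + (norm x)\<^sup>2)) \<le> e * 1"
            using e by (intro mult_left_mono) (auto simp: divide_le_eq_1 add_pos_nonneg)
          finally show "inner (app x) x \<le> R * (norm x)\<^sup>2 + e" by simp
        qed
      qed
      ultimately show ?thesis by linarith
    qed
  qed (use assms in simp)
qed

end

section \<open>The spectral gap and the reduction to finite dimension\<close>

locale gap = resolved H A E
  for H :: "'h::real_inner set" and A :: "('h \<times> 'h) set" and E :: "real set \<Rightarrow> 'h \<Rightarrow> 'h" +
  fixes \<beta> :: real and G :: "'h set"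
  assumes complete: "complete H" and \<beta>: "0 < \<beta>"
    and fin: "finite G" "E {-\<beta><..<\<beta>} ` H \<subseteq> span G"
begin

abbreviation "D \<equiv> Domain A"
abbreviation "Pp \<equiv> E {\<beta>..}"
abbreviation "Pm \<equiv> E {..-\<beta>}"
abbreviation "PX \<equiv> E {-\<beta><..<\<beta>}"
abbreviation "PY \<equiv> E (- {-\<beta><..<\<beta>})"

lemma Y_borel [measurable, simp]: "- {-\<beta><..<\<beta>} \<in> sets borel"
  by (simp add: borel_comp)

lemma PY_eq: "u \<in> H \<Longrightarrow> PY u = Pm u + Pp u"
proof -
  assume u: "u \<in> H"
  have "- {-\<beta><..<\<beta>} = {..-\<beta>} \<union> {\<beta>..}" by auto
  moreover have "{..-\<beta>} \<inter> {\<beta>..} = {}" using \<beta> by auto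
  ultimately show ?thesis using E_Un[of "{..-\<beta>}" "{\<beta>..}" u] u by simp
qed

lemma XY: "u \<in> H \<Longrightarrow> u = PX u + PY u"
  using E_Compl[of "{-\<beta><..<\<beta>}" u] by simp

lemma Pp_form: "y \<in> D \<Longrightarrow> Pp y = y \<Longrightarrow> \<beta> * (norm y)\<^sup>2 \<le> inner (app y) y"
  using form_ge[OF app_graph, of y "{\<beta>..}" \<beta>] by simp

lemma Pm_form:
  assumes "y \<in> D" "Pm y = y" shows "inner (app y) y \<le> - \<beta> * (norm y)\<^sup>2"
proof -
  have y: "y \<in> H" using dom_in assms by simp
  have *: "inner (app y) y \<le> c * (norm y)\<^sup>2" if "- \<beta> < c" for c
  proof (cases "y = 0")
    case False
    have "inner (app y) y < c * (norm y)\<^sup>2"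
      by (rule form_less[OF app_graph, of _ "{..-\<beta>}"]) (use assms False that in auto)
    then show ?thesis by simp
  qed simp
  show ?thesis
  proof (cases "y = 0")
    case False
    show ?thesis
    proof (rule field_le_epsilon)
      fix e :: real assume "0 < e"
      then have "inner (app y) y \<le> (- \<beta> + e / (norm y)\<^sup>2) * (norm y)\<^sup>2"
        using False by (intro *) simp
      also have "\<dots> = - \<beta> * (norm y)\<^sup>2 + e" using False by (simp add: field_simps)
      finally show "inner (app y) y \<le> - \<beta> * (norm y)\<^sup>2 + e" .
    qed
  qed simp
qed

text \<open>Test with \<open>Pp y - Pm y\<close>: it has the norm of \<open>y\<close>, and it turns
  two definite forms of opposite sign into a sum.\<close>

lemma PY_coercive:
  assumes "y \<in> D" "PY y = y" shows "\<beta> * norm y \<le> norm (app y)"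
proof -
  have y: "y \<in> H" using dom_in assms by simp
  let ?p = "Pp y" and ?m = "Pm y"
  have pm: "y = ?m + ?p" using PY_eq[OF y] assms(2) by simp
  have D: "?p \<in> D" "?m \<in> D" using assms E_dom by simp_all
  have H: "?p \<in> H" "?m \<in> H" using D dom_in by simp_all
  have disj: "{..-\<beta>} \<inter> {\<beta>..} = {}" "{\<beta>..} \<inter> {..-\<beta>} = {}" using \<beta> by auto
  have o: "inner ?m ?p = 0" by (rule E_orth) (use y disj in auto)
  have amp: "inner (app ?m) ?p = 0" "inner (app ?p) ?m = 0"
    using E_orth[OF _ _ disj(1) app_in[OF assms(1)] y] E_orth[OF _ _ disj(2) app_in[OF assms(1)] y]
      app_E[OF _ assms(1)] by simp_all
  have "inner (app y) (?p - ?m) = inner (app ?p) ?p - inner (app ?m) ?m"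
    using amp app_add[OF D(2,1)] pm[symmetric]
    by (simp add: inner_add_left inner_diff_right)
  also have "\<dots> \<ge> \<beta> * (norm ?p)\<^sup>2 + \<beta> * (norm ?m)\<^sup>2"
    using Pp_form[OF D(1)] Pm_form[OF D(2)] y E_idem by simp
  finally have *: "\<beta> * ((norm ?p)\<^sup>2 + (norm ?m)\<^sup>2) \<le> inner (app y) (?p - ?m)" by (simp add: distrib_left)
  have n: "(norm y)\<^sup>2 = (norm ?p)\<^sup>2 + (norm ?m)\<^sup>2" "(norm (?p - ?m))\<^sup>2 = (norm ?p)\<^sup>2 + (norm ?m)\<^sup>2"
  proof -
    have "(norm (?m + ?p))\<^sup>2 = (norm ?p)\<^sup>2 + (norm ?m)\<^sup>2"
      using o unfolding power2_norm_eq_inner by (simp add: inner_add_left inner_add_right inner_commute)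
    then show "(norm y)\<^sup>2 = (norm ?p)\<^sup>2 + (norm ?m)\<^sup>2" using pm by simp
    show "(norm (?p - ?m))\<^sup>2 = (norm ?p)\<^sup>2 + (norm ?m)\<^sup>2"
      using o unfolding power2_norm_eq_inner by (simp add: inner_diff_left inner_diff_right inner_commute)
  qed
  then have "norm (?p - ?m) = norm y" by (metis norm_ge_zero power2_eq_imp_eq)
  then have "\<beta> * (norm y)\<^sup>2 \<le> norm (app y) * norm y"
    using * n(1) norm_cauchy_schwarz[of "app y" "?p - ?m"] by simp
  then show ?thesis by (cases "y = 0") (auto simp: power2_eq_square)
qed

text \<open>Coercivity gives a closed range inside the range of \<open>PY\<close>, so a missing
  direction could be taken orthogonal to it. Such a vector is sent to 0 by the self-adjoint
  \<open>A\<close>, hence is 0 by coercivity again.\<close>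

lemma PY_surj:
  assumes w: "w \<in> H" "PY w = w"
  obtains y where "y \<in> D" "PY y = y" "app y = w"
proof -
  define M where "M = app ` {y \<in> D. PY y = y}"
  have coer: "\<beta> * norm (x - y) \<le> norm (app x - app y)"
    if "x \<in> D" "PY x = x" "y \<in> D" "PY y = y" for x y
    using PY_coercive[of "x - y"] that by (simp add: dom_diff E_diff dom_in app_diff)
  have "complete M"
    unfolding complete_def
  proof (intro allI impI)
    fix s assume s: "(\<forall>n. s n \<in> M) \<and> Cauchy s"
    have "\<exists>x. x \<in> D \<and> PY x = x \<and> s n = app x" for n
    proof -
      have "s n \<in> app ` {y \<in> D. PY y = y}" using s unfolding M_def by simp
      then show ?thesis by (elim imageE) auto
    qed
    then obtain x where x: "\<And>n. x n \<in> D" "\<And>n. PY (x n) = x n" "\<And>n. s n = app (x n)" by metis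
    have "Cauchy x"
    proof (rule metric_CauchyI)
      fix e :: real assume "e > 0"
      then obtain N where N: "\<And>m n. m \<ge> N \<Longrightarrow> n \<ge> N \<Longrightarrow> dist (s m) (s n) < \<beta> * e"
        using s \<beta> metric_CauchyD[of s "\<beta> * e"] by auto
      have "dist (x m) (x n) < e" if "m \<ge> N" "n \<ge> N" for m n
      proof -
        have "\<beta> * norm (x m - x n) < \<beta> * e"
          using coer[OF x(1,2) x(1,2), of m n] N[OF that] x(3) by (simp add: dist_norm)
        then show ?thesis using \<beta> by (simp add: dist_norm)
      qed
      then show "\<exists>N. \<forall>m\<ge>N. \<forall>n\<ge>N. dist (x m) (x n) < e" by blast
    qed
    then obtain l where l: "l \<in> H" "x \<longlonglongrightarrow> l"
      using complete x(1) dom_in unfolding complete_def by metis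
    obtain z where z: "z \<in> H" "s \<longlonglongrightarrow> z"
      using complete s x(1,3) app_in unfolding complete_def by metis
    have "(l, z) \<in> A"
      by (rule graph_closed[OF _ l(2) z(2) l(1) z(1)]) (use x app_graph in simp)
    moreover have "PY l = l"
      by (rule E_lim_fix[OF _ _ x(2) l(2) l(1)]) (use x dom_in in simp_all)
    ultimately have "z \<in> M" unfolding M_def using app_eq by (intro image_eqI[of _ _ l]) auto
    then show "\<exists>z\<in>M. s \<longlonglongrightarrow> z" using z by blast
  qed
  moreover have "subspace M"
    unfolding M_def
  proof (rule linear_within_image_subspace[OF app_linear])
    show "subspace {y \<in> D. PY y = y}"
      using dom_subspace dom_in unfolding subspace_def by (simp add: E_add E_scale E_zero)
  qed simp
  ultimately obtain m where m: "m \<in> M" "\<And>x. x \<in> M \<Longrightarrow> inner (w - m) x = 0"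
    using orthogonal_projection_exists[of M w] by metis
  obtain y where y: "y \<in> D" "PY y = y" "m = app y" using m(1) unfolding M_def by auto
  have mH: "m \<in> H" "PY m = m" using y app_in app_E[of "- {-\<beta><..<\<beta>}" y] by simp_all
  have wm: "w - m \<in> H" "PY (w - m) = w - m" using w mH H_diff E_diff by simp_all
  have "(w - m, 0) \<in> A"
  proof (rule memI[OF wm(1) subspace_0[OF sub]])
    fix u s assume us: "(u, s) \<in> A"
    have "(PY u, PY s) \<in> A" using E_graph[OF us] by simp
    moreover have "PY (PY u) = PY u" using us graph_in E_idem by simp
    ultimately have "PY s \<in> M" unfolding M_def using app_eq by (intro image_eqI[of _ _ "PY u"]) auto
    then have "inner (w - m) (PY s) = 0" by (rule m(2))
    then have "inner (PY (w - m)) s = 0" using E_sym[of "- {-\<beta><..<\<beta>}" "w - m" s] wm(1) us graph_in by simp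
    then show "inner s (w - m) = inner u 0" using wm(2) by (simp add: inner_commute)
  qed
  then have "app (w - m) = 0" "w - m \<in> D" using app_eq by auto
  then have "w - m = 0" using PY_coercive[of "w - m"] wm(2) \<beta> by (simp add: mult_le_0_iff)
  then show ?thesis using that y by auto
qed

text \<open>\<open>y \<mapsto> A\<^sup>-\<^sup>1 PY (\<Phi> (x + y))\<close> contracts with factor
  \<open>\<kappa> / \<beta>\<close>. \<open>\<Phi>\<close> is general because three maps are
  inserted: an affine one to invert \<open>C\<close>, the truncated nonlinearity, and at the end an
  affine one whose uniqueness statement identifies the fixed point.\<close>

lemma reduction:
  assumes \<Phi>: "\<And>u. u \<in> H \<Longrightarrow> \<Phi> u \<in> H"
    and lip: "\<And>u v. u \<in> H \<Longrightarrow> v \<in> H \<Longrightarrow> norm (\<Phi> u - \<Phi> v) \<le> \<kappa> * norm (u - v)"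
    and \<kappa>: "0 \<le> \<kappa>" "\<kappa> < \<beta>" and x: "x \<in> H"
  shows "\<exists>!y. y \<in> D \<and> PY y = y \<and> app y = PY (\<Phi> (x + y))"
proof -
  define Ainv where "Ainv w = (SOME y. y \<in> D \<and> PY y = y \<and> app y = w)" for w
  have Ainv: "Ainv w \<in> D \<and> PY (Ainv w) = Ainv w \<and> app (Ainv w) = w" if "w \<in> H" "PY w = w" for w
    unfolding Ainv_def by (rule someI_ex) (rule PY_surj[OF that], intro exI conjI)
  let ?Y = "{y \<in> H. PY y = y}"
  let ?T = "\<lambda>y. Ainv (PY (\<Phi> (x + y)))"
  have T: "?T y \<in> D \<and> PY (?T y) = ?T y \<and> app (?T y) = PY (\<Phi> (x + y))" if "y \<in> ?Y" for y
    by (rule Ainv) (use that x \<Phi> H_add E_in E_idem in auto)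
  have "\<exists>!y\<in>?Y. ?T y = y"
  proof (rule Banach_fix)
    show "complete ?Y" by (rule range_complete[OF complete]) simp
    have "(0::'h) \<in> ?Y" using E_zero subspace_0[OF sub] by simp
    then show "?Y \<noteq> {}" by blast
    show "0 \<le> \<kappa> / \<beta>" "\<kappa> / \<beta> < 1" using \<kappa> \<beta> by simp_all
    show "?T ` ?Y \<subseteq> ?Y" using T dom_in by auto
    fix y z assume yz: "y \<in> ?Y" "z \<in> ?Y"
    have H: "x + y \<in> H" "x + z \<in> H" using x yz H_add by auto
    have "\<beta> * norm (?T y - ?T z) \<le> norm (app (?T y - ?T z))"
      using T[OF yz(1)] T[OF yz(2)] by (intro PY_coercive) (simp_all add: dom_diff E_diff dom_in)
    also have "app (?T y - ?T z) = PY (\<Phi> (x + y) - \<Phi> (x + z))"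
      using T[OF yz(1)] T[OF yz(2)] H \<Phi> by (simp add: app_diff E_diff)
    also have "norm \<dots> \<le> norm (\<Phi> (x + y) - \<Phi> (x + z))"
      using H \<Phi> by (intro E_norm_le H_diff) simp_all
    also have "\<dots> \<le> \<kappa> * norm (y - z)" using lip[OF H] by simp
    finally show "dist (?T y) (?T z) \<le> \<kappa> / \<beta> * dist y z"
      using \<beta> by (simp add: dist_norm field_simps)
  qed
  then obtain y where y: "y \<in> ?Y" "?T y = y" by auto
  show ?thesis
  proof (rule ex1I[of _ y])
    show "y \<in> D \<and> PY y = y \<and> app y = PY (\<Phi> (x + y))" using T[OF y(1)] y(2) by simp
    fix z assume z: "z \<in> D \<and> PY z = z \<and> app z = PY (\<Phi> (x + z))"
    have yy: "y \<in> D \<and> PY y = y \<and> app y = PY (\<Phi> (x + y))" using T[OF y(1)] y(2) by simp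
    have H: "x + y \<in> H" "x + z \<in> H" using x yy z dom_in H_add by auto
    have "\<beta> * norm (z - y) \<le> norm (app (z - y))"
      using yy z by (intro PY_coercive) (simp_all add: dom_diff E_diff dom_in)
    also have "app (z - y) = PY (\<Phi> (x + z) - \<Phi> (x + y))"
      using yy z H \<Phi> by (simp add: app_diff E_diff)
    also have "norm \<dots> \<le> norm (\<Phi> (x + z) - \<Phi> (x + y))"
      using H \<Phi> by (intro E_norm_le H_diff) simp_all
    also have "\<dots> \<le> \<kappa> * norm (z - y)" using lip[OF H(2,1)] by simp
    finally have "(\<beta> - \<kappa>) * norm (z - y) \<le> 0" by (simp add: left_diff_distrib)
    then show "z = y" using \<kappa> by (simp add: mult_le_0_iff)
  qed
qed

end

section \<open>A bounded perturbation \<open>C = A - B\<close> and the solvability of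
  \<open>C z = v\<close>\<close>

locale pert = gap H A E \<beta> G
  for H :: "'h::real_inner set" and A :: "('h \<times> 'h) set" and E :: "real set \<Rightarrow> 'h \<Rightarrow> 'h"
    and \<beta> :: real and G :: "'h set" +
  fixes B :: "'h \<Rightarrow> 'h" and E' :: "real set \<Rightarrow> 'h \<Rightarrow> 'h" and \<kappa> :: real
  assumes B: "bounded_self_adjoint_on H B"
    and B_bound: "\<And>u. u \<in> H \<Longrightarrow> norm (B u) \<le> \<kappa> * norm u"
    and \<kappa>: "0 \<le> \<kappa>" "\<kappa> < \<beta>"
    and res': "spectral_resolution H (op_minus A B) E'"
begin

sublocale C: resolved H "op_minus A B" E'
proof
  show "self_adjoint_on H (op_minus A B)"
    using res' unfolding spectral_resolution_def by (rule conjunct1)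
qed (rule sub, rule res')

abbreviation "N \<equiv> E' {..<0}"

lemma B_linear: "linear_within H B"
  using sub B by (rule bounded_self_adjoint_linear)

lemma B_in: "u \<in> H \<Longrightarrow> B u \<in> H"
  using B unfolding bounded_self_adjoint_on_def by simp

lemmas B_diff = linear_within_diff[OF B_linear]
  and B_0 = linear_within_0[OF B_linear]

lemma C_dom: "Domain (op_minus A B) = D"
  unfolding op_minus_def by auto

lemma C_app: "u \<in> D \<Longrightarrow> C.app u = app u - B u"
  by (rule C.app_eq) (use app_graph[of u] in \<open>auto simp: op_minus_def\<close>)

lemma B_lip: "u \<in> H \<Longrightarrow> v \<in> H \<Longrightarrow> norm (B u - B v) \<le> \<kappa> * norm (u - v)"
  using B_bound[of "u - v"] by (simp add: B_diff H_diff)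

lemma X_dom: "u \<in> H \<Longrightarrow> PX u \<in> D"
  by (rule dom_bounded[of _ _ \<beta>]) auto

lemma PX_PY: "u \<in> H \<Longrightarrow> PX (PY u) = 0" "u \<in> H \<Longrightarrow> PY (PX u) = 0"
  by (rule E_disj; simp)+

lemma Y_solve:
  assumes "w \<in> H" "x \<in> H" "PX x = x"
  obtains y where "y \<in> D" "PY y = y" "PY (C.app (x + y)) = PY w"
proof -
  have "\<exists>!y. y \<in> D \<and> PY y = y \<and> app y = PY (B (x + y) + w)"
    by (rule reduction[of "\<lambda>u. B u + w", OF _ _ \<kappa> assms(2)])
      (use assms(1) B_in H_add B_lip in simp_all)
  then obtain y where y: "y \<in> D" "PY y = y" "app y = PY (B (x + y) + w)" by blast
  have x: "x \<in> D" using X_dom[OF assms(2)] assms(3) by simp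
  have H: "x + y \<in> H" "app x \<in> H" "app y \<in> H" "B (x + y) \<in> H"
    using x y(1) by (simp_all add: H_add dom_in app_in B_in)
  have "PY (app x) = app (PY (PX x))"
    using app_E[of "- {-\<beta><..<\<beta>}" "PX x"] assms(3) x by simp
  then have "PY (app x) = 0" using PX_PY(2)[OF assms(2)] app_0 by simp
  moreover have "PY (app y) = app y" using app_E[of "- {-\<beta><..<\<beta>}" y] y(1,2) by simp
  ultimately have "PY (C.app (x + y)) = PY w"
    using y x H assms(1) by (simp add: C_app dom_add app_add E_diff E_add H_add)
  then show ?thesis using that y by blast
qed

text \<open>The range of \<open>C\<close> is closed: modulo the finite-dimensional range of \<open>PX\<close> it is everything, by
  the reduction, so only the orthogonal complement of \<open>range C\<close> inside that space can be missing,
  and each such vector is the \<open>PX\<close>-part of an element of the kernel.\<close>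

lemma C_solve:
  assumes v: "v \<in> H" and ker: "\<And>k. k \<in> D \<Longrightarrow> C.app k = 0 \<Longrightarrow> inner v k = 0"
  obtains z where "z \<in> D" "C.app z = v"
proof -
  \<comment> \<open>What \<open>C\<close> reaches inside the finite-dimensional range of
    \<open>PX\<close>; every other datum is reduced to that range by subtracting a value
    \<open>C.app \<eta>\<close> with \<open>\<eta>\<close> in the range of
    \<open>PY\<close>.\<close>
  define X' where "X' = {x \<in> H. PX x = x \<and> (\<exists>u\<in>D. C.app u = x)}"
  have X': "subspace X'"
    unfolding X'_def subspace_def
  proof (intro conjI ballI allI, goal_cases)
    case 1
    have "0 \<in> D" using dom_subspace subspace_0 by blast
    then show ?case using C.app_0 E_zero subspace_0[OF sub] by auto
  next
    case (2 x y)
    then obtain p q where "p \<in> D" "C.app p = x" "q \<in> D" "C.app q = y" by auto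
    then show ?case using 2 dom_add[of p q] C.app_add[of p q] C_dom H_add[of x y] E_add[of _ x y]
      by (auto intro!: bexI[of _ "p + q"])
  next
    case (3 c x)
    then obtain p where "p \<in> D" "C.app p = x" by auto
    then show ?case using 3 dom_scale[of p c] C.app_scale[of p c] C_dom subspace_scale[OF sub, of x c] E_scale[of _ x c]
      by (auto intro!: bexI[of _ "c *\<^sub>R p"])
  qed
  obtain F where F: "F \<subseteq> X'" "independent F" "X' \<subseteq> span F"
    by (rule maximal_independent_subset)
  have "F \<subseteq> span G"
  proof
    fix x assume "x \<in> F"
    then have "x \<in> PX ` H" using F(1) unfolding X'_def by (intro image_eqI[of _ _ x]) auto
    then show "x \<in> span G" using fin(2) by blast
  qed
  then have finF: "finite F" using independent_span_bound[OF fin(1) F(2)] by simp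
  have spF: "span F = X'" using span_minimal[OF F(1) X'] F(3) by simp
  have z0: "0 \<in> H" "PX 0 = 0" using subspace_0[OF sub] E_zero by simp_all
  obtain \<eta> where \<eta>: "\<eta> \<in> D" "PY \<eta> = \<eta>" "PY (C.app (0 + \<eta>)) = PY v"
    using Y_solve[OF v z0] by metis
  define \<xi> where "\<xi> = v - C.app \<eta>"
  have C\<eta>: "C.app \<eta> \<in> H" using \<eta>(1) C.app_in C_dom by simp
  have \<xi>: "\<xi> \<in> H" "PY \<xi> = 0" unfolding \<xi>_def using \<eta>(3) v C\<eta> by (simp_all add: H_diff E_diff)
  then have PX\<xi>: "PX \<xi> = \<xi>" using XY[of \<xi>] by simp
  obtain \<xi>1 where \<xi>1: "\<xi>1 \<in> X'" "\<And>x. x \<in> X' \<Longrightarrow> inner (\<xi> - \<xi>1) x = 0"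
    using span_projection_exists[OF finF, of \<xi>] unfolding spF by metis
  \<comment> \<open>The claim is that the unreachable part \<open>\<xi>2\<close> is the
    \<open>PX\<close>-component of a kernel vector \<open>k\<close>; pairing \<open>v\<close> with
    \<open>k\<close> then gives \<open>inner \<xi>2 \<xi>2 = 0\<close>.\<close>
  define \<xi>2 where "\<xi>2 = \<xi> - \<xi>1"
  have H1: "\<xi>1 \<in> H" "PX \<xi>1 = \<xi>1" using \<xi>1(1) unfolding X'_def by simp_all
  have H2: "\<xi>2 \<in> H" "PX \<xi>2 = \<xi>2" unfolding \<xi>2_def using H1 \<xi>(1) PX\<xi> by (simp_all add: H_diff E_diff)
  obtain y where y: "y \<in> D" "PY y = y" "PY (C.app (\<xi>2 + y)) = PY 0"
    using Y_solve[OF z0(1) H2] by metis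
  define k where "k = \<xi>2 + y"
  have \<xi>2D: "\<xi>2 \<in> D" using X_dom[OF H2(1)] H2(2) by simp
  have kD: "k \<in> D" unfolding k_def using \<xi>2D y(1) by (rule dom_add)
  have Ck: "C.app k \<in> H" using kD C.app_in C_dom by simp
  have "PY (C.app k) = 0" using y(3) E_zero[of "- {-\<beta><..<\<beta>}"] unfolding k_def by simp
  then have PXCk: "PX (C.app k) = C.app k" using XY[OF Ck] by simp
  have yH: "y \<in> H" using y(1) dom_in by simp
  have PXk: "PX k = \<xi>2"
    unfolding k_def using H2 y(2) yH PX_PY(1)[OF yH] by (simp add: E_add)
  have Yperp: "inner x y' = 0" if "x \<in> H" "PX x = x" "y' \<in> H" "PY y' = y'" for x y'
    by (rule E_fix_orth[of "{-\<beta><..<\<beta>}" "- {-\<beta><..<\<beta>}"]) (use that in auto)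
  \<comment> \<open>Up to some \<open>C.app \<eta>u\<close>, which is orthogonal to \<open>k\<close>
    because \<open>C.app k\<close> is in the range of \<open>PX\<close>, every
    \<open>C.app u\<close> lies in \<open>X'\<close>; and on \<open>X'\<close> pairing with
    \<open>k\<close> is pairing with \<open>PX k = \<xi>2\<close>.\<close>
  have Ck0: "C.app k = 0"
  proof (rule orth_dom[OF Ck])
    fix u w assume "(u, w) \<in> A"
    then have uD: "u \<in> D" by auto
    have CuH: "C.app u \<in> H" using uD C.app_in C_dom by simp
    obtain \<eta>u where \<eta>u: "\<eta>u \<in> D" "PY \<eta>u = \<eta>u" "PY (C.app (0 + \<eta>u)) = PY (C.app u)"
      using Y_solve[OF CuH z0] by metis
    define x' where "x' = C.app u - C.app \<eta>u"
    have C\<eta>u: "C.app \<eta>u \<in> H" using \<eta>u(1) C.app_in C_dom by simp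
    have x'H: "x' \<in> H" "PY x' = 0" unfolding x'_def using \<eta>u(3) CuH C\<eta>u by (simp_all add: H_diff E_diff)
    then have "PX x' = x'" using XY[of x'] by simp
    moreover have "C.app (u - \<eta>u) = x'" "u - \<eta>u \<in> D"
      using uD \<eta>u(1) C.app_diff C_dom dom_diff unfolding x'_def by auto
    ultimately have "x' \<in> X'" unfolding X'_def using x'H by blast
    have "inner k x' = inner (PX k) x'"
      using E_sym[of "{-\<beta><..<\<beta>}" k x'] kD dom_in x'H \<open>PX x' = x'\<close> by simp
    also have "\<dots> = 0" using \<xi>1(2)[OF \<open>x' \<in> X'\<close>] PXk unfolding \<xi>2_def by simp
    finally have 1: "inner k x' = 0" .
    have "inner k (C.app \<eta>u) = inner (C.app k) \<eta>u"
      using C.app_sym[of k \<eta>u] kD \<eta>u(1) C_dom by simp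
    also have "\<dots> = 0" by (rule Yperp) (use Ck PXCk \<eta>u dom_in in simp_all)
    finally have 2: "inner k (C.app \<eta>u) = 0" .
    have "inner (C.app k) u = inner k (C.app u)" using C.app_sym[of k u] kD uD C_dom by simp
    also have "\<dots> = 0" using 1 2 unfolding x'_def by (simp add: inner_diff_right)
    finally show "inner (C.app k) u = 0" .
  qed
  have "inner v k = 0" by (rule ker[OF kD Ck0])
  moreover have "v = C.app \<eta> + \<xi>1 + \<xi>2" unfolding \<xi>2_def \<xi>_def by simp
  moreover have "inner (C.app \<eta>) k = 0" using C.app_sym[of \<eta> k] kD \<eta>(1) C_dom Ck0 by simp
  moreover have "inner \<xi>1 k = 0"
  proof -
    have "inner \<xi>1 k = inner \<xi>1 (PX k)"
      using E_sym[of "{-\<beta><..<\<beta>}" \<xi>1 k] kD dom_in H1 by simp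
    also have "\<dots> = 0" using \<xi>1(2)[OF \<xi>1(1)] PXk unfolding \<xi>2_def by (simp add: inner_commute)
    finally show ?thesis .
  qed
  moreover have "inner \<xi>2 k = inner \<xi>2 \<xi>2"
    unfolding k_def using Yperp[OF H2 yH y(2)] by (simp add: inner_add_right)
  ultimately have "inner \<xi>2 \<xi>2 = 0" by (simp add: inner_add_left)
  then have "v = C.app \<eta> + \<xi>1" using \<open>v = C.app \<eta> + \<xi>1 + \<xi>2\<close> by simp
  moreover obtain u where "u \<in> D" "C.app u = \<xi>1" using \<xi>1(1) unfolding X'_def by auto
  ultimately have "C.app (\<eta> + u) = v" "\<eta> + u \<in> D"
    using C.app_add[of \<eta> u] \<eta>(1) C_dom dom_add by simp_all
  then show ?thesis using that by blast
qed

section \<open>The negative subspace of \<open>C\<close> relative to the range of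
  \<open>Pp\<close>\<close>

lemma N_in: "u \<in> H \<Longrightarrow> N u \<in> H" by (rule C.E_in) simp
lemma N_idem: "u \<in> H \<Longrightarrow> N (N u) = N u" by (rule C.E_idem) simp

text \<open>The Sylvester equation \<open>A \<Theta> - \<Theta> C = Pp B\<close> for \<open>\<Theta> = Pp\<close> restricted to a spectral subspace of
  \<open>C\<close> on which \<open>C \<le> 0\<close>, tested with an approximately maximizing vector of \<open>\<Theta>\<close>.\<close>

lemma sylvester_bounded:
  assumes v: "v \<in> H" "E' {- real m..<0} v = v"
  shows "\<beta> * norm (Pp v) \<le> \<kappa> * norm v"
proof -
  let ?M = "{- real m..<0}"
  define V where "V = {v \<in> H. E' ?M v = v}"
  define T where "T = (\<lambda>v. norm (Pp v)) ` {v \<in> V. norm v \<le> 1}"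
  \<comment> \<open>The norm of \<open>Pp\<close> on \<open>V\<close>. It need not be attained;
    truncating at \<open>- m\<close> makes \<open>C\<close> bounded on \<open>V\<close>, so that
    approximate maximizers suffice.\<close>
  define \<theta> where "\<theta> = Sup T"
  have scaleV: "c *\<^sub>R x \<in> V" if "x \<in> V" for c x
    using that unfolding V_def by (simp add: subspace_scale[OF sub] C.E_scale)
  have bdd: "bdd_above T"
  proof (rule bdd_aboveI[of _ 1])
    fix x assume "x \<in> T"
    then obtain v where "v \<in> H" "norm v \<le> 1" "x = norm (Pp v)" unfolding T_def V_def by auto
    then show "x \<le> 1" using E_norm_le[of "{\<beta>..}" v] by simp
  qed
  have "0 \<in> V" unfolding V_def using subspace_0[OF sub] C.E_zero by simp
  then have T0: "0 \<in> T" unfolding T_def using E_zero[of "{\<beta>..}"] by (intro image_eqI[of _ _ 0]) simp_all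
  have \<theta>0: "0 \<le> \<theta>" unfolding \<theta>_def using T0 bdd by (rule cSup_upper)
  have \<theta>: "norm (Pp v) \<le> \<theta> * norm v" if "v \<in> V" for v
  proof (cases "v = 0")
    case False
    let ?w = "(1 / norm v) *\<^sub>R v"
    have "norm (Pp ?w) \<le> \<theta>"
      unfolding \<theta>_def T_def
      by (rule cSup_upper[OF imageI]) (use scaleV that False bdd T_def in auto)
    moreover have "Pp ?w = (1 / norm v) *\<^sub>R Pp v" using that V_def by (intro E_scale) auto
    ultimately show ?thesis using False by (simp add: field_simps)
  qed (use E_zero[of "{\<beta>..}"] in simp)
  have key: "\<beta> * (\<theta>\<^sup>2 - \<epsilon>\<^sup>2) \<le> real m * \<epsilon> + \<kappa> * \<theta>" if \<epsilon>: "0 < \<epsilon>" "\<theta> \<le> 1" for \<epsilon>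
  proof -
    have "\<exists>t\<in>T. \<theta>\<^sup>2 - \<epsilon>\<^sup>2 \<le> t\<^sup>2"
    proof (cases "\<theta>\<^sup>2 \<le> \<epsilon>\<^sup>2")
      case True
      then show ?thesis using T0 by (intro bexI[of _ 0]) simp_all
    next
      case False
      then have "sqrt (\<theta>\<^sup>2 - \<epsilon>\<^sup>2) < \<theta>"
        using \<epsilon>(1) \<theta>0 real_less_rsqrt real_sqrt_less_iff[of "\<theta>\<^sup>2 - \<epsilon>\<^sup>2" "\<theta>\<^sup>2"] by simp
      then obtain t where t: "t \<in> T" "sqrt (\<theta>\<^sup>2 - \<epsilon>\<^sup>2) < t"
        using less_cSup_iff[OF _ bdd] T0 unfolding \<theta>_def by auto
      have "(sqrt (\<theta>\<^sup>2 - \<epsilon>\<^sup>2))\<^sup>2 \<le> t\<^sup>2" using t(2) False by (intro power_mono) auto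
      then show ?thesis using t False by (intro bexI[of _ t]) simp_all
    qed
    then obtain v where v: "v \<in> V" "norm v \<le> 1" "\<theta>\<^sup>2 - \<epsilon>\<^sup>2 \<le> (norm (Pp v))\<^sup>2"
      unfolding T_def by auto
    have vH: "v \<in> H" "E' ?M v = v" using v(1) unfolding V_def by simp_all
    let ?p = "Pp v"
    have pH: "?p \<in> H" using vH by (simp add: E_in)
    let ?q = "E' ?M ?p"
    have qV: "?q \<in> V" "?q \<in> H" unfolding V_def using pH by (simp_all add: C.E_in C.E_idem)
    \<comment> \<open>\<open>?q\<close> is \<open>\<Theta>\<^sup>T \<Theta> v\<close> for the
      restriction \<open>\<Theta>\<close> of \<open>Pp\<close> to \<open>V\<close>. A maximizer
      would satisfy \<open>?q = \<theta>\<^sup>2 v\<close>; for a \<open>v\<close> whose squared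
      value is within \<open>\<epsilon>\<^sup>2\<close> of \<open>\<theta>\<^sup>2\<close>, the
      defect \<open>e\<close> has norm at most \<open>\<epsilon>\<close>.\<close>
    define e where "e = ?q - \<theta>\<^sup>2 *\<^sub>R v"
    have pp: "inner ?p v = (norm ?p)\<^sup>2" using E_inner[of "{\<beta>..}" v] vH by simp
    have qv: "inner ?q v = (norm ?p)\<^sup>2" using C.E_sym[of ?M ?p v] pH vH pp by simp
    have "(norm ?q)\<^sup>2 = inner ?q ?p" using C.E_inner[of ?M ?p] pH by simp
    also have "\<dots> = inner (Pp ?q) ?p"
      using E_sym[of "{\<beta>..}" ?q ?p] E_idem[of "{\<beta>..}" v] pH vH qV by simp
    also have "\<dots> \<le> norm (Pp ?q) * norm ?p" by (rule norm_cauchy_schwarz)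
    also have "\<dots> \<le> \<theta> * norm ?q * norm ?p" by (intro mult_right_mono \<theta> qV norm_ge_zero)
    finally have "norm ?q * norm ?q \<le> (\<theta> * norm ?p) * norm ?q" by (simp add: power2_eq_square mult_ac)
    then have "norm ?q \<le> \<theta> * norm ?p" using \<theta>0 by (cases "norm ?q = 0") (auto simp: mult_le_cancel_right)
    then have q2: "(norm ?q)\<^sup>2 \<le> \<theta>\<^sup>2 * (norm ?p)\<^sup>2" using power_mono[of "norm ?q" "\<theta> * norm ?p" 2] by (simp add: power_mult_distrib)
    have e2: "(norm e)\<^sup>2 = (norm ?q)\<^sup>2 - 2 * \<theta>\<^sup>2 * inner ?q v + \<theta>\<^sup>2 * (\<theta>\<^sup>2 * (norm v)\<^sup>2)"
      unfolding e_def power2_norm_eq_inner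
      by (simp add: inner_diff_left inner_diff_right inner_commute[of v ?q] algebra_simps)
    have "\<theta>\<^sup>2 * (\<theta>\<^sup>2 * (norm v)\<^sup>2) \<le> \<theta>\<^sup>2 * (\<theta>\<^sup>2 * 1)"
      using v(2) by (intro mult_left_mono) (auto simp: power_le_one)
    then have "(norm e)\<^sup>2 \<le> \<theta>\<^sup>2 * (\<theta>\<^sup>2 - (norm ?p)\<^sup>2)"
      using e2 q2 qv by (simp add: right_diff_distrib)
    also have "\<dots> \<le> \<theta>\<^sup>2 * \<epsilon>\<^sup>2" using v(3) by (intro mult_left_mono) auto
    also have "\<dots> \<le> 1 * \<epsilon>\<^sup>2" using \<epsilon>(2) \<theta>0 by (intro mult_right_mono) (auto simp: power_le_one)
    finally have ne: "norm e \<le> \<epsilon>" using \<epsilon>(1) by (auto intro: power2_le_imp_le)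
    have M: "\<bar>x\<bar> \<le> real m" if "x \<in> ?M" for x using that by auto
    have vD: "v \<in> Domain (op_minus A B)" and nC: "norm (C.app v) \<le> real m * norm v"
      using C.bounded_part[OF vH(1) _ M vH(2)] by auto
    have vD': "v \<in> D" using vD C_dom by simp
    have CvH: "C.app v \<in> H" using vD by (rule C.app_in)
    have EC: "E' ?M (C.app v) = C.app v" using C.app_E[OF _ vD, of ?M] vH(2) by simp
    have neg: "inner (C.app v) v \<le> 0"
    proof (cases "v = 0")
      case False
      have "inner (C.app v) v < 0 * (norm v)\<^sup>2"
        by (rule C.form_less[OF C.app_graph[OF vD] _ vH(2)]) (use False in auto)
      then show ?thesis by simp
    qed simp
    \<comment> \<open>Up to the defect this is
      \<open>\<theta>\<^sup>2 * inner (C.app v) v \<le> 0\<close>: the contribution of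
      \<open>C\<close> has the favourable sign, and only the term with \<open>B\<close>
      remains.\<close>
    have "inner (C.app v) ?p = inner (C.app v) ?q"
      using C.E_sym[of ?M "C.app v" ?p] CvH pH EC by simp
    also have "\<dots> = inner (C.app v) e + \<theta>\<^sup>2 * inner (C.app v) v"
      unfolding e_def by (simp add: inner_diff_right)
    also have "\<dots> \<le> norm (C.app v) * norm e + 0"
      using neg by (intro add_mono norm_cauchy_schwarz) (simp add: mult_le_0_iff)
    also have "\<dots> \<le> (real m * 1) * \<epsilon> + 0"
      using nC v(2) ne by (intro add_mono mult_mono order_trans[OF nC]) (auto intro: mult_left_mono)
    finally have 1: "inner (C.app v) ?p \<le> real m * \<epsilon>" by simp
    have "inner (B v) ?p \<le> norm (B v) * norm ?p" by (rule norm_cauchy_schwarz)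
    also have "\<dots> \<le> (\<kappa> * 1) * \<theta>"
    proof (rule mult_mono)
      show "norm (B v) \<le> \<kappa> * 1" using B_bound[OF vH(1)] mult_left_mono[OF v(2) \<kappa>(1)] by simp
      show "norm ?p \<le> \<theta>" using \<theta>[OF v(1)] mult_left_mono[OF v(2) \<theta>0] by simp
    qed (use \<kappa> in auto)
    finally have 2: "inner (B v) ?p \<le> \<kappa> * \<theta>" by simp
    have pD: "?p \<in> D" using vD' by (simp add: E_dom)
    have "\<beta> * (norm ?p)\<^sup>2 \<le> inner (app ?p) ?p"
      using Pp_form[OF pD] E_idem[of "{\<beta>..}" v] vH by simp
    also have "app ?p = Pp (app v)" using vD' by (simp add: app_E)
    also have "inner (Pp (app v)) ?p = inner (app v) ?p"
      using E_sym[of "{\<beta>..}" "app v" ?p] E_idem[of "{\<beta>..}" v] vH pH vD' app_in by simp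
    also have "app v = C.app v + B v" using C_app[OF vD'] by simp
    finally have "\<beta> * (norm ?p)\<^sup>2 \<le> real m * \<epsilon> + \<kappa> * \<theta>" using 1 2 by (simp add: inner_add_left)
    moreover have "\<beta> * (\<theta>\<^sup>2 - \<epsilon>\<^sup>2) \<le> \<beta> * (norm ?p)\<^sup>2"
      using v(3) \<beta> by (intro mult_left_mono) simp_all
    ultimately show ?thesis by linarith
  qed
  have \<theta>1: "\<theta> \<le> 1"
    unfolding \<theta>_def
  proof (rule cSup_least)
    fix x assume "x \<in> T"
    then obtain v where "v \<in> H" "norm v \<le> 1" "x = norm (Pp v)" unfolding T_def V_def by auto
    then show "x \<le> 1" using E_norm_le[of "{\<beta>..}" v] by simp
  qed (use T0 in auto)
  have "\<beta> * \<theta>\<^sup>2 \<le> \<kappa> * \<theta>"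
  proof (rule ccontr)
    assume "\<not> ?thesis"
    then have g: "0 < \<beta> * \<theta>\<^sup>2 - \<kappa> * \<theta>" (is "0 < ?g") by simp
    \<comment> \<open>Chosen so that \<open>(\<beta> + m) \<epsilon>\<close> is at most half of
      \<open>?g\<close>, while \<open>\<epsilon> \<le> 1\<close> allows
      \<open>\<epsilon>\<^sup>2 \<le> \<epsilon>\<close>.\<close>
    define \<epsilon> where "\<epsilon> = min 1 (?g / (2 * (\<beta> + real m)))"
    have pos: "0 < \<beta> + real m" using \<beta> by simp
    have \<epsilon>: "0 < \<epsilon>" "\<epsilon> \<le> 1" using g pos unfolding \<epsilon>_def by auto
    have "\<epsilon> \<le> ?g / (2 * (\<beta> + real m))" unfolding \<epsilon>_def by simp
    then have "\<epsilon> * (\<beta> + real m) \<le> ?g / 2" using pos by (simp add: field_simps)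
    moreover have "\<beta> * \<epsilon>\<^sup>2 \<le> \<beta> * \<epsilon>" using \<epsilon> \<beta> by (intro mult_left_mono) (auto simp: power2_eq_square mult_le_one)
    moreover have "\<beta> * (\<theta>\<^sup>2 - \<epsilon>\<^sup>2) \<le> real m * \<epsilon> + \<kappa> * \<theta>" by (rule key[OF \<epsilon>(1) \<theta>1])
    ultimately show False using g by (simp add: algebra_simps)
  qed
  then have "\<beta> * \<theta> \<le> \<kappa>"
    using \<theta>0 \<kappa>(1) by (cases "\<theta> = 0") (auto simp: power2_eq_square mult.assoc[symmetric] mult_le_cancel_right)
  have vV: "v \<in> V" unfolding V_def using v by simp
  have "\<beta> * norm (Pp v) \<le> (\<beta> * \<theta>) * norm v"
    using mult_left_mono[OF \<theta>[OF vV], of \<beta>] \<beta> by (simp add: mult.assoc)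
  also have "\<dots> \<le> \<kappa> * norm v" using \<open>\<beta> * \<theta> \<le> \<kappa>\<close> by (rule mult_right_mono) simp
  finally show ?thesis .
qed

text \<open>The constant in \<open>sylvester_bounded\<close> does not depend on the truncation
  \<open>m\<close>, so it survives the limit.\<close>

lemma sylvester:
  assumes v: "v \<in> H" "N v = v"
  shows "\<beta> * norm (Pp v) \<le> \<kappa> * norm v"
proof (rule LIMSEQ_le)
  let ?v = "\<lambda>m. E' {- real m..<0} v"
  have lim: "?v \<longlonglongrightarrow> v" using C.E_lim[OF v(1)] v(2) by simp
  have vH: "?v m \<in> H" for m using v(1) by (simp add: C.E_in)
  have "(\<lambda>m. Pp (?v m) - Pp v) \<longlonglongrightarrow> 0"
  proof (rule tendsto_norm_zero_cancel, rule tendsto_sandwich[OF _ _ tendsto_const])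
    show "(\<lambda>m. norm (?v m - v)) \<longlonglongrightarrow> 0" using lim by (simp add: LIM_zero tendsto_norm_zero)
    show "\<forall>\<^sub>F m in sequentially. norm (Pp (?v m) - Pp v) \<le> norm (?v m - v)"
      using E_norm_le[of "{\<beta>..}"] vH v(1) by (simp add: E_diff[symmetric] H_diff)
  qed simp
  then have "(\<lambda>m. Pp (?v m)) \<longlonglongrightarrow> Pp v" by (rule LIM_zero_cancel)
  then show "(\<lambda>m. \<beta> * norm (Pp (?v m))) \<longlonglongrightarrow> \<beta> * norm (Pp v)" by (intro tendsto_intros)
  show "(\<lambda>m. \<kappa> * norm (?v m)) \<longlonglongrightarrow> \<kappa> * norm v" by (intro tendsto_intros lim)
  show "\<exists>M. \<forall>m\<ge>M. \<beta> * norm (Pp (?v m)) \<le> \<kappa> * norm (?v m)"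
    using sylvester_bounded[OF vH C.E_idem] v(1) by simp
qed

text \<open>The vectors \<open>v - Pp v\<close> with \<open>N v = v\<close>, together with the
  common kernel of \<open>N\<close> and \<open>Pp\<close>, fill the kernel of \<open>Pp\<close>.
  Applying \<open>N\<close> to the desired equation gives \<open>v = N (Pp v) + N w\<close>, whose
  right-hand side is a contraction with factor \<open>\<kappa> / \<beta>\<close> by
  \<open>sylvester\<close>.\<close>

lemma complement_split:
  assumes w: "w \<in> H" "Pp w = 0"
  obtains v k where "v \<in> H" "N v = v" "k \<in> H" "N k = 0" "Pp k = 0" "w = (v - Pp v) + k"
proof -
  let ?V = "{v \<in> H. N v = v}"
  let ?T = "\<lambda>v. N (Pp v) + N w"
  have "\<exists>!v\<in>?V. ?T v = v"
  proof (rule Banach_fix)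
    show "complete ?V" by (rule C.range_complete[OF complete]) simp
    have "0 \<in> ?V" using C.E_zero subspace_0[OF sub] by simp
    then show "?V \<noteq> {}" by blast
    show "0 \<le> \<kappa> / \<beta>" "\<kappa> / \<beta> < 1" using \<kappa> \<beta> by simp_all
    show "?T ` ?V \<subseteq> ?V"
      using w(1) by (auto simp: H_add C.E_in E_in C.E_add C.E_idem)
    fix x y assume xy: "x \<in> ?V" "y \<in> ?V"
    then have d: "x - y \<in> H" "N (x - y) = x - y" by (simp_all add: H_diff C.E_diff)
    have "?T x - ?T y = N (Pp (x - y))" using xy by (simp add: E_diff C.E_diff E_in)
    then have "norm (?T x - ?T y) \<le> norm (Pp (x - y))"
      using C.E_norm_le[of "{..<0}" "Pp (x - y)"] d(1) by (simp add: E_in)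
    also have "\<dots> \<le> \<kappa> / \<beta> * norm (x - y)" using sylvester[OF d] \<beta> by (simp add: field_simps)
    finally show "dist (?T x) (?T y) \<le> \<kappa> / \<beta> * dist x y" by (simp add: dist_norm)
  qed
  then obtain v where v: "v \<in> H" "N v = v" "N (Pp v) + N w = v" by auto
  define k where "k = w - (v - Pp v)"
  have pH: "Pp v \<in> H" using v(1) by (simp add: E_in)
  show ?thesis
  proof (rule that[OF v(1,2)])
    show "k \<in> H" unfolding k_def using v(1) pH w(1) by (intro H_diff)
    have "N k = N w - (N v - N (Pp v))" unfolding k_def using v(1) pH w(1) by (simp add: H_diff C.E_diff)
    then show "N k = 0" using v by (simp add: algebra_simps)
    have "Pp k = Pp w - (Pp v - Pp (Pp v))" unfolding k_def using v(1) pH w(1) by (simp add: H_diff E_diff)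
    then show "Pp k = 0" using w(2) E_idem[of "{\<beta>..}" v] v(1) by simp
    show "w = (v - Pp v) + k" unfolding k_def by simp
  qed
qed

end

section \<open>Dimension counts extracted from a Fredholm index\<close>

lemma linear_within_independent_lift:
  fixes f :: "'a::real_vector \<Rightarrow> 'a"
  assumes lin: "linear_within V f"
    and K: "finite K" "independent K" "K \<subseteq> V" "\<And>x. x \<in> K \<Longrightarrow> f x = 0"
    and S: "finite S" "independent S" and l: "\<And>s. s \<in> S \<Longrightarrow> l s \<in> V" "\<And>s. s \<in> S \<Longrightarrow> f (l s) = s"
  shows "independent (K \<union> l ` S) \<and> card (K \<union> l ` S) = card K + card S"
proof -
  have inj: "inj_on l S" using l(2) by (metis inj_onI)
  have lV: "l ` S \<subseteq> V" using l(1) by auto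
  have f_eq: "f (\<Sum>v\<in>l ` S. u v *\<^sub>R v) = (\<Sum>s\<in>S. u (l s) *\<^sub>R s)" for u
  proof -
    have "(\<Sum>v\<in>l ` S. u v *\<^sub>R v) = (\<Sum>s\<in>S. u (l s) *\<^sub>R l s)"
      using inj by (simp add: sum.reindex)
    then show ?thesis
      using linear_within_sum[OF lin S(1) lV, of "\<lambda>s. u (l s)"] l(2) by simp
  qed
  have coeff0: "\<forall>v\<in>l ` S. u v = 0" if "f (\<Sum>v\<in>l ` S. u v *\<^sub>R v) = 0" for u
    using that S(2) dependent_finite[OF S(1)] unfolding f_eq by auto
  have ind: "independent (l ` S)"
  proof
    assume "dependent (l ` S)"
    then obtain u v where "v \<in> l ` S" "u v \<noteq> 0" "(\<Sum>v\<in>l ` S. u v *\<^sub>R v) = 0"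
      using dependent_finite[of "l ` S"] S(1) by auto
    then show False using coeff0[of u] linear_within_0[OF lin] by auto
  qed
  have "x = 0 \<and> y = 0" if "x \<in> span K" "y \<in> span (l ` S)" "x + y = 0" for x y
  proof -
    have "f ` K \<subseteq> {0}" using K(4) by auto
    then have "span (f ` K) \<subseteq> {0}" using span_mono[of "f ` K" "{0}"] by simp
    then have "f x = 0" using linear_within_span[OF lin K(3) that(1)] by auto
    moreover have "x \<in> V" "y \<in> V"
      using that span_minimal[OF K(3) linear_within_subspace[OF lin]]
        span_minimal[OF lV linear_within_subspace[OF lin]] by auto
    ultimately have "f y = 0" using linear_within_add[OF lin, of x y] that(3) linear_within_0[OF lin] by simp
    moreover have "y \<in> range (\<lambda>u. \<Sum>v\<in>l ` S. u v *\<^sub>R v)"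
      using that(2) span_finite[of "l ` S"] S(1) by simp
    then obtain u where u: "y = (\<Sum>v\<in>l ` S. u v *\<^sub>R v)" by (rule rangeE)
    ultimately have "\<forall>v\<in>l ` S. u v = 0" using coeff0[of u] by simp
    then have "y = 0" unfolding u by (intro sum.neutral) simp
    then show ?thesis using that(3) by simp
  qed
  then have *: "independent (K \<union> l ` S) \<and> K \<inter> l ` S = {}"
    using independent_Un_direct[of K "l ` S"] K(1,2) S(1) ind by simp
  then show ?thesis
    using card_Un_disjoint[of K "l ` S"] K(1) S(1) card_image[OF inj] by simp
qed

lemma has_fredholm_index_witnesses:
  assumes "has_fredholm_index f V W n"
  obtains K F where "finite K" "independent K" "K \<subseteq> {u \<in> V. f u = 0}" "{u \<in> V. f u = 0} \<subseteq> span K"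
    "finite F" "F \<subseteq> W" "W \<subseteq> span (f ` V \<union> F)"
    "\<forall>F'. finite F' \<and> F' \<subseteq> W \<and> W \<subseteq> span (f ` V \<union> F') \<longrightarrow> card F \<le> card F'"
    "n = int (card K) - int (card F)"
proof -
  obtain k c where kc: "edim {u \<in> V. f u = 0} = enat k" "quotient_edim W (f ` V) = enat c" "n = int k - int c"
    using assms unfolding has_fredholm_index_def by auto
  obtain G where G: "finite G" "{u \<in> V. f u = 0} \<subseteq> span G" and dimk: "dim {u \<in> V. f u = 0} = k"
    using kc(1) unfolding edim_def by (auto split: if_splits)
  obtain K where K: "K \<subseteq> {u \<in> V. f u = 0}" "independent K" "{u \<in> V. f u = 0} \<subseteq> span K" "card K = dim {u \<in> V. f u = 0}"
    by (rule basis_exists)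
  have finK: "finite K" using independent_span_bound[OF G(1) K(2)] K(1) G(2) by (simp add: subset_trans)
  define S where "S = {F. finite F \<and> F \<subseteq> W \<and> W \<subseteq> span (f ` V \<union> F)}"
  have inf: "Inf ((\<lambda>F. enat (card F)) ` S) = enat c"
    using kc(2) unfolding quotient_edim_def S_def .
  \<comment> \<open>The infimum over the empty set is \<open>\<infinity>\<close>, not a finite
    \<open>c\<close>; over a nonempty set of extended naturals it is attained.\<close>
  have "S \<noteq> {}"
  proof
    assume "S = {}"
    then show False using inf by (simp add: Inf_enat_def)
  qed
  then obtain F0 where "F0 \<in> S" by auto
  then have "Inf ((\<lambda>F. enat (card F)) ` S) \<in> (\<lambda>F. enat (card F)) ` S"
    by (intro wellorder_InfI[of "enat (card F0)"] imageI)
  then have "enat c \<in> (\<lambda>F. enat (card F)) ` S" unfolding inf .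
  then obtain F where F: "F \<in> S" "card F = c" by auto
  have least: "c \<le> card F'" if "F' \<in> S" for F'
  proof -
    have "enat c \<le> enat (card F')" unfolding inf[symmetric] by (rule Inf_lower) (use that in auto)
    then show ?thesis by simp
  qed
  show ?thesis
  proof (rule that[OF finK K(2,1,3)])
    show "finite F" "F \<subseteq> W" "W \<subseteq> span (f ` V \<union> F)" using F(1) unfolding S_def by simp_all
    show "\<forall>F'. finite F' \<and> F' \<subseteq> W \<and> W \<subseteq> span (f ` V \<union> F') \<longrightarrow> card F \<le> card F'"
      using least F(2) unfolding S_def by simp
    show "n = int (card K) - int (card F)" using kc(3) K(4) dimk F(2) by simp
  qed
qed

context gap
begin

abbreviation "P \<equiv> E {..<0}"
abbreviation "Xm \<equiv> E {-\<beta><..<0}"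
abbreviation "Xp \<equiv> E {0..<\<beta>}"

lemma PX_eq: "u \<in> H \<Longrightarrow> PX u = Xm u + Xp u"
proof -
  assume u: "u \<in> H"
  have "{-\<beta><..<\<beta>} = {-\<beta><..<0} \<union> {0..<\<beta>}" using \<beta> by auto
  moreover have "{-\<beta><..<0} \<inter> {0..<\<beta>} = {}" by auto
  ultimately show ?thesis using E_Un[of "{-\<beta><..<0}" "{0..<\<beta>}" u] u by simp
qed

lemma X_basis:
  assumes "M \<in> sets borel" "M \<subseteq> {-\<beta><..<\<beta>}"
  obtains U where "finite U" "independent U" "U \<subseteq> E M ` H" "E M ` H \<subseteq> span U"
proof -
  obtain U where U: "U \<subseteq> E M ` H" "independent U" "E M ` H \<subseteq> span U"
    by (rule maximal_independent_subset)
  have "E M ` H \<subseteq> PX ` H"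
  proof
    fix x assume "x \<in> E M ` H"
    then obtain u where u: "u \<in> H" "x = E M u" by auto
    moreover have "{-\<beta><..<\<beta>} \<inter> M = M" using assms(2) by auto
    ultimately have "PX x = x" using E_Int[of "{-\<beta><..<\<beta>}" M u] assms(1) by simp
    then show "x \<in> PX ` H" using u E_in assms(1) by (intro image_eqI[of _ _ x]) simp_all
  qed
  then have "U \<subseteq> span G" using U(1) fin(2) by blast
  then show ?thesis using that U independent_span_bound[OF fin(1) U(2)] by blast
qed

end

context pert
begin

lemma N_range: "N ` H = {v \<in> H. N v = v}"
  using N_in N_idem by force

text \<open>The kernel of the index map contributes \<open>card K\<close>. The image of the map
  misses at most \<open>card F\<close> dimensions of the range of \<open>Xm\<close>, so at least
  \<open>card U - card F\<close> of them lift to the range of \<open>N\<close>. Kernel vectors and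
  lifts all satisfy \<open>Pm v = 0\<close>, because \<open>Pm v = Pm (P v)\<close>.\<close>

lemma negative_dimension:
  assumes n: "has_fredholm_index P (N ` H) (P ` H) n" and U: "finite U" "independent U" "U \<subseteq> Xm ` H" "Xm ` H \<subseteq> span U"
  obtains S where "finite S" "independent S" "S \<subseteq> {v \<in> H. N v = v \<and> Pm v = 0}"
    "n + int (card U) \<le> int (card S)"
proof -
  obtain K F where K: "finite K" "independent K" "K \<subseteq> {u \<in> N ` H. P u = 0}" "{u \<in> N ` H. P u = 0} \<subseteq> span K"
    and F: "finite F" "F \<subseteq> P ` H" "P ` H \<subseteq> span (P ` N ` H \<union> F)"
    "\<forall>F'. finite F' \<and> F' \<subseteq> P ` H \<and> P ` H \<subseteq> span (P ` N ` H \<union> F') \<longrightarrow> card F \<le> card F'"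
    and nKF: "n = int (card K) - int (card F)"
    by (rule has_fredholm_index_witnesses[OF n])
  have linP: "linear_within H P" by (rule E_linear) simp
  have NH: "subspace (N ` H)" by (rule C.E_range_subspace) simp
  have NHH: "N ` H \<subseteq> H" unfolding N_range by auto
  have linN: "linear_within (N ` H) P"
    using NH linP NHH unfolding linear_within_def by blast
  define W where "W = P ` N ` H"
  have W: "subspace W" unfolding W_def by (rule linear_within_image_subspace[OF linP NH NHH])
  obtain Bm where Bm: "Bm \<subseteq> W" "independent Bm" "W \<subseteq> span Bm" by (rule maximal_independent_subset)
  have spBm: "span Bm = W" using span_minimal[OF Bm(1) W] Bm(3) by simp
  \<comment> \<open>A basis of the image \<open>W\<close> is completed by vectors from the range of
    \<open>Xm\<close>; the added ones, \<open>T\<close>, count that range modulo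
    \<open>W\<close>.\<close>
  obtain B' where B': "Bm \<subseteq> B'" "B' \<subseteq> Bm \<union> Xm ` H" "independent B'" "Bm \<union> Xm ` H \<subseteq> span B'"
    using maximal_independent_subset_extend[of Bm "Bm \<union> Xm ` H"] Bm(2) by blast
  define T where "T = B' - Bm"
  have TX: "T \<subseteq> Xm ` H" using B'(2) unfolding T_def by blast
  have BT: "B' = Bm \<union> T" using B'(1) unfolding T_def by blast
  have XmP: "x \<in> H \<and> P x = x \<and> Pm x = 0 \<and> Xm x = x" if x: "x \<in> Xm ` H" for x
  proof -
    obtain u where u: "u \<in> H" "x = Xm u" using x by auto
    have "{..<0} \<inter> {-\<beta><..<0} = {-\<beta><..<0}" "{..-\<beta>} \<inter> {-\<beta><..<0} = {}" by (auto simp: less_imp_le)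
    then show ?thesis
      using u E_Int[of "{..<0}" "{-\<beta><..<0}" u] E_disj[of "{..-\<beta>}" "{-\<beta><..<0}" u] E_idem[of "{-\<beta><..<0}" u]
      by (simp add: E_in)
  qed
  have "T \<subseteq> P ` H" using TX XmP by (metis image_eqI subsetD subsetI)
  then have "T \<subseteq> span (W \<union> F)" using F(3) unfolding W_def by (rule subset_trans)
  also have "span (W \<union> F) = span (Bm \<union> F)"
    unfolding span_Un spBm span_eq_iff[THEN iffD2, OF W] ..
  finally have T: "finite T \<and> card T \<le> card F"
    using B'(3) F(1) unfolding BT by (intro independent_mod_card) (auto simp: T_def)
  obtain S where S: "S \<subseteq> Xm ` H \<inter> W" "independent S" "Xm ` H \<inter> W \<subseteq> span S"
    by (rule maximal_independent_subset)
  have Xms: "subspace (Xm ` H)" by (rule E_range_subspace) simp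
  have finS: "finite S"
    using independent_span_bound[OF U(1) S(2)] S(1) U(4) by blast
  have "U \<subseteq> span (S \<union> T)"
  proof
    fix u assume u: "u \<in> U"
    then have "u \<in> span (Bm \<union> T)" using U(3) B'(4) BT by auto
    then obtain a b where ab: "u = a + b" "a \<in> span Bm" "b \<in> span T" unfolding span_Un by auto
    have b: "b \<in> Xm ` H" using ab(3) span_minimal[OF TX Xms] by auto
    have "a = u - b" using ab by simp
    then have "a \<in> Xm ` H" using u U(3) b subspace_diff[OF Xms] by auto
    then have "a \<in> span S" using ab(2) spBm S(3) by auto
    then show "u \<in> span (S \<union> T)" unfolding span_Un using ab by blast
  qed
  then have "card U \<le> card (S \<union> T)"
    using independent_span_bound[of "S \<union> T" U] finS T U(2) by simp
  also have "\<dots> \<le> card S + card T" by (rule card_Un_le)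
  finally have cU: "card U \<le> card S + card F" using T by simp
  have "\<forall>s\<in>S. \<exists>v. v \<in> N ` H \<and> P v = s"
  proof
    fix s assume "s \<in> S"
    then have "s \<in> W" using S(1) by (simp add: subset_iff)
    then have "s \<in> P ` (N ` H)" unfolding W_def .
    then show "\<exists>v. v \<in> N ` H \<and> P v = s" by (elim imageE[of _ P]) (rule exI, rule conjI, assumption, simp)
  qed
  from bchoice[OF this] obtain l where l': "\<forall>s\<in>S. l s \<in> N ` H \<and> P (l s) = s" ..
  then have l: "\<And>s. s \<in> S \<Longrightarrow> l s \<in> N ` H" "\<And>s. s \<in> S \<Longrightarrow> P (l s) = s"
    by simp_all
  have lift: "independent (K \<union> l ` S) \<and> card (K \<union> l ` S) = card K + card S"
    by (rule linear_within_independent_lift[OF linN K(1,2) _ _ finS S(2) l]) (use K(3) in blast)+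
  have PmP: "Pm v = Pm (P v)" if "v \<in> H" for v
  proof -
    have "{..-\<beta>} \<inter> {..<0} = {..-\<beta>}" using \<beta> by auto
    then show ?thesis using E_Int[of "{..-\<beta>}" "{..<0}" v] that by simp
  qed
  show ?thesis
  proof (rule that[of "K \<union> l ` S"])
    show "K \<union> l ` S \<subseteq> {v \<in> H. N v = v \<and> Pm v = 0}"
    proof
      fix v assume "v \<in> K \<union> l ` S"
      then consider "v \<in> K" | s where "s \<in> S" "v = l s" by blast
      then show "v \<in> {v \<in> H. N v = v \<and> Pm v = 0}"
      proof cases
        case 1
        then show ?thesis using subsetD[OF K(3)] PmP[of v] E_zero[of "{..-\<beta>}"] unfolding N_range by simp
      next
        case 2
        have "v \<in> N ` H" "P v = s" using l[OF 2(1)] 2(2) by simp_all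
        moreover have "s \<in> Xm ` H" using S(1) 2(1) by (simp add: subset_iff)
        from XmP[OF this] have "Pm s = 0" by (elim conjE)
        ultimately show ?thesis using PmP[of v] unfolding N_range by simp
      qed
    qed
    show "finite (K \<union> l ` S)" "independent (K \<union> l ` S)" using K(1) finS lift by simp_all
    show "n + int (card U) \<le> int (card (K \<union> l ` S))" using lift cU nKF by linarith
  qed
qed

text \<open>By \<open>complement_split\<close> the kernel of \<open>Pp\<close> is spanned by
  \<open>M\<close>, the image of the range of \<open>N\<close> under \<open>1 - Pp\<close>, and a
  basis \<open>T\<close> of the wanted space. Modulo \<open>M\<close>, the range of
  \<open>Xp\<close> contributes \<open>T1\<close>, and \<open>T\<close> adds a further
  \<open>T2\<close>. Then \<open>card U \<le> card K + card T1\<close>,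
  \<open>card F \<le> card T2\<close> and \<open>card T1 + card T2 \<le> card T\<close>.\<close>

lemma positive_dimension:
  assumes n: "has_fredholm_index P (N ` H) (P ` H) n" and U: "finite U" "independent U" "U \<subseteq> Xp ` H" "Xp ` H \<subseteq> span U"
  obtains S where "finite S" "independent S" "S \<subseteq> {v \<in> H. N v = 0 \<and> Pp v = 0}"
    "int (card U) - n \<le> int (card S)"
proof -
  obtain K F where K: "finite K" "independent K" "K \<subseteq> {u \<in> N ` H. P u = 0}" "{u \<in> N ` H. P u = 0} \<subseteq> span K"
    and F: "finite F" "F \<subseteq> P ` H" "P ` H \<subseteq> span (P ` N ` H \<union> F)" "\<forall>F'. finite F' \<and> F' \<subseteq> P ` H \<and> P ` H \<subseteq> span (P ` N ` H \<union> F') \<longrightarrow> card F \<le> card F'"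
    and nKF: "n = int (card K) - int (card F)"
    by (rule has_fredholm_index_witnesses[OF n])
  define K2 where "K2 = {v \<in> H. N v = 0 \<and> Pp v = 0}"
  obtain T where T: "T \<subseteq> K2" "independent T" "K2 \<subseteq> span T" by (rule maximal_independent_subset)
  show ?thesis
  proof (cases "finite T")
    case False
    \<comment> \<open>An infinite-dimensional space contains independent sets of every finite size;
      \<open>nat\<close> covers a negative difference.\<close>
    then obtain S where "S \<subseteq> T" "finite S" "card S = nat (int (card U) - n)"
      by (metis infinite_arbitrarily_large)
    then show ?thesis using that[of S] T independent_mono[OF T(2)] unfolding K2_def by auto
  next
    case finT: True
    define GG where "GG = {w \<in> H. Pp w = 0}"
    define Q where "Q v = v - Pp v" for v
    have linP: "linear_within H P" by (rule E_linear) simp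
    have NHH: "N ` H \<subseteq> H" unfolding N_range by auto
    have linQ: "linear_within H Q"
      unfolding linear_within_def Q_def using sub by (simp add: E_add E_scale scaleR_diff_right)
    have QH: "Q v \<in> H" "Pp (Q v) = 0" if "v \<in> H" for v
      unfolding Q_def using that by (simp_all add: H_diff E_in E_diff E_idem)
    have NH: "subspace (N ` H)" by (rule C.E_range_subspace) simp
    define M where "M = Q ` N ` H"
    have MGG: "M \<subseteq> GG" unfolding M_def GG_def using QH NHH by auto
    have Ms: "subspace M" unfolding M_def by (rule linear_within_image_subspace[OF linQ NH NHH])
    have GGM: "GG \<subseteq> span (M \<union> T)"
    proof
      fix w assume "w \<in> GG"
      then have "w \<in> H" "Pp w = 0" unfolding GG_def by auto
      then obtain v k where vk: "v \<in> H" "N v = v" "k \<in> H" "N k = 0" "Pp k = 0" "w = (v - Pp v) + k"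
        by (rule complement_split)
      have "v \<in> N ` H" using vk unfolding N_range by simp
      then have "v - Pp v \<in> M" unfolding M_def Q_def by blast
      moreover have "k \<in> span T" using vk T(3) unfolding K2_def by auto
      ultimately show "w \<in> span (M \<union> T)" unfolding vk(6) span_Un using span_base by blast
    qed
    obtain Bm where Bm: "Bm \<subseteq> M" "independent Bm" "M \<subseteq> span Bm" by (rule maximal_independent_subset)
    have spBm: "span Bm = M" using span_minimal[OF Bm(1) Ms] Bm(3) by simp
    obtain B1 where B1: "Bm \<subseteq> B1" "B1 \<subseteq> Bm \<union> Xp ` H" "independent B1" "Bm \<union> Xp ` H \<subseteq> span B1"
      using maximal_independent_subset_extend[of Bm "Bm \<union> Xp ` H"] Bm(2) by blast
    obtain B2 where B2: "B1 \<subseteq> B2" "B2 \<subseteq> B1 \<union> T" "independent B2" "B1 \<union> T \<subseteq> span B2"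
      using maximal_independent_subset_extend[of B1 "B1 \<union> T"] B1(3) by blast
    define T1 where "T1 = B1 - Bm"
    define T2 where "T2 = B2 - B1"
    have T1X: "T1 \<subseteq> Xp ` H" using B1(2) unfolding T1_def by blast
    have T2T: "T2 \<subseteq> T" using B2(2) unfolding T2_def by blast
    have B1e: "B1 = Bm \<union> T1" and B2e: "B2 = Bm \<union> (T1 \<union> T2)"
      using B1(1) B2(1) unfolding T1_def T2_def by auto
    have XpP: "x \<in> H \<and> Pp x = 0 \<and> P x = 0" if x: "x \<in> Xp ` H" for x
    proof -
      obtain u where u: "u \<in> H" "x = Xp u" using x by auto
      have "{\<beta>..} \<inter> {0..<\<beta>} = {}" "{..<0} \<inter> {0..<\<beta>} = {}" by auto
      then show ?thesis
        using u E_disj[of "{\<beta>..}" "{0..<\<beta>}" u] E_disj[of "{..<0}" "{0..<\<beta>}" u] by (simp add: E_in)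
    qed
    have K2GG: "K2 \<subseteq> GG" unfolding K2_def GG_def by auto
    have "T1 \<union> T2 \<subseteq> GG"
      using T1X T2T T(1) XpP K2GG unfolding GG_def by blast
    then have "T1 \<union> T2 \<subseteq> span (M \<union> T)" using GGM by (rule subset_trans)
    also have "span (M \<union> T) = span (Bm \<union> T)" unfolding span_Un spBm span_eq_iff[THEN iffD2, OF Ms] ..
    finally have c12: "finite (T1 \<union> T2) \<and> card (T1 \<union> T2) \<le> card T"
    proof (intro independent_mod_card)
      show "independent (Bm \<union> (T1 \<union> T2))" using B2(3) unfolding B2e .
      show "Bm \<inter> (T1 \<union> T2) = {}" using B1(1) unfolding T1_def T2_def by auto
    qed (use finT in simp_all)
    have "card (T1 \<union> T2) = card T1 + card T2"
      using c12 B1e by (intro card_Un_disjoint) (auto simp: T2_def)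
    then have card12: "card T1 + card T2 \<le> card T" using c12 by simp
    have fin12: "finite T1" "finite T2" using c12 by auto
    have T2H: "T2 \<subseteq> H" using T2T T(1) unfolding K2_def by auto
    \<comment> \<open>\<open>F\<close> is minimal, so it suffices that the image of
      \<open>T2\<close> spans modulo the image of the index map: \<open>P\<close> annihilates
      \<open>T1\<close>, and it maps \<open>M\<close> into the image of the index map since
      \<open>P (v - Pp v) = P v\<close>.\<close>
    have "card F \<le> card (P ` T2)"
    proof (rule F(4)[rule_format], intro conjI)
      show "P ` H \<subseteq> span (P ` N ` H \<union> P ` T2)"
      proof
        fix w assume "w \<in> P ` H"
        then obtain u where u: "u \<in> H" "w = P u" by blast
        have d: "{\<beta>..} \<inter> {..<0} = {}" using \<beta> by auto
        have w: "w \<in> H" "P w = w" "Pp w = 0"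
          using u E_disj[of "{\<beta>..}" "{..<0}" u] d by (simp_all add: E_in E_idem)
        then have "w \<in> span (M \<union> T)" using GGM unfolding GG_def by blast
        moreover have "M \<union> T \<subseteq> span B2"
          using spBm B2(4) span_mono[of Bm B2] B2e by auto
        ultimately have wB2: "w \<in> span B2" using span_minimal[of "M \<union> T" "span B2"] by auto
        have "B2 \<subseteq> H" using Bm(1) MGG T1X XpP T2H unfolding B2e GG_def by blast
        then have "P w \<in> span (P ` B2)" using linear_within_span[OF linP _ wB2] by simp
        moreover have "P ` B2 \<subseteq> span (P ` N ` H \<union> P ` T2)"
        proof
          fix z assume "z \<in> P ` B2"
          then obtain b where b: "b \<in> B2" "z = P b" by blast
          consider "b \<in> Bm" | "b \<in> T1" | "b \<in> T2" using b(1) B2e by blast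
          then show "z \<in> span (P ` N ` H \<union> P ` T2)"
          proof cases
            case 1
            then obtain v where v: "v \<in> N ` H" "b = Q v" using Bm(1) unfolding M_def by blast
            have vH: "v \<in> H" using v(1) NHH by blast
            have "{..<0} \<inter> {\<beta>..} = {}" using \<beta> by auto
            then have "P b = P v" using v(2) vH E_disj[of "{..<0}" "{\<beta>..}" v] unfolding Q_def by (simp add: E_diff E_in)
            then show ?thesis using b(2) v(1) by (intro span_base) blast
          next
            case 2
            then have "b \<in> Xp ` H" using T1X by (simp add: subset_iff)
          from XpP[OF this] have "z = 0" using b(2) by simp
            then show ?thesis by (simp add: span_0)
          next
            case 3
            then show ?thesis using b(2) by (intro span_base) blast
          qed
        qed
        ultimately show "w \<in> span (P ` N ` H \<union> P ` T2)"
          using w(2) span_minimal[of "P ` B2" "span (P ` N ` H \<union> P ` T2)"] by auto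
      qed
    qed (use fin12 T2H in auto)
    then have cF: "card F \<le> card T2" using card_image_le[OF fin12(2), of P] by simp
    \<comment> \<open>If \<open>v - Pp v\<close> lies in the range of \<open>Xp\<close>, then
      \<open>P v = 0\<close>, so \<open>v\<close> is in the kernel spanned by
      \<open>K\<close>.\<close>
    have "U \<subseteq> span (Q ` K \<union> T1)"
    proof
      fix x assume "x \<in> U"
      then have xX: "x \<in> Xp ` H" using U(3) by blast
      then have "x \<in> span (Bm \<union> T1)" using B1(4) B1e by blast
      then obtain m t where mt: "x = m + t" "m \<in> span Bm" "t \<in> span T1" unfolding span_Un by auto
      have Xps: "subspace (Xp ` H)" by (rule E_range_subspace) simp
      have "t \<in> Xp ` H" using mt(3) span_minimal[OF T1X Xps] by auto
      then have mX: "m \<in> Xp ` H" using mt(1) xX subspace_diff[OF Xps, of x t] by simp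
      obtain v where v: "v \<in> N ` H" "m = Q v" using mt(2) spBm unfolding M_def by auto
      have vH: "v \<in> H" using v(1) NHH by blast
      have "{..<0} \<inter> {\<beta>..} = {}" using \<beta> by auto
      then have "P m = P v" using v(2) vH E_disj[of "{..<0}" "{\<beta>..}" v] unfolding Q_def by (simp add: E_diff E_in)
      then have "P v = 0" using XpP[OF mX] by simp
      then have "v \<in> span K" using K(4) v(1) by blast
      moreover have "K \<subseteq> H" using K(3) NHH by blast
      ultimately have "m \<in> span (Q ` K)" using linear_within_span[OF linQ, of K v] v(2) by simp
      then show "x \<in> span (Q ` K \<union> T1)" unfolding span_Un using mt by blast
    qed
    then have "card U \<le> card (Q ` K \<union> T1)"
      using independent_span_bound[of "Q ` K \<union> T1" U] K(1) fin12 U(2) by simp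
    also have "\<dots> \<le> card (Q ` K) + card T1" by (rule card_Un_le)
    also have "card (Q ` K) \<le> card K" by (rule card_image_le[OF K(1)])
    finally have "card U \<le> card K + card T1" by simp
    then have "int (card U) - n \<le> int (card T)" using cF card12 nKF by linarith
    then show ?thesis using that[of T] finT T unfolding K2_def by simp
  qed
qed

end

section \<open>Finite-dimensional spaces on which the form of \<open>C\<close> is definite\<close>

context pert
begin

lemma N_form:
  assumes "x \<in> D" "N x = x" "x \<noteq> 0"
  shows "inner (C.app x) x < 0"
proof -
  have "inner (C.app x) x < 0 * (norm x)\<^sup>2"
    by (rule C.form_less[OF C.app_graph, of _ "{..<0}"]) (use assms C_dom in auto)
  then show ?thesis by simp
qed

lemma N_app: "x \<in> D \<Longrightarrow> N x \<in> D" "x \<in> D \<Longrightarrow> C.app (N x) = N (C.app x)"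
  using C.E_dom[of "{..<0}" x] C.app_E[of "{..<0}" x] C_dom by simp_all

lemma N_kernel: "k \<in> D \<Longrightarrow> C.app k = 0 \<Longrightarrow> N k = 0"
proof (rule ccontr)
  assume k: "k \<in> D" "C.app k = 0" "N k \<noteq> 0"
  have "inner (C.app (N k)) (N k) < 0"
    using k N_app by (intro N_form) (simp_all add: N_idem dom_in)
  then show False using k N_app C.E_zero[of "{..<0}"] by simp
qed

lemma nonneg_form:
  assumes "x \<in> D" "N x = 0" shows "0 \<le> inner (C.app x) x"
proof -
  have x: "x \<in> H" using assms dom_in by simp
  have "- {..<0} = {0::real..}" by auto
  then have "E' {0..} x = x" using C.E_Compl[of "{..<0}" x] x assms(2) by simp
  then have "0 * (norm x)\<^sup>2 \<le> inner (C.app x) x"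
    by (intro C.form_ge[OF C.app_graph, of _ "{0..}"]) (use assms C_dom in auto)
  then show ?thesis by simp
qed

text \<open>The form is nonnegative where \<open>N\<close> vanishes, so a zero of it is a minimum
  and the first variation \<open>inner (C.app x) w\<close> vanishes for all such \<open>w\<close>;
  together with \<open>N (C.app x) = 0\<close> this makes \<open>x\<close> a kernel vector.\<close>

lemma pos_form:
  assumes ker: "\<And>k. k \<in> D \<Longrightarrow> C.app k = 0 \<Longrightarrow> k = 0" and x: "x \<in> D" "N x = 0" "x \<noteq> 0"
  shows "0 < inner (C.app x) x"
proof (rule ccontr)
  assume "\<not> ?thesis"
  then have x0: "inner (C.app x) x = 0" using nonneg_form[OF x(1,2)] by simp
  have CxH: "C.app x \<in> H" using x C.app_in C_dom by simp
  have NCx: "N (C.app x) = 0" using N_app(2)[OF x(1)] x(2) C.app_0 by simp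
  have "C.app x = 0"
  proof (rule orth_dom[OF CxH])
    fix u v assume "(u, v) \<in> A"
    then have u: "u \<in> D" by auto
    have uH: "u \<in> H" using u dom_in by simp
    define w where "w = u - N u"
    have w: "w \<in> D" "N w = 0"
      unfolding w_def using u uH N_app N_idem by (simp_all add: dom_diff C.E_diff N_in)
    define a b where "a = inner (C.app x) w" and "b = inner (C.app w) w"
    have b: "0 \<le> b" unfolding b_def using nonneg_form[OF w] .
    \<comment> \<open>The form at \<open>x + t w\<close> is \<open>2 t a + t\<^sup>2 b\<close>;
      dividing by \<open>b + 1\<close> instead of \<open>b\<close> avoids the case
      \<open>b = 0\<close>, and the value becomes \<open>- t\<^sup>2 (b + 2)\<close>.\<close>
    define t where "t = - a / (b + 1)"
    have tw: "t *\<^sub>R w \<in> D" "N (t *\<^sub>R w) = 0" using w dom_in by (simp_all add: dom_scale C.E_scale)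
    have "x + t *\<^sub>R w \<in> D" "N (x + t *\<^sub>R w) = 0"
      using x tw by (simp_all add: dom_add C.E_add dom_in)
    then have "0 \<le> inner (C.app (x + t *\<^sub>R w)) (x + t *\<^sub>R w)" by (rule nonneg_form)
    also have "C.app (x + t *\<^sub>R w) = C.app x + t *\<^sub>R C.app w"
      using x w tw C.app_add[of x "t *\<^sub>R w"] C.app_scale[of w t] C_dom by simp
    also have "inner (C.app x + t *\<^sub>R C.app w) (x + t *\<^sub>R w) = 2 * t * a + t * t * b"
      using C.app_sym[of x w] x w C_dom x0
      unfolding a_def b_def by (simp add: inner_add_left inner_add_right inner_commute[of x] algebra_simps)
    also have at: "a = - t * (b + 1)" using b unfolding t_def by simp
    also have "2 * t * (- t * (b + 1)) + t * t * b = - (t\<^sup>2 * (b + 2))"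
      by (simp add: power2_eq_square algebra_simps)
    finally have "t\<^sup>2 * (b + 2) \<le> 0" by simp
    then have "t\<^sup>2 \<le> 0" using b by (simp add: mult_le_0_iff)
    then have "a = 0" using at by simp
    moreover have "inner (C.app x) (N u) = 0"
      using C.E_sym[of "{..<0}" "C.app x" u] CxH uH NCx by simp
    ultimately show "inner (C.app x) u = 0" unfolding a_def w_def by (simp add: inner_diff_right)
  qed
  then show False using ker x by blast
qed

text \<open>Used with \<open>\<sigma>\<close> equal to -1 and to 1. The preimages of
  \<open>S\<close> under \<open>C\<close> lie in the domain, where the form makes sense, and
  \<open>C\<close> maps their span back into \<open>V\<close>; finite dimension turns definiteness
  into the bound \<open>\<gamma>\<close>.\<close>

lemma definite_space:
  assumes S: "finite S" "independent S" "S \<subseteq> V" and V: "subspace V"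
    and Z: "subspace Z" "Z \<subseteq> D" and solve: "\<And>s. s \<in> S \<Longrightarrow> \<exists>z\<in>Z. C.app z = s"
    and pos: "\<And>z. z \<in> Z \<Longrightarrow> z \<noteq> 0 \<Longrightarrow> 0 < \<sigma> * inner (C.app z) z"
  obtains L \<gamma> where "finite L" "independent L" "card L = card S" "L \<subseteq> D" "0 < \<gamma>"
    "\<forall>l\<in>span L. C.app l \<in> V \<and> \<gamma> * (norm l)\<^sup>2 \<le> \<sigma> * inner (C.app l) l"
proof -
  have "\<forall>s\<in>S. \<exists>z. z \<in> Z \<and> C.app z = s" using solve unfolding Bex_def by (intro ballI)
  from bchoice[OF this] obtain l where "\<forall>s\<in>S. l s \<in> Z \<and> C.app (l s) = s" ..
  then have l: "\<And>s. s \<in> S \<Longrightarrow> l s \<in> Z" "\<And>s. s \<in> S \<Longrightarrow> C.app (l s) = s" by simp_all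
  have lin: "linear_within D C.app" using C.app_linear unfolding C_dom .
  have lD: "\<And>s. s \<in> S \<Longrightarrow> l s \<in> D" using l(1) Z(2) by (rule subsetD[rotated])
  have ind: "independent (l ` S) \<and> card (l ` S) = card S"
    using linear_within_independent_lift[OF lin, of "{}" S l] S(1,2) lD l(2) independent_empty by simp
  have LD: "l ` S \<subseteq> D" using lD by auto
  have sZ: "span (l ` S) \<subseteq> Z" by (rule span_minimal[OF _ Z(1)]) (use l(1) in auto)
  have CV: "C.app x \<in> V" if "x \<in> span (l ` S)" for x
  proof -
    have "C.app ` l ` S = S" using l(2) by (force simp: image_image)
    then have "C.app x \<in> span S" using linear_within_span[OF lin LD that] by simp
    then show ?thesis using span_minimal[OF S(3) V] by auto
  qed
  interpret q: posdef_form "span (l ` S)" "\<lambda>x y. \<sigma> * inner (C.app x) y"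
  proof
    fix x y z c assume x: "x \<in> span (l ` S)" and y: "y \<in> span (l ` S)"
    have xy: "x \<in> D" "y \<in> D" using x y sZ Z(2) by auto
    show "\<sigma> * inner (C.app (x + y)) z = \<sigma> * inner (C.app x) z + \<sigma> * inner (C.app y) z"
      using xy C.app_add C_dom by (simp add: inner_add_left distrib_left)
    show "\<sigma> * inner (C.app (c *\<^sub>R x)) y = c * (\<sigma> * inner (C.app x) y)"
      using xy C.app_scale C_dom by simp
    show "\<sigma> * inner (C.app x) y = \<sigma> * inner (C.app y) x"
      using xy C.app_sym[of x y] C_dom by (simp add: inner_commute)
  next
    fix x assume "x \<in> span (l ` S)" "x \<noteq> 0"
    then show "0 < \<sigma> * inner (C.app x) x" using pos[of x] sZ by auto
  qed (rule subspace_span)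
  obtain \<gamma> where \<gamma>: "0 < \<gamma>" "\<And>x. x \<in> span (l ` S) \<Longrightarrow> \<gamma> * (norm x)\<^sup>2 \<le> \<sigma> * inner (C.app x) x"
    using q.bounded_below[of "l ` S"] S(1) span_superset by blast
  show ?thesis
  proof (rule that[of "l ` S" \<gamma>])
    show "\<forall>x\<in>span (l ` S). C.app x \<in> V \<and> \<gamma> * (norm x)\<^sup>2 \<le> \<sigma> * inner (C.app x) x"
      using CV \<gamma>(2) by blast
  qed (use S(1) ind LD \<gamma>(1) in simp_all)
qed

lemma E_kernel_subspace: "M \<in> sets borel \<Longrightarrow> subspace {x \<in> H. E M x = 0}"
  using sub by (auto simp: subspace_def E_zero E_add E_scale)

lemma negative_space:
  assumes S: "finite S" "independent S" "S \<subseteq> {v \<in> H. N v = v \<and> Pm v = 0}"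
  obtains L \<gamma> where "finite L" "independent L" "card L = card S" "L \<subseteq> D" "0 < \<gamma>"
    "\<forall>l\<in>span L. C.app l \<in> {x \<in> H. Pm x = 0} \<and> \<gamma> * (norm l)\<^sup>2 \<le> -1 * inner (C.app l) l"
proof (rule definite_space[OF S(1,2), of "{x \<in> H. Pm x = 0}" "{z \<in> D. N z = z}" "-1"])
  show "S \<subseteq> {x \<in> H. Pm x = 0}" using S(3) by auto
  show "subspace {z \<in> D. N z = z}"
    using dom_subspace dom_in unfolding subspace_def by (simp add: C.E_zero C.E_add C.E_scale)
  fix s assume "s \<in> S"
  then have s: "s \<in> H" "N s = s" using S(3) by auto
  \<comment> \<open>\<open>C\<close> may have a kernel here, but \<open>N\<close> annihilates it and
    fixes \<open>s\<close>, so \<open>C_solve\<close> applies; replacing \<open>z\<close> by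
    \<open>N z\<close> keeps the equation.\<close>
  have "inner s k = 0" if "k \<in> D" "C.app k = 0" for k
    using C.E_sym[of "{..<0}" s k] s N_kernel[OF that] dom_in[OF that(1)] by simp
  then obtain z where z: "z \<in> D" "C.app z = s" using C_solve[OF s(1)] by blast
  then show "\<exists>z\<in>{z \<in> D. N z = z}. C.app z = s"
    using N_app s N_idem dom_in by (intro bexI[of _ "N z"]) simp_all
next
  fix z assume "z \<in> {z \<in> D. N z = z}" "z \<noteq> 0"
  then show "0 < -1 * inner (C.app z) z" using N_form[of z] by simp
next
  fix L \<gamma>
  assume "finite L" "independent L" "card L = card S" "L \<subseteq> D" "0 < \<gamma>"
    "\<forall>l\<in>span L. C.app l \<in> {x \<in> H. Pm x = 0} \<and> \<gamma> * (norm l)\<^sup>2 \<le> -1 * inner (C.app l) l"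
  then show thesis by (rule that)
qed (rule E_kernel_subspace, simp, blast)

lemma positive_space:
  assumes ker: "\<And>k. k \<in> D \<Longrightarrow> C.app k = 0 \<Longrightarrow> k = 0"
    and S: "finite S" "independent S" "S \<subseteq> {v \<in> H. N v = 0 \<and> Pp v = 0}"
  obtains L \<gamma> where "finite L" "independent L" "card L = card S" "L \<subseteq> D" "0 < \<gamma>"
    "\<forall>l\<in>span L. C.app l \<in> {x \<in> H. Pp x = 0} \<and> \<gamma> * (norm l)\<^sup>2 \<le> 1 * inner (C.app l) l"
proof (rule definite_space[OF S(1,2), of "{x \<in> H. Pp x = 0}" "{z \<in> D. N z = 0}" 1])
  show "S \<subseteq> {x \<in> H. Pp x = 0}" using S(3) by auto
  show "subspace {z \<in> D. N z = 0}"
    using dom_subspace dom_in unfolding subspace_def by (simp add: C.E_zero C.E_add C.E_scale)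
  fix s assume "s \<in> S"
  then have s: "s \<in> H" "N s = 0" using S(3) by auto
  have "inner s k = 0" if "k \<in> D" "C.app k = 0" for k
    using ker[OF that] by simp
  then obtain z where z: "z \<in> D" "C.app z = s" using C_solve[OF s(1)] by blast
  have "z - N z \<in> D \<and> N (z - N z) = 0 \<and> C.app (z - N z) = s"
    using N_app[OF z(1)] s z N_idem dom_in C.app_diff[of z "N z"] C_dom by (simp add: dom_diff C.E_diff)
  then show "\<exists>z\<in>{z \<in> D. N z = 0}. C.app z = s" by (intro bexI[of _ "z - N z"]) simp_all
next
  fix z assume "z \<in> {z \<in> D. N z = 0}" "z \<noteq> 0"
  then show "0 < 1 * inner (C.app z) z" using pos_form[OF ker, of z] by simp
next
  fix L \<gamma>
  assume "finite L" "independent L" "card L = card S" "L \<subseteq> D" "0 < \<gamma>"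
    "\<forall>l\<in>span L. C.app l \<in> {x \<in> H. Pp x = 0} \<and> \<gamma> * (norm l)\<^sup>2 \<le> 1 * inner (C.app l) l"
  then show thesis by (rule that)
qed (rule E_kernel_subspace, simp, blast)

text \<open>The mixed terms vanish because \<open>C.app l\<close> has no component in the range of
  \<open>E M\<close>, although \<open>l\<close> itself may have one.\<close>

lemma form_sum:
  assumes l: "l \<in> D" and y: "y \<in> D" "E M y = y" and M: "M \<in> sets borel" and "E M (C.app l) = 0"
  shows "inner (C.app (l + y)) (l + y) = inner (C.app l) l + inner (C.app y) y"
proof -
  have "inner (C.app l) y = inner (E M (C.app l)) y"
    using E_sym[OF M, of "C.app l" y] y l C.app_in C_dom dom_in by simp
  then have "inner (C.app l) y = 0" using assms(5) by simp
  moreover from this have "inner (C.app y) l = 0"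
    using C.app_sym[of y l] l y C_dom by (simp add: inner_commute)
  ultimately show ?thesis
    using C.app_add[of l y] l y C_dom by (simp add: inner_add_left inner_add_right)
qed

lemma B_form: "u \<in> H \<Longrightarrow> \<bar>inner (B u) u\<bar> \<le> \<kappa> * (norm u)\<^sup>2"
proof -
  assume u: "u \<in> H"
  have "\<bar>inner (B u) u\<bar> \<le> norm (B u) * norm u" by (rule Cauchy_Schwarz_ineq2)
  also have "\<dots> \<le> \<kappa> * norm u * norm u" using B_bound[OF u] by (rule mult_right_mono) simp
  finally show ?thesis by (simp add: power2_eq_square)
qed

lemma Y_forms:
  shows "y \<in> D \<Longrightarrow> Pm y = y \<Longrightarrow> inner (C.app y) y \<le> - (\<beta> - \<kappa>) * (norm y)\<^sup>2"
    and "y \<in> D \<Longrightarrow> Pp y = y \<Longrightarrow> (\<beta> - \<kappa>) * (norm y)\<^sup>2 \<le> inner (C.app y) y"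
proof -
  assume y: "y \<in> D"
  have "inner (C.app y) y = inner (app y) y - inner (B y) y"
    using C_app[OF y] by (simp add: inner_diff_left)
  moreover have "- (\<kappa> * (norm y)\<^sup>2) \<le> inner (B y) y" "inner (B y) y \<le> \<kappa> * (norm y)\<^sup>2"
    using B_form[OF dom_in[OF y]] by linarith+
  moreover have "(\<beta> - \<kappa>) * (norm y)\<^sup>2 = \<beta> * (norm y)\<^sup>2 - \<kappa> * (norm y)\<^sup>2"
    by (simp add: left_diff_distrib)
  moreover note Pm_form[OF y] Pp_form[OF y]
  ultimately show "Pm y = y \<Longrightarrow> inner (C.app y) y \<le> - (\<beta> - \<kappa>) * (norm y)\<^sup>2"
    "Pp y = y \<Longrightarrow> (\<beta> - \<kappa>) * (norm y)\<^sup>2 \<le> inner (C.app y) y"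
    unfolding mult_minus_left by linarith+
qed

end

section \<open>Two ordered perturbations of equal index: splitting and coercivity\<close>

locale gap_pair = gap H A E \<beta> G + p1: pert H A E \<beta> G B1 E1 \<kappa> + p2: pert H A E \<beta> G B2 E2 \<kappa>
  for H :: "'h::real_inner set" and A :: "('h \<times> 'h) set" and E :: "real set \<Rightarrow> 'h \<Rightarrow> 'h"
    and \<beta> :: real and G :: "'h set" and B1 E1 B2 E2 and \<kappa> :: real +
  fixes n :: int
  assumes index1: "has_fredholm_index P (p1.N ` H) (P ` H) n"
    and index2: "has_fredholm_index P (p2.N ` H) (P ` H) n"
    and B12: "\<And>u. u \<in> H \<Longrightarrow> inner (B1 u) u \<le> inner (B2 u) u"
    and kernel2: "\<And>k. k \<in> D \<Longrightarrow> app k = B2 k \<Longrightarrow> k = 0"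
begin

lemma C2_kernel: "k \<in> D \<Longrightarrow> p2.C.app k = 0 \<Longrightarrow> k = 0"
  using kernel2[of k] p2.C_app[of k] by simp

text \<open>\<open>PX\<close> is injective on the sum of the spans of \<open>L1\<close> and
  \<open>L2\<close>, which together have at least as many dimensions as the range of
  \<open>PX\<close>. So \<open>PX\<close> maps the sum onto that range, and what remains of any
  \<open>w\<close> lies in the range of \<open>PY\<close>.\<close>

lemma splitting:
  obtains L1 L2 \<gamma> where "0 < \<gamma>"
    "\<forall>l\<in>span L1. \<forall>y\<in>D. Pm y = y \<longrightarrow>
        l + y \<in> D \<and> inner (p1.C.app (l + y)) (l + y) \<le> - \<gamma> * ((norm l)\<^sup>2 + (norm y)\<^sup>2)"
    "\<forall>l\<in>span L2. \<forall>y\<in>D. Pp y = y \<longrightarrow>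
        l + y \<in> D \<and> \<gamma> * ((norm l)\<^sup>2 + (norm y)\<^sup>2) \<le> inner (p2.C.app (l + y)) (l + y)"
    "\<forall>w\<in>D. \<exists>l1\<in>span L1. \<exists>l2\<in>span L2. \<exists>ym\<in>D. \<exists>yp\<in>D. Pm ym = ym \<and> Pp yp = yp \<and>
        w = (l1 + ym) + (l2 + yp)"
proof -
  have bm: "{-\<beta><..<0} \<in> sets borel" "{-\<beta><..<0} \<subseteq> {-\<beta><..<\<beta>}" using \<beta> by auto
  obtain Um where Um: "finite Um" "independent Um" "Um \<subseteq> Xm ` H" "Xm ` H \<subseteq> span Um"
    using X_basis[OF bm] by blast
  have bp: "{0..<\<beta>} \<in> sets borel" "{0..<\<beta>} \<subseteq> {-\<beta><..<\<beta>}" using \<beta> by auto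
  obtain Up where Up: "finite Up" "independent Up" "Up \<subseteq> Xp ` H" "Xp ` H \<subseteq> span Up"
    using X_basis[OF bp] by blast
  obtain S1 where S1: "finite S1" "independent S1" "S1 \<subseteq> {v \<in> H. p1.N v = v \<and> Pm v = 0}"
    "n + int (card Um) \<le> int (card S1)"
    using p1.negative_dimension[OF index1 Um] by blast
  obtain S2 where S2: "finite S2" "independent S2" "S2 \<subseteq> {v \<in> H. p2.N v = 0 \<and> Pp v = 0}"
    "int (card Up) - n \<le> int (card S2)"
    using p2.positive_dimension[OF index2 Up] by blast
  obtain L1 \<gamma>1 where L1: "finite L1" "independent L1" "card L1 = card S1" "L1 \<subseteq> D" "0 < \<gamma>1"
    "\<forall>l\<in>span L1. p1.C.app l \<in> {x \<in> H. Pm x = 0} \<and> \<gamma>1 * (norm l)\<^sup>2 \<le> -1 * inner (p1.C.app l) l"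
    by (rule p1.negative_space[OF S1(1-3)])
  obtain L2 \<gamma>2 where L2: "finite L2" "independent L2" "card L2 = card S2" "L2 \<subseteq> D" "0 < \<gamma>2"
    "\<forall>l\<in>span L2. p2.C.app l \<in> {x \<in> H. Pp x = 0} \<and> \<gamma>2 * (norm l)\<^sup>2 \<le> 1 * inner (p2.C.app l) l"
    by (rule p2.positive_space[OF C2_kernel S2(1-3)])
  have sD: "span L1 \<subseteq> D" "span L2 \<subseteq> D"
    using span_minimal[OF L1(4) dom_subspace] span_minimal[OF L2(4) dom_subspace] by simp_all
  define \<gamma> where "\<gamma> = min (min \<gamma>1 \<gamma>2) (\<beta> - \<kappa>)"
  have \<gamma>: "0 < \<gamma>" "\<gamma> \<le> \<gamma>1" "\<gamma> \<le> \<gamma>2" "\<gamma> \<le> \<beta> - \<kappa>"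
    using L1(5) L2(5) p1.\<kappa> unfolding \<gamma>_def by auto
  have neg: "l + y \<in> D \<and> inner (p1.C.app (l + y)) (l + y) \<le> - \<gamma> * ((norm l)\<^sup>2 + (norm y)\<^sup>2)"
    if "l \<in> span L1" "y \<in> D" "Pm y = y" for l y
  proof
    have lD: "l \<in> D" using that sD by auto
    show "l + y \<in> D" using lD that(2) by (rule dom_add)
    have "inner (p1.C.app (l + y)) (l + y) = inner (p1.C.app l) l + inner (p1.C.app y) y"
      by (rule p1.form_sum[OF lD that(2,3)]) (use bspec[OF L1(6) that(1)] in simp_all)
    also have "\<dots> \<le> - \<gamma>1 * (norm l)\<^sup>2 + - (\<beta> - \<kappa>) * (norm y)\<^sup>2"
      using bspec[OF L1(6) that(1)] p1.Y_forms(1)[OF that(2,3)] by simp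
    also have "\<dots> \<le> - \<gamma> * (norm l)\<^sup>2 + - \<gamma> * (norm y)\<^sup>2"
      using \<gamma> by (intro add_mono mult_right_mono) auto
    finally show "inner (p1.C.app (l + y)) (l + y) \<le> - \<gamma> * ((norm l)\<^sup>2 + (norm y)\<^sup>2)"
      by (simp add: distrib_left)
  qed
  have pos: "l + y \<in> D \<and> \<gamma> * ((norm l)\<^sup>2 + (norm y)\<^sup>2) \<le> inner (p2.C.app (l + y)) (l + y)"
    if "l \<in> span L2" "y \<in> D" "Pp y = y" for l y
  proof
    have lD: "l \<in> D" using that sD by auto
    show "l + y \<in> D" using lD that(2) by (rule dom_add)
    have "\<gamma> * (norm l)\<^sup>2 + \<gamma> * (norm y)\<^sup>2 \<le> \<gamma>2 * (norm l)\<^sup>2 + (\<beta> - \<kappa>) * (norm y)\<^sup>2"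
      using \<gamma> by (intro add_mono mult_right_mono) auto
    also have "\<dots> \<le> inner (p2.C.app l) l + inner (p2.C.app y) y"
      using bspec[OF L2(6) that(1)] p2.Y_forms(2)[OF that(2,3)] by simp
    also have "\<dots> = inner (p2.C.app (l + y)) (l + y)"
      by (rule p2.form_sum[OF lD that(2,3), symmetric]) (use bspec[OF L2(6) that(1)] in simp_all)
    finally show "\<gamma> * ((norm l)\<^sup>2 + (norm y)\<^sup>2) \<le> inner (p2.C.app (l + y)) (l + y)"
      by (simp add: distrib_left)
  qed
  \<comment> \<open>If the \<open>PX\<close>-part vanishes, one and the same vector \<open>w\<close>
    is \<open>l2 + yp\<close> and \<open>- (l1 + ym)\<close>, so the form of
    \<open>C\<^sub>2\<close> is nonnegative and that of \<open>C\<^sub>1\<close> nonpositive on it,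
    with lower and upper bounds in all four components. But the order of \<open>B1\<close> and
    \<open>B2\<close> puts the form of \<open>C\<^sub>2\<close> below that of
    \<open>C\<^sub>1\<close>.\<close>
  have inj: "l1 = 0 \<and> l2 = 0" if l: "l1 \<in> span L1" "l2 \<in> span L2" and 0: "PX (l1 + l2) = 0" for l1 l2
  proof -
    have lD: "l1 \<in> D" "l2 \<in> D" using l sD by auto
    define ym where "ym = - Pm (l1 + l2)"
    define yp where "yp = - Pp (l1 + l2)"
    have uD: "l1 + l2 \<in> D" using lD by (rule dom_add)
    then have uH: "l1 + l2 \<in> H" by (rule dom_in)
    have yD: "ym \<in> D" "yp \<in> D"
      using E_dom[of "{..-\<beta>}", OF _ uD] E_dom[of "{\<beta>..}", OF _ uD] subspace_neg[OF dom_subspace]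
      unfolding ym_def yp_def by simp_all
    have yP: "Pm ym = ym" "Pp yp = yp"
      using E_scale[of "{..-\<beta>}" "Pm (l1 + l2)" "-1"] E_scale[of "{\<beta>..}" "Pp (l1 + l2)" "-1"] E_in uH E_idem
      unfolding ym_def yp_def by simp_all
    have "l1 + l2 = - ym - yp" using XY[OF uH] PY_eq[OF uH] 0 unfolding ym_def yp_def by simp
    then have eq: "l1 + ym = - (l2 + yp)" by (simp add: algebra_simps eq_neg_iff_add_eq_0)
    define w where "w = l2 + yp"
    have wD: "w \<in> D" using pos[OF l(2) yD(2) yP(2)] unfolding w_def by simp
    have e2: "\<gamma> * ((norm l2)\<^sup>2 + (norm yp)\<^sup>2) \<le> inner (p2.C.app w) w"
      using pos[OF l(2) yD(2) yP(2)] unfolding w_def by simp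
    have "p1.C.app (- w) = - p1.C.app w"
      using p1.C.app_scale[of w "-1"] wD p1.C_dom by simp
    then have e1: "inner (p1.C.app w) w \<le> - \<gamma> * ((norm l1)\<^sup>2 + (norm ym)\<^sup>2)"
      using neg[OF l(1) yD(1) yP(1)] unfolding eq w_def[symmetric] by simp
    have "inner (p2.C.app w) w \<le> inner (p1.C.app w) w"
      using B12[OF dom_in[OF wD]] p1.C_app[OF wD] p2.C_app[OF wD] by (simp add: inner_diff_left)
    with e1 e2 have "\<gamma> * ((norm l1)\<^sup>2 + (norm ym)\<^sup>2 + (norm l2)\<^sup>2 + (norm yp)\<^sup>2) \<le> 0"
      by (simp add: algebra_simps)
    then have "(norm l1)\<^sup>2 + (norm ym)\<^sup>2 + (norm l2)\<^sup>2 + (norm yp)\<^sup>2 \<le> 0"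
      using \<gamma>(1) by (simp add: mult_le_0_iff)
    then have "(norm l1)\<^sup>2 \<le> 0" "(norm l2)\<^sup>2 \<le> 0"
      using zero_le_power2[of "norm l1"] zero_le_power2[of "norm l2"] zero_le_power2[of "norm ym"] zero_le_power2[of "norm yp"]
      by linarith+
    then show ?thesis by simp
  qed
  have L12: "independent (L1 \<union> L2) \<and> L1 \<inter> L2 = {}"
    by (rule independent_Un_direct[OF L1(1) L2(1) L1(2) L2(2)])
      (use inj E_zero[of "{-\<beta><..<\<beta>}"] in auto)
  have linX: "linear_within H PX" by (rule E_linear) simp
  have LH: "L1 \<union> L2 \<subseteq> H" using L1(4) L2(4) dom_in by blast
  have "x = 0" if x: "x \<in> span (L1 \<union> L2)" "PX x = 0" for x
  proof -
    obtain a b where "x = a + b" "a \<in> span L1" "b \<in> span L2" using x(1) unfolding span_Un by blast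
    then show ?thesis using inj[of a b] x(2) by simp
  qed
  then have ind: "independent (PX ` (L1 \<union> L2)) \<and> card (PX ` (L1 \<union> L2)) = card (L1 \<union> L2)"
    using linear_within_independent_image[OF linX _ LH] L1(1) L2(1) L12 by blast
  have sub_U: "PX u \<in> span (Um \<union> Up)" if "u \<in> H" for u
  proof -
    have "Xm u \<in> span Um" "Xp u \<in> span Up" using Um(4) Up(4) that by auto
    then show ?thesis unfolding PX_eq[OF that] span_Un by blast
  qed
  \<comment> \<open>The lower bounds \<open>n + card Um\<close> and \<open>card Up - n\<close> add
    up to \<open>card Um + card Up\<close>: this is where the equality of the indices is
    used.\<close>
  have c: "card (Um \<union> Up) \<le> card (PX ` (L1 \<union> L2))"
  proof -
    have "card (L1 \<union> L2) = card L1 + card L2" using card_Un_disjoint[OF L1(1) L2(1)] L12 by simp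
    moreover have "card (Um \<union> Up) \<le> card Um + card Up" by (rule card_Un_le)
    ultimately show ?thesis using ind S1(4) S2(4) L1(3) L2(3) by linarith
  qed
  have "PX ` (L1 \<union> L2) \<subseteq> span (Um \<union> Up)" using sub_U LH by auto
  then obtain t' where t': "card t' = card (Um \<union> Up)" "finite t'" "PX ` (L1 \<union> L2) \<subseteq> t'" "span (Um \<union> Up) \<subseteq> span t'"
  proof -
    assume a: "PX ` (L1 \<union> L2) \<subseteq> span (Um \<union> Up)"
    obtain B where B: "PX ` (L1 \<union> L2) \<subseteq> B" "B \<subseteq> span (Um \<union> Up)" "independent B" "span (Um \<union> Up) \<subseteq> span B"
      using maximal_independent_subset_extend[OF a] ind by blast
    have fB: "finite B \<and> card B \<le> card (Um \<union> Up)"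
      using independent_span_bound[of "Um \<union> Up" B] Um(1) Up(1) B by simp
    have "card (PX ` (L1 \<union> L2)) \<le> card B" using B(1) fB by (intro card_mono) auto
    then show thesis using that[of B] B fB c by simp
  qed
  have "t' = PX ` (L1 \<union> L2)"
    using card_subset_eq[OF t'(2,3)] card_mono[OF t'(2,3)] t'(1) c by simp
  then have full: "span (Um \<union> Up) \<subseteq> span (PX ` (L1 \<union> L2))" using t'(4) by simp
  have dec: "\<exists>l1\<in>span L1. \<exists>l2\<in>span L2. \<exists>ym\<in>D. \<exists>yp\<in>D. Pm ym = ym \<and> Pp yp = yp \<and>
        w = (l1 + ym) + (l2 + yp)" if w: "w \<in> D" for w
  proof -
    have wH: "w \<in> H" using w by (rule dom_in)
    have "PX w \<in> span (PX ` (L1 \<union> L2))" using sub_U[OF wH] full by auto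
    then obtain l where l: "l \<in> span (L1 \<union> L2)" "PX l = PX w"
      using linear_within_span_surj[OF linX LH] by blast
    then obtain l1 l2 where l12: "l = l1 + l2" "l1 \<in> span L1" "l2 \<in> span L2" unfolding span_Un by blast
    have lD: "l \<in> D" unfolding l12(1) using l12(2,3) sD by (intro dom_add) auto
    define r where "r = w - l"
    have rD: "r \<in> D" unfolding r_def using w lD by (rule dom_diff)
    have rH: "r \<in> H" using rD by (rule dom_in)
    have "PX r = 0" unfolding r_def using l(2) wH dom_in[OF lD] by (simp add: E_diff)
    then have "r = Pm r + Pp r" using XY[OF rH] PY_eq[OF rH] by simp
    then have "w = (l1 + Pm r) + (l2 + Pp r)" unfolding r_def l12(1) by (simp add: algebra_simps)
    moreover have "Pm r \<in> D" "Pp r \<in> D" using rD by (simp_all add: E_dom)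
    moreover have "Pm (Pm r) = Pm r" "Pp (Pp r) = Pp r" using rH by (simp_all add: E_idem)
    ultimately show ?thesis using l12(2,3) by blast
  qed
  show ?thesis
    by (rule that[OF \<gamma>(1)]; intro ballI impI; rule neg pos dec; assumption)
qed

text \<open>The splitting is determined by \<open>B1\<close> and \<open>B2\<close>, and the form of
  \<open>A - B\<close> lies between the two extreme forms, so the constant is uniform in
  \<open>B\<close>. The factor 4 collects \<open>norm w \<le> 2 r\<close> and
  \<open>norm (b - a) \<le> 2 r\<close>.\<close>

lemma coercive:
  obtains c where "0 < c"
    "\<And>B w. bounded_self_adjoint_on H B \<Longrightarrow>
      (\<And>u. u \<in> H \<Longrightarrow> inner (B1 u) u \<le> inner (B u) u \<and> inner (B u) u \<le> inner (B2 u) u) \<Longrightarrow>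
      w \<in> D \<Longrightarrow> c * norm w \<le> norm (app w - B w)"
proof -
  obtain L1 L2 \<gamma> where \<gamma>: "0 < \<gamma>"
    and neg: "\<forall>l\<in>span L1. \<forall>y\<in>D. Pm y = y \<longrightarrow>
        l + y \<in> D \<and> inner (p1.C.app (l + y)) (l + y) \<le> - \<gamma> * ((norm l)\<^sup>2 + (norm y)\<^sup>2)"
    and pos: "\<forall>l\<in>span L2. \<forall>y\<in>D. Pp y = y \<longrightarrow>
        l + y \<in> D \<and> \<gamma> * ((norm l)\<^sup>2 + (norm y)\<^sup>2) \<le> inner (p2.C.app (l + y)) (l + y)"
    and dec: "\<forall>w\<in>D. \<exists>l1\<in>span L1. \<exists>l2\<in>span L2. \<exists>ym\<in>D. \<exists>yp\<in>D. Pm ym = ym \<and> Pp yp = yp \<and>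
        w = (l1 + ym) + (l2 + yp)"
    by (rule splitting)
  show ?thesis
  proof (rule that[of "\<gamma> / 4"])
    show "0 < \<gamma> / 4" using \<gamma> by simp
    fix B w assume B: "bounded_self_adjoint_on H B" and w: "w \<in> D"
      and B12: "\<And>u. u \<in> H \<Longrightarrow> inner (B1 u) u \<le> inner (B u) u \<and> inner (B u) u \<le> inner (B2 u) u"
    obtain l1 l2 ym yp where l: "l1 \<in> span L1" "l2 \<in> span L2" and y: "ym \<in> D" "Pm ym = ym" "yp \<in> D" "Pp yp = yp"
      and weq: "w = (l1 + ym) + (l2 + yp)"
      using bspec[OF dec w] by blast
    define a b where "a = l1 + ym" and "b = l2 + yp"
    define r where "r = sqrt ((norm l1)\<^sup>2 + (norm ym)\<^sup>2 + (norm l2)\<^sup>2 + (norm yp)\<^sup>2)"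
    have r2: "r\<^sup>2 = (norm l1)\<^sup>2 + (norm ym)\<^sup>2 + (norm l2)\<^sup>2 + (norm yp)\<^sup>2" and r0: "0 \<le> r"
      unfolding r_def by simp_all
    have aD: "a \<in> D" and a: "inner (p1.C.app a) a \<le> - \<gamma> * ((norm l1)\<^sup>2 + (norm ym)\<^sup>2)"
      using neg[rule_format, OF l(1) y(1,2)] unfolding a_def by simp_all
    have bD: "b \<in> D" and b: "\<gamma> * ((norm l2)\<^sup>2 + (norm yp)\<^sup>2) \<le> inner (p2.C.app b) b"
      using pos[rule_format, OF l(2) y(3,4)] unfolding b_def by simp_all
    have ab: "a \<in> H" "b \<in> H" using aD bD dom_in by simp_all
    define T where "T u = app u - B u" for u
    have Bl: "B (a + b) = B a + B b" "inner (B a) b = inner a (B b)"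
      using B ab unfolding bounded_self_adjoint_on_def by simp_all
    have Tsym: "inner (T a) b = inner (T b) a"
      unfolding T_def using app_sym[OF aD bD] Bl(2) by (simp add: inner_diff_left inner_diff_right inner_commute)
    have "inner (T w) (b - a) = inner (T b) b - inner (T a) a"
      using Tsym app_add[OF aD bD] Bl(1) unfolding weq a_def[symmetric] b_def[symmetric] T_def
      by (simp add: inner_diff_left inner_diff_right inner_add_left)
    moreover have "inner (p2.C.app b) b \<le> inner (T b) b"
      using B12[OF ab(2)] p2.C_app[OF bD] unfolding T_def by (simp add: inner_diff_left)
    moreover have "inner (T a) a \<le> inner (p1.C.app a) a"
      using B12[OF ab(1)] p1.C_app[OF aD] unfolding T_def by (simp add: inner_diff_left)
    ultimately have "\<gamma> * r\<^sup>2 \<le> inner (T w) (b - a)" using a b unfolding r2 by (simp add: algebra_simps)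
    also have "\<dots> \<le> norm (T w) * norm (b - a)" by (rule norm_cauchy_schwarz)
    finally have main: "\<gamma> * r\<^sup>2 \<le> norm (T w) * norm (b - a)" .
    have bound: "norm z \<le> 2 * r" if z: "norm z \<le> (norm l1 + norm ym) + (norm l2 + norm yp)" for z :: 'h
    proof -
      have q: "(s + t)\<^sup>2 \<le> 2 * (s\<^sup>2 + t\<^sup>2)" for s t :: real
        using sum_squares_bound[of s t] by (simp add: power2_sum)
      have "(norm z)\<^sup>2 \<le> ((norm l1 + norm ym) + (norm l2 + norm yp))\<^sup>2" using z by (rule power_mono) simp
      also have "\<dots> \<le> 2 * ((norm l1 + norm ym)\<^sup>2 + (norm l2 + norm yp)\<^sup>2)" by (rule q)
      also have "\<dots> \<le> 2 * (2 * ((norm l1)\<^sup>2 + (norm ym)\<^sup>2) + 2 * ((norm l2)\<^sup>2 + (norm yp)\<^sup>2))"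
        by (intro mult_left_mono add_mono q) simp
      also have "\<dots> = (2 * r)\<^sup>2" unfolding power_mult_distrib r2 by simp
      finally show ?thesis by (rule power2_le_imp_le) (use r0 in simp)
    qed
    have "norm a \<le> norm l1 + norm ym" "norm b \<le> norm l2 + norm yp"
      unfolding a_def b_def by (rule norm_triangle_ineq)+
    moreover have "norm (b - a) \<le> norm b + norm a" "norm w \<le> norm a + norm b"
      unfolding weq a_def b_def by (rule norm_triangle_ineq4, rule norm_triangle_ineq)
    ultimately have "norm w \<le> 2 * r" "norm (b - a) \<le> 2 * r"
      by (intro bound; linarith)+
    then have "\<gamma> * r\<^sup>2 \<le> norm (T w) * (2 * r)"
      using main by (meson mult_left_mono norm_ge_zero order_trans)
    then have "\<gamma> * r \<le> 2 * norm (T w)"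
      using r0 by (cases "r = 0") (auto simp: power2_eq_square)
    moreover have "\<gamma> * norm w \<le> \<gamma> * (2 * r)" using \<open>norm w \<le> 2 * r\<close> \<gamma> by simp
    ultimately show "\<gamma> / 4 * norm w \<le> norm (app w - B w)" unfolding T_def by simp
  qed
qed

end

section \<open>Convex combinations of operators and Brouwer's theorem in a finite-dimensional
  span\<close>

lemma lipschitz_within_continuous:
  fixes f :: "'a::real_normed_vector \<Rightarrow> 'b::real_normed_vector"
  assumes "0 \<le> k" "\<And>u v. u \<in> S \<Longrightarrow> v \<in> S \<Longrightarrow> norm (f u - f v) \<le> k * norm (u - v)"
  shows "continuous_on S f"
  by (rule lipschitz_on_continuous_on[of k])
    (use assms in \<open>auto intro!: lipschitz_onI simp: dist_norm\<close>)

lemma bounded_self_adjoint_convex: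
  assumes H: "subspace H" and B: "bounded_self_adjoint_on H B" "bounded_self_adjoint_on H B'"
    and s: "0 \<le> s" "s \<le> (1::real)"
  shows "bounded_self_adjoint_on H (\<lambda>u. (1 - s) *\<^sub>R B u + s *\<^sub>R B' u)"
proof -
  obtain K where K: "\<And>u. u \<in> H \<Longrightarrow> norm (B u) \<le> K * norm u"
    proof -
    have "\<exists>C. \<forall>u\<in>H. norm (B u) \<le> C * norm u"
      using B(1) unfolding bounded_self_adjoint_on_def by (elim conjE)
    then obtain C where "\<forall>u\<in>H. norm (B u) \<le> C * norm u" ..
    then show thesis by (intro that[of C]) simp
  qed
  obtain K' where K': "\<And>u. u \<in> H \<Longrightarrow> norm (B' u) \<le> K' * norm u"
    proof -
    have "\<exists>C. \<forall>u\<in>H. norm (B' u) \<le> C * norm u"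
      using B(2) unfolding bounded_self_adjoint_on_def by (elim conjE)
    then obtain C where "\<forall>u\<in>H. norm (B' u) \<le> C * norm u" ..
    then show thesis by (intro that[of C]) simp
  qed
  have bd: "norm ((1 - s) *\<^sub>R B u + s *\<^sub>R B' u) \<le> ((1 - s) * K + s * K') * norm u" if "u \<in> H" for u
  proof -
    have "norm ((1 - s) *\<^sub>R B u + s *\<^sub>R B' u) \<le> norm ((1 - s) *\<^sub>R B u) + norm (s *\<^sub>R B' u)"
      by (rule norm_triangle_ineq)
    also have "\<dots> = (1 - s) * norm (B u) + s * norm (B' u)" using s by simp
    also have "\<dots> \<le> (1 - s) * (K * norm u) + s * (K' * norm u)"
      using s by (intro add_mono mult_left_mono K K' that) simp_all
    finally show ?thesis by (simp add: algebra_simps)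
  qed
  have 1: "B u \<in> H" "B' u \<in> H" if "u \<in> H" for u
    using B that unfolding bounded_self_adjoint_on_def by simp_all
  have 2: "B (u + v) = B u + B v" "B' (u + v) = B' u + B' v" if "u \<in> H" "v \<in> H" for u v
    using B that unfolding bounded_self_adjoint_on_def by simp_all
  have 3: "B (c *\<^sub>R u) = c *\<^sub>R B u" "B' (c *\<^sub>R u) = c *\<^sub>R B' u" if "u \<in> H" for c u
    using B that unfolding bounded_self_adjoint_on_def by simp_all
  have 4: "inner (B u) v = inner u (B v)" "inner (B' u) v = inner u (B' v)" if "u \<in> H" "v \<in> H" for u v
    using B that unfolding bounded_self_adjoint_on_def by simp_all
  show ?thesis
    unfolding bounded_self_adjoint_on_def
  proof (intro conjI ballI allI)
    show "\<exists>C. \<forall>u\<in>H. norm ((1 - s) *\<^sub>R B u + s *\<^sub>R B' u) \<le> C * norm u"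
      using bd by (intro exI ballI)
    show "(1 - s) *\<^sub>R B u + s *\<^sub>R B' u \<in> H" if "u \<in> H" for u
      using that by (intro subspace_add[OF H] subspace_scale[OF H] 1)
  qed (simp_all add: 2 3 4 scaleR_add_right inner_add_left inner_add_right mult.commute)
qed

lemma orthonormal_enumeration:
  fixes F :: "'a::real_inner set"
  assumes "finite F"
  obtains n :: nat and e where "\<And>i. i < n \<Longrightarrow> e i \<in> span F"
    "\<And>x. x \<in> span F \<Longrightarrow> x = (\<Sum>i<n. inner x (e i) *\<^sub>R e i)"
    "\<And>i. i < n \<Longrightarrow> norm (e i) = 1"
proof -
  interpret posdef_form UNIV "inner :: 'a \<Rightarrow> 'a \<Rightarrow> real"
    by standard (auto simp: inner_add_left intro: inner_commute)
  obtain B where B: "finite B" "span B = span F" "\<And>b. b \<in> B \<Longrightarrow> inner b b = 1"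
    "\<And>b c. b \<in> B \<Longrightarrow> c \<in> B \<Longrightarrow> b \<noteq> c \<Longrightarrow> inner b c = 0"
    using orthonormal_basis[OF assms] by (metis UNIV_I subsetI)
  obtain e where e: "bij_betw e {0..<card B} B"
    using ex_bij_betw_nat_finite[OF B(1)] by blast
  have eB: "e i \<in> B" if "i < card B" for i
    using e that by (auto simp: bij_betw_def)
  have on: "inner (e i) (e j) = (if i = j then 1 else 0)" if "i < card B" "j < card B" for i j
  proof (cases "i = j")
    case False
    then have "e i \<noteq> e j" using e that by (auto simp: bij_betw_def inj_on_def)
    then show ?thesis using B(4) eB that False by simp
  qed (use B(3) eB that in simp)
  show ?thesis
  proof (rule that[of "card B" e])
    show "e i \<in> span F" if "i < card B" for i
      using eB[OF that] B(2) span_base by blast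
    show "norm (e i) = 1" if "i < card B" for i
      using B(3)[OF eB[OF that]] by (simp add: norm_eq_sqrt_inner)
    fix x assume "x \<in> span F"
    then have "x \<in> span B" using B(2) by simp
    then have "x \<in> range (\<lambda>u. \<Sum>v\<in>B. u v *\<^sub>R v)" using span_finite[OF B(1)] by simp
    then obtain u where u: "x = (\<Sum>v\<in>B. u v *\<^sub>R v)" by (rule rangeE)
    have x: "x = (\<Sum>i<card B. u (e i) *\<^sub>R e i)"
      unfolding u using sum.reindex_bij_betw[OF e, of "\<lambda>v. u v *\<^sub>R v"] by (simp add: lessThan_atLeast0)
    have "inner x (e j) = u (e j)" if "j < card B" for j
    proof -
      have "inner x (e j) = (\<Sum>i<card B. u (e i) * inner (e i) (e j))"
        by (subst x) (simp add: inner_sum_left)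
      also have "\<dots> = (\<Sum>i<card B. if i = j then u (e j) else 0)"
        using on that by (intro sum.cong) auto
      also have "\<dots> = u (e j)" using that by simp
      finally show ?thesis .
    qed
    then have "(\<Sum>i<card B. inner x (e i) *\<^sub>R e i) = (\<Sum>i<card B. u (e i) *\<^sub>R e i)"
      by (intro sum.cong) simp_all
    then show "x = (\<Sum>i<card B. inner x (e i) *\<^sub>R e i)" using x by simp
  qed
qed

lemma brouwer_span:
  fixes \<Phi> :: "'a::real_inner \<Rightarrow> 'a"
  assumes F: "finite F" and cont: "continuous_on (span F) \<Phi>"
    and maps: "\<And>x. x \<in> span F \<Longrightarrow> \<Phi> x \<in> span F"
    and bd: "\<And>x. x \<in> span F \<Longrightarrow> norm (\<Phi> x) \<le> K"
  obtains x where "x \<in> span F" "\<Phi> x = x"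
proof -
  obtain n :: nat and e where e: "\<And>i. i < n \<Longrightarrow> e i \<in> span F"
    "\<And>x. x \<in> span F \<Longrightarrow> x = (\<Sum>i<n. inner x (e i) *\<^sub>R e i)"
    "\<And>i. i < n \<Longrightarrow> norm (e i) = 1"
    using orthonormal_enumeration[OF F] by metis
  define J where "J c = (\<Sum>i<n. c i *\<^sub>R e i)" for c :: "nat \<Rightarrow> real"
  define \<phi> where "\<phi> c i = (if i < n then inner (\<Phi> (J c)) (e i) else 0)" for c i
  have JF: "J c \<in> span F" for c
    unfolding J_def by (intro span_sum span_scale) (use e(1) in simp)
  have cJ: "continuous_on UNIV J"
    unfolding J_def by (intro continuous_intros continuous_on_product_coordinates)
  have c\<Phi>: "continuous_on UNIV (\<lambda>c. \<Phi> (J c))"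
    by (rule continuous_on_compose2[OF cont cJ]) (use JF in auto)
  have K0: "0 \<le> K" using bd[OF span_0] norm_ge_zero order_trans by blast
  obtain c where c: "c \<in> topspace (Euclidean_space n)" "\<phi> c = c"
  \<comment> \<open>There are \<open>n\<close> coordinates of size at most \<open>K\<close>; the two
    added units make the bound strict and the radius positive.\<close>
  proof (rule brouwer_Euclidean_space[of n \<phi> "real (n + 1) * (K + 1)"])
    show "continuous_on (topspace (Euclidean_space n)) \<phi>"
    proof (rule continuous_on_subset[of UNIV])
      show "continuous_on UNIV \<phi>"
      proof (rule continuous_on_coordinatewise_then_product)
        show "continuous_on UNIV (\<lambda>c. \<phi> c i)" for i
          unfolding \<phi>_def using c\<Phi> by (cases "i < n") (auto intro!: continuous_intros)
      qed
    qed simp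
    show "\<phi> x \<in> topspace (Euclidean_space n)" for x
      by (simp add: topspace_Euclidean_space \<phi>_def)
    show "0 < real (n + 1) * (K + 1)" using K0 by simp
    fix x :: "nat \<Rightarrow> real"
    have "(\<Sum>i<n. (\<phi> x i)\<^sup>2) \<le> (\<Sum>i<n. K\<^sup>2)"
    proof (rule sum_mono)
      fix i assume "i \<in> {..<n}"
      then have i: "i < n" by simp
      have "\<bar>inner (\<Phi> (J x)) (e i)\<bar> \<le> norm (\<Phi> (J x)) * norm (e i)" by (rule Cauchy_Schwarz_ineq2)
      also have "\<dots> \<le> K" using e(3)[OF i] bd[OF JF] by simp
      finally show "(\<phi> x i)\<^sup>2 \<le> K\<^sup>2"
        using i K0 unfolding \<phi>_def by (simp add: abs_le_square_iff[symmetric])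
    qed
    also have "\<dots> = real n * K\<^sup>2" by simp
    also have "\<dots> < (real (n + 1))\<^sup>2 * (K + 1)\<^sup>2"
    proof (rule mult_strict_mono')
      show "real n < (real (n + 1))\<^sup>2" by (simp add: power2_eq_square algebra_simps add_pos_nonneg)
      show "K\<^sup>2 < (K + 1)\<^sup>2" using K0 by (intro power_strict_mono) simp_all
    qed (use K0 in simp_all)
    finally show "(\<Sum>i<n. (\<phi> x i)\<^sup>2) < (real (n + 1) * (K + 1))\<^sup>2" by (simp add: power_mult_distrib)
  qed
  have "\<Phi> (J c) = (\<Sum>i<n. inner (\<Phi> (J c)) (e i) *\<^sub>R e i)"
    by (rule e(2)[OF maps[OF JF]])
  also have "\<dots> = (\<Sum>i<n. c i *\<^sub>R e i)"
    using fun_cong[OF c(2)] unfolding \<phi>_def by (intro sum.cong) (auto split: if_splits, metis)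
  finally have "\<Phi> (J c) = J c" unfolding J_def .
  then show ?thesis using that JF by blast
qed

section \<open>Existence by Brouwer's theorem\<close>

context gap_pair
begin

text \<open>Brouwer's theorem needs a map that is bounded on the whole range of \<open>PX\<close>,
  so the nonlinear term is cut off; the a priori bound then shows that the cut-off is inactive at
  the fixed point.\<close>

theorem existence:
  assumes F: "\<And>u. u \<in> H \<Longrightarrow> F u \<in> H"
    and lip: "\<And>u v. u \<in> H \<Longrightarrow> v \<in> H \<Longrightarrow> norm (F u - F v) \<le> l * norm (u - v)"
    and l: "0 \<le> l" "l < \<beta>"
    and asym: "\<And>\<epsilon>. 0 < \<epsilon> \<Longrightarrow> \<exists>M. \<forall>u\<in>H. \<exists>B. bounded_self_adjoint_on H B \<and>
      (\<forall>w\<in>H. inner (B1 w) w \<le> inner (B w) w \<and> inner (B w) w \<le> inner (B2 w) w) \<and>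
      norm (F u - B u) \<le> \<epsilon> * norm u + M"
  shows "\<exists>u\<in>D. app u = F u"
proof -
  obtain c where c: "0 < c" and coer: "\<And>B w. bounded_self_adjoint_on H B \<Longrightarrow>
      (\<And>u. u \<in> H \<Longrightarrow> inner (B1 u) u \<le> inner (B u) u \<and> inner (B u) u \<le> inner (B2 u) u) \<Longrightarrow>
      w \<in> D \<Longrightarrow> c * norm w \<le> norm (app w - B w)"
    by (rule coercive) blast
  obtain M where M: "\<And>u. u \<in> H \<Longrightarrow> \<exists>B. bounded_self_adjoint_on H B \<and>
      (\<forall>w\<in>H. inner (B1 w) w \<le> inner (B w) w \<and> inner (B w) w \<le> inner (B2 w) w) \<and>
      norm (F u - B u) \<le> (c / 2) * norm u + M"
    using asym[of "c / 2"] c by auto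
  \<comment> \<open>From \<open>c * norm u \<le> c / 2 * norm u + \<bar>M\<bar>\<close>; the 1 makes
    the bound strict and \<open>R\<close> positive.\<close>
  define R where "R = 2 * \<bar>M\<bar> / c + 1"
  have R: "0 < R" unfolding R_def using c by (simp add: add_nonneg_pos)
  have apriori: "norm u < R" if u: "u \<in> D" and s: "0 \<le> s" "s \<le> 1" and eq: "p2.C.app u = s *\<^sub>R (F u - B2 u)" for u s
  proof -
    have uH: "u \<in> H" using u by (rule dom_in)
    obtain B where B: "bounded_self_adjoint_on H B"
      and B12: "\<And>w. w \<in> H \<Longrightarrow> inner (B1 w) w \<le> inner (B w) w \<and> inner (B w) w \<le> inner (B2 w) w"
      and FB: "norm (F u - B u) \<le> (c / 2) * norm u + M"
      using M[OF uH] by blast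
    \<comment> \<open>Along the homotopy the comparison operator is a convex combination of
      \<open>B2\<close> and \<open>B\<close>, hence still between \<open>B1\<close> and
      \<open>B2\<close>.\<close>
    define B' where "B' u = (1 - s) *\<^sub>R B2 u + s *\<^sub>R B u" for u
    have "bounded_self_adjoint_on H B'"
      unfolding B'_def by (rule bounded_self_adjoint_convex[OF sub p2.B B s])
    moreover have "inner (B1 w) w \<le> inner (B' w) w \<and> inner (B' w) w \<le> inner (B2 w) w" if w: "w \<in> H" for w
    proof
      have a: "inner (B1 w) w \<le> inner (B w) w" "inner (B w) w \<le> inner (B2 w) w"
        "inner (B1 w) w \<le> inner (B2 w) w" using B12[OF w] gap_pair.B12 by auto
      have "inner (B' w) w = (1 - s) * inner (B2 w) w + s * inner (B w) w"
        unfolding B'_def by (simp add: inner_add_left)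
      moreover have "(1 - s) * inner (B1 w) w + s * inner (B1 w) w \<le> (1 - s) * inner (B2 w) w + s * inner (B w) w"
        using a s by (intro add_mono mult_left_mono) simp_all
      moreover have "(1 - s) * inner (B2 w) w + s * inner (B w) w \<le> (1 - s) * inner (B2 w) w + s * inner (B2 w) w"
        using a s by (intro add_mono mult_left_mono) simp_all
      ultimately show "inner (B1 w) w \<le> inner (B' w) w" "inner (B' w) w \<le> inner (B2 w) w"
        by (simp_all add: algebra_simps)
    qed
    ultimately have "c * norm u \<le> norm (app u - B' u)" using coer u by blast
    also have "app u - B' u = s *\<^sub>R (F u - B u)"
      using eq p2.C_app[OF u] unfolding B'_def by (simp add: algebra_simps)
    also have "norm \<dots> \<le> 1 * norm (F u - B u)"
      using s by (simp add: mult_left_le_one_le)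
    finally have "c * norm u \<le> (c / 2) * norm u + \<bar>M\<bar>" using FB by simp
    then have "norm u \<le> 2 * \<bar>M\<bar> / c" using c by (simp add: field_simps)
    then show ?thesis unfolding R_def by simp
  qed
  \<comment> \<open>Equal to 1 up to radius \<open>R\<close> and to 0 from \<open>2 R\<close> on. It
    will be evaluated at the \<open>PX\<close>-component alone, so that for fixed \<open>x\<close>
    the map \<open>\<Psi> x\<close> keeps a Lipschitz constant
    \<open>max \<kappa> l < \<beta>\<close>.\<close>
  define cut where "cut x = max 0 (min 1 (2 - norm x / R))" for x :: 'h
  have cut: "0 \<le> cut x" "cut x \<le> 1" for x unfolding cut_def by auto
  have ccut: "continuous_on S cut" for S unfolding cut_def by (intro continuous_intros) (use R in auto)
  define \<kappa>' where "\<kappa>' = max \<kappa> l"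
  have \<kappa>': "0 \<le> \<kappa>'" "\<kappa>' < \<beta>" "\<kappa> \<le> \<kappa>'" "l \<le> \<kappa>'" using p1.\<kappa> l unfolding \<kappa>'_def by auto
  define \<Psi> where "\<Psi> x u = B2 u + cut x *\<^sub>R (F u - B2 u)" for x u
  have \<Psi>H: "\<Psi> x u \<in> H" if "u \<in> H" for x u
    unfolding \<Psi>_def using that by (intro H_add subspace_scale[OF sub] H_diff F p2.B_in)
  have \<Psi>lip: "norm (\<Psi> x u - \<Psi> x v) \<le> \<kappa>' * norm (u - v)" if uv: "u \<in> H" "v \<in> H" for x u v
  proof -
    have "\<Psi> x u - \<Psi> x v = (1 - cut x) *\<^sub>R (B2 u - B2 v) + cut x *\<^sub>R (F u - F v)"
      unfolding \<Psi>_def by (simp add: algebra_simps)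
    also have "norm \<dots> \<le> norm ((1 - cut x) *\<^sub>R (B2 u - B2 v)) + norm (cut x *\<^sub>R (F u - F v))"
      by (rule norm_triangle_ineq)
    also have "\<dots> = (1 - cut x) * norm (B2 u - B2 v) + cut x * norm (F u - F v)"
      using cut[of x] by simp
    also have "\<dots> \<le> (1 - cut x) * (\<kappa>' * norm (u - v)) + cut x * (\<kappa>' * norm (u - v))"
    proof (intro add_mono mult_left_mono)
      show "norm (B2 u - B2 v) \<le> \<kappa>' * norm (u - v)"
        using p2.B_lip[OF uv] mult_right_mono[OF \<kappa>'(3), of "norm (u - v)"] by simp
      show "norm (F u - F v) \<le> \<kappa>' * norm (u - v)"
        using lip[OF uv] mult_right_mono[OF \<kappa>'(4), of "norm (u - v)"] by simp
    qed (use cut[of x] in simp_all)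
    finally show ?thesis by (simp add: algebra_simps)
  qed
  have ex: "\<exists>!y. y \<in> D \<and> PY y = y \<and> app y = PY (\<Psi> x (x + y))" if "x \<in> H" for x
    by (rule reduction[OF \<Psi>H \<Psi>lip \<kappa>'(1,2) that])
  define Y where "Y x = (THE y. y \<in> D \<and> PY y = y \<and> app y = PY (\<Psi> x (x + y)))" for x
  have Y: "Y x \<in> D \<and> PY (Y x) = Y x \<and> app (Y x) = PY (\<Psi> x (x + Y x))" if "x \<in> H" for x
    unfolding Y_def by (rule theI'[OF ex[OF that]])
  have YH: "Y x \<in> H" if "x \<in> H" for x using Y[OF that] dom_in by simp
  \<comment> \<open>Freezing \<open>Y z\<close> on the right leaves an expression continuous in
    \<open>x\<close>, from which continuity of \<open>Y\<close> at \<open>z\<close> follows.\<close>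
  have Ydiff: "(\<beta> - \<kappa>') * norm (Y x - Y z) \<le> norm (\<Psi> x (x + Y z) - \<Psi> z (z + Y z))" if xz: "x \<in> H" "z \<in> H" for x z
  proof -
    have H: "x + Y x \<in> H" "x + Y z \<in> H" "z + Y z \<in> H" using xz YH H_add by simp_all
    have "\<beta> * norm (Y x - Y z) \<le> norm (app (Y x - Y z))"
      using Y[OF xz(1)] Y[OF xz(2)] by (intro PY_coercive) (simp_all add: dom_diff E_diff dom_in)
    also have "app (Y x - Y z) = PY (\<Psi> x (x + Y x) - \<Psi> z (z + Y z))"
      using Y[OF xz(1)] Y[OF xz(2)] H \<Psi>H by (simp add: app_diff E_diff)
    also have "norm \<dots> \<le> norm (\<Psi> x (x + Y x) - \<Psi> z (z + Y z))"
      using H \<Psi>H by (intro E_norm_le H_diff) simp_all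
    also have "\<dots> \<le> norm (\<Psi> x (x + Y x) - \<Psi> x (x + Y z)) + norm (\<Psi> x (x + Y z) - \<Psi> z (z + Y z))"
      using norm_triangle_ineq[of "\<Psi> x (x + Y x) - \<Psi> x (x + Y z)" "\<Psi> x (x + Y z) - \<Psi> z (z + Y z)"] by simp
    also have "norm (\<Psi> x (x + Y x) - \<Psi> x (x + Y z)) \<le> \<kappa>' * norm (Y x - Y z)"
      using \<Psi>lip[OF H(1,2), of x] by simp
    finally show ?thesis by (simp add: left_diff_distrib)
  qed
  have cF: "continuous_on H F" using l(1) lip by (rule lipschitz_within_continuous)
  have cB: "continuous_on H B2" using p2.\<kappa>(1) p2.B_lip by (rule lipschitz_within_continuous)
  have cY: "continuous_on H Y"
    unfolding continuous_on_def
  proof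
    fix z assume z: "z \<in> H"
    define g where "g x = \<Psi> x (x + Y z)" for x
    have cg: "continuous_on H g"
      unfolding g_def \<Psi>_def using YH[OF z] H_add
      by (intro continuous_intros ccut continuous_on_compose2[OF cF] continuous_on_compose2[OF cB]) auto
    show "(Y \<longlongrightarrow> Y z) (at z within H)"
    proof (rule Lim_null_comparison[THEN LIM_zero_cancel])
      show "\<forall>\<^sub>F x in at z within H. norm (Y x - Y z) \<le> norm (g x - g z) / (\<beta> - \<kappa>')"
        unfolding eventually_at_filter
      proof (rule always_eventually, intro allI impI)
        fix x assume "x \<in> H"
        then show "norm (Y x - Y z) \<le> norm (g x - g z) / (\<beta> - \<kappa>')"
          using Ydiff[OF _ z, of x] \<kappa>'(2) unfolding g_def by (simp add: field_simps)
      qed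
      have "(g \<longlongrightarrow> g z) (at z within H)" using cg z unfolding continuous_on_def by blast
      then have "((\<lambda>x. norm (g x - g z)) \<longlongrightarrow> 0) (at z within H)"
        by (intro tendsto_norm_zero LIM_zero)
      then show "((\<lambda>x. norm (g x - g z) / (\<beta> - \<kappa>')) \<longlongrightarrow> 0) (at z within H)"
        by (rule tendsto_divide_zero)
    qed
  qed
  \<comment> \<open>The inverse of \<open>A - B2\<close>; coercivity will make it Lipschitz with
    constant \<open>1 / c\<close>.\<close>
  define I where "I v = (SOME z. z \<in> D \<and> p2.C.app z = v)" for v
  have I: "I v \<in> D \<and> p2.C.app (I v) = v" if v: "v \<in> H" for v
  proof -
    have "inner v k = 0" if "k \<in> D" "p2.C.app k = 0" for k using C2_kernel[OF that] by simp
    then have "\<exists>z. z \<in> D \<and> p2.C.app z = v" using p2.C_solve[OF v] by blast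
    then show ?thesis unfolding I_def by (rule someI_ex)
  qed
  have coer2: "c * norm w \<le> norm (p2.C.app w)" if w: "w \<in> D" for w
    using coer[OF p2.B _ w] B12 p2.C_app[OF w] by simp
  have Ilip: "norm (I u - I v) \<le> (1 / c) * norm (u - v)" if "u \<in> H" "v \<in> H" for u v
  proof -
    have "c * norm (I u - I v) \<le> norm (p2.C.app (I u - I v))"
      using I that by (intro coer2 dom_diff) simp_all
    also have "p2.C.app (I u - I v) = u - v"
      using I[OF that(1)] I[OF that(2)] p2.C.app_diff[of "I u" "I v"] p2.C_dom by simp
    finally show ?thesis using c by (simp add: field_simps)
  qed
  define K where "K x = cut x *\<^sub>R (F (x + Y x) - B2 (x + Y x))" for x
  have xYH: "x + Y x \<in> H" if "x \<in> H" for x using that YH H_add by simp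
  have KH: "K x \<in> H" if "x \<in> H" for x
    unfolding K_def using xYH[OF that] by (intro subspace_scale[OF sub] H_diff F p2.B_in)
  have cK: "continuous_on H K"
    unfolding K_def using xYH
    by (intro continuous_intros ccut cY continuous_on_compose2[OF cF] continuous_on_compose2[OF cB]) auto
  have cI: "continuous_on H I"
    by (rule lipschitz_within_continuous[of "1 / c"]) (use c Ilip in simp_all)
  have cPX: "continuous_on H PX"
    by (rule lipschitz_within_continuous[of 1]) (use E_norm_le[of "{-\<beta><..<\<beta>}"] in \<open>simp_all add: E_diff[symmetric] H_diff\<close>)
  \<comment> \<open>A fixed point \<open>x\<close> is the \<open>PX\<close>-component of the
    solution \<open>z\<close> of \<open>(A - B2) z = K x\<close>.\<close>
  define \<Phi> where "\<Phi> x = PX (I (K x))" for x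
  have c\<Phi>: "continuous_on H \<Phi>"
    unfolding \<Phi>_def
    by (intro continuous_on_compose2[OF cPX] continuous_on_compose2[OF cI cK]) (use KH I dom_in in auto)
  have z0: "0 \<in> H" by (rule subspace_0[OF sub])
  have growth: "norm (F u) \<le> norm (F 0) + l * norm u" if "u \<in> H" for u
    using lip[OF that z0] norm_triangle_ineq2[of "F u" "F 0"] by simp
  \<comment> \<open>From radius \<open>2 R\<close> on the cut-off makes \<open>K\<close> vanish;
    inside, coercivity on the range of \<open>PY\<close> bounds \<open>Y x\<close>.\<close>
  have Kbd: "norm (K x) \<le> norm (F 0) + (l + \<kappa>) * (2 * R + (\<kappa>' * (2 * R) + norm (F 0)) / (\<beta> - \<kappa>'))" (is "_ \<le> ?K")
    if x: "x \<in> H" for x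
  proof (cases "2 * R \<le> norm x")
    case True
    then have "cut x = 0" unfolding cut_def using R by (simp add: field_simps)
    then show ?thesis unfolding K_def using l p1.\<kappa> \<kappa>' R by simp
  next
    case False
    have "norm (\<Psi> x 0) \<le> norm (F 0)"
      unfolding \<Psi>_def using p2.B_0 cut[of x] by (simp add: mult_left_le_one_le)
    moreover have "norm (\<Psi> x (x + Y x)) \<le> norm (\<Psi> x 0) + \<kappa>' * norm (x + Y x)"
      using \<Psi>lip[OF xYH[OF x] z0, of x] norm_triangle_ineq2[of "\<Psi> x (x + Y x)" "\<Psi> x 0"] by simp
    moreover have "\<beta> * norm (Y x) \<le> norm (\<Psi> x (x + Y x))"
      using PY_coercive[of "Y x"] Y[OF x] E_norm_le[of "- {-\<beta><..<\<beta>}" "\<Psi> x (x + Y x)"] \<Psi>H[OF xYH[OF x]] by simp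
    moreover have "\<kappa>' * norm (x + Y x) \<le> \<kappa>' * (2 * R + norm (Y x))"
      using False \<kappa>'(1) norm_triangle_ineq[of x "Y x"] by (intro mult_left_mono) simp_all
    ultimately have "(\<beta> - \<kappa>') * norm (Y x) \<le> \<kappa>' * (2 * R) + norm (F 0)" by (simp add: algebra_simps)
    then have "norm (Y x) \<le> (\<kappa>' * (2 * R) + norm (F 0)) / (\<beta> - \<kappa>')"
      using \<kappa>'(2) by (simp add: field_simps)
    then have nu: "norm (x + Y x) \<le> 2 * R + (\<kappa>' * (2 * R) + norm (F 0)) / (\<beta> - \<kappa>')"
      using False norm_triangle_ineq[of x "Y x"] by linarith
    have "norm (K x) \<le> norm (F (x + Y x) - B2 (x + Y x))"
      unfolding K_def using cut[of x] by (simp add: mult_left_le_one_le)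
    also have "\<dots> \<le> norm (F (x + Y x)) + norm (B2 (x + Y x))" by (rule norm_triangle_ineq4)
    also have "\<dots> \<le> norm (F 0) + (l + \<kappa>) * norm (x + Y x)"
      using growth[OF xYH[OF x]] p2.B_bound[OF xYH[OF x]] by (simp add: distrib_right)
    also have "\<dots> \<le> ?K" using nu l(1) p1.\<kappa>(1) by (intro add_left_mono mult_left_mono) simp_all
    finally show ?thesis .
  qed
  have bX: "{-\<beta><..<\<beta>} \<in> sets borel" "{-\<beta><..<\<beta>} \<subseteq> {-\<beta><..<\<beta>}" by auto
  obtain U where U: "finite U" "independent U" "U \<subseteq> PX ` H" "PX ` H \<subseteq> span U"
    using X_basis[OF bX] by blast
  have spU: "span U = PX ` H" using span_minimal[OF U(3) E_range_subspace[OF bX(1)]] U(4) by simp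
  have UH: "span U \<subseteq> H" unfolding spU using E_in[OF bX(1)] by auto
  obtain x where x: "x \<in> span U" "\<Phi> x = x"
  proof (rule brouwer_span[OF U(1), of \<Phi> "(1 / c) * (?K + norm (K 0)) + norm (I (K 0))"])
    show "continuous_on (span U) \<Phi>"
      by (rule continuous_on_subset[OF c\<Phi> UH])
    fix x assume "x \<in> span U"
    then have xH: "x \<in> H" using UH by (rule subsetD[rotated])
    have IH: "I (K x) \<in> H" using I[OF KH[OF xH]] dom_in by simp
    then show "\<Phi> x \<in> span U" unfolding spU \<Phi>_def by (rule imageI)
    have "norm (\<Phi> x) \<le> norm (I (K x))" unfolding \<Phi>_def using IH by (intro E_norm_le) simp_all
    also have "\<dots> \<le> norm (I (K x) - I (K 0)) + norm (I (K 0))"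
      using norm_triangle_ineq[of "I (K x) - I (K 0)" "I (K 0)"] by simp
    also have "norm (I (K x) - I (K 0)) \<le> (1 / c) * norm (K x - K 0)"
      using Ilip KH xH z0 by simp
    also have "\<dots> \<le> (1 / c) * (?K + norm (K 0))"
      using c Kbd[OF xH] norm_triangle_ineq4[of "K x" "K 0"] by (intro mult_left_mono) simp_all
    finally show "norm (\<Phi> x) \<le> (1 / c) * (?K + norm (K 0)) + norm (I (K 0))" by simp
  qed
  have "x \<in> PX ` H" using x(1) spU by simp
  then have xH: "x \<in> H" "PX x = x" using E_in[OF bX(1)] E_idem[OF bX(1)] by auto
  define z where "z = I (K x)"
  have z: "z \<in> D" "p2.C.app z = K x" "PX z = x"
    using I[OF KH[OF xH(1)]] x(2) unfolding z_def \<Phi>_def by simp_all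
  have zH: "z \<in> H" using z(1) by (rule dom_in)
  have zeq: "z = x + PY z" using XY[OF zH] z(3) by simp
  \<comment> \<open>With \<open>K x\<close> held fixed, \<open>PY z\<close> and \<open>Y x\<close>
    solve the same affine equation in the range of \<open>PY\<close>. Uniqueness gives
    \<open>z = x + Y x\<close>, so \<open>K x\<close> is the cut-off nonlinear term at
    \<open>z\<close> itself.\<close>
  define \<Psi>' where "\<Psi>' u = B2 u + K x" for u
  have uniq: "\<exists>!y. y \<in> D \<and> PY y = y \<and> app y = PY (\<Psi>' (x + y))"
    by (rule reduction[OF _ _ p1.\<kappa> xH(1)])
      (use KH[OF xH(1)] p2.B_in p2.B_lip H_add in \<open>simp_all add: \<Psi>'_def\<close>)
  have "PY z \<in> D \<and> PY (PY z) = PY z \<and> app (PY z) = PY (\<Psi>' (x + PY z))"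
  proof (intro conjI)
    show "PY z \<in> D" using z(1) by (simp add: E_dom)
    show "PY (PY z) = PY z" using zH by (simp add: E_idem)
    have "app z = \<Psi>' z" unfolding \<Psi>'_def using z(2) p2.C_app[OF z(1)] by (simp add: algebra_simps)
    then show "app (PY z) = PY (\<Psi>' (x + PY z))" using app_E[of "- {-\<beta><..<\<beta>}" z] z(1) zeq by simp
  qed
  moreover have "Y x \<in> D \<and> PY (Y x) = Y x \<and> app (Y x) = PY (\<Psi>' (x + Y x))"
    using Y[OF xH(1)] unfolding \<Psi>'_def \<Psi>_def K_def .
  ultimately have "PY z = Y x" using uniq by blast
  then have zY: "z = x + Y x" using zeq by simp
  have "p2.C.app z = cut x *\<^sub>R (F z - B2 z)" using z(2) unfolding zY K_def .
  \<comment> \<open>The bound is used with \<open>s = cut x\<close>; since \<open>x = PX z\<close>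
    is no longer than \<open>z\<close>, it forces \<open>cut x = 1\<close>.\<close>
  then have zR: "norm z < R" using apriori[OF z(1)] cut by blast
  have "norm x \<le> norm z" using E_norm_le[of "{-\<beta><..<\<beta>}" z] zH z(3) by simp
  then have "norm x / R < 1" using zR R by (simp add: field_simps)
  then have "cut x = 1" unfolding cut_def by simp
  then have "app z = F z" using \<open>p2.C.app z = cut x *\<^sub>R (F z - B2 z)\<close> p2.C_app[OF z(1)] by simp
  then show ?thesis using z(1) by blast
qed

end

section \<open>The space \<open>L\<^sup>2\<close>\<close>

lemma L2_rep_square_integrable: "square_integrable (L2_rep u)"
  using Quotient3_rep_reflp[OF Quotient3_L2] by blast

lemma L2_rep_measurable [measurable]: "L2_rep u \<in> borel_measurable lebesgue"
  using L2_rep_square_integrable[of u] unfolding square_integrable_def by (rule conjunct1)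

lemma L2_rep_integrable: "integrable lebesgue (\<lambda>z. (L2_rep u z)\<^sup>2)"
  using L2_rep_square_integrable[of u] unfolding square_integrable_def by (rule conjunct2)

lemma L2_rep_class:
  assumes "square_integrable f" shows "AE z in lebesgue. L2_rep (L2_class f) z = f z"
proof -
  show ?thesis using rep_abs_rsp_left[OF Quotient3_L2, of f f] assms by simp
qed

lemma L2_eqI:
  assumes "AE z in lebesgue. L2_rep u z = L2_rep v z" shows "u = v"
  using Quotient3_rel_rep[OF Quotient3_L2, of u v] L2_rep_square_integrable[of u]
    L2_rep_square_integrable[of v] assms by simp

lemma L2_rep_add: "AE z in lebesgue. L2_rep (u + v) z = L2_rep u z + L2_rep v z"
proof -
  have "u + v = L2_class (\<lambda>z. L2_rep u z + L2_rep v z)" by (simp add: plus_L2_def)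
  then show ?thesis
    using L2_rep_class[OF square_integrable_add[OF L2_rep_square_integrable[of u] L2_rep_square_integrable[of v]]]
    by simp
qed

lemma L2_rep_scale: "AE z in lebesgue. L2_rep (c *\<^sub>R u) z = c * L2_rep u z"
proof -
  have "c *\<^sub>R u = L2_class (\<lambda>z. c * L2_rep u z)" by (simp add: scaleR_L2_def)
  then show ?thesis
    using L2_rep_class[OF square_integrable_scale[OF L2_rep_square_integrable[of u]]] by simp
qed

lemma L2_rep_diff: "AE z in lebesgue. L2_rep (u - v) z = L2_rep u z - L2_rep v z"
  using L2_rep_add[of "u - v" v] by eventually_elim simp

lemma L2_rep_zero: "AE z in lebesgue. L2_rep 0 z = 0"
  using L2_rep_class[OF square_integrable_0] unfolding zero_L2_def[symmetric] .

lemma L2_inner: "inner u v = (LINT z|lebesgue. L2_rep u z * L2_rep v z)"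
  by (simp add: inner_L2_def)

lemma L2_norm_sq: "(norm u)\<^sup>2 = (LINT z|lebesgue. (L2_rep u z)\<^sup>2)" for u :: L2
  using power2_norm_eq_inner[of u] L2_inner[of u u] by (simp only: power2_eq_square)

lemma L2_norm_nn: "(\<integral>\<^sup>+z. ennreal ((L2_rep u z)\<^sup>2) \<partial>lebesgue) = ennreal ((norm u)\<^sup>2)" for u :: L2
  unfolding L2_norm_sq by (rule nn_integral_eq_integral[OF L2_rep_integrable]) simp

lemma L2_norm_mono:
  fixes u v :: L2
  assumes "0 \<le> c" "AE z in lebesgue. \<bar>L2_rep u z\<bar> \<le> c * \<bar>L2_rep v z\<bar>"
  shows "norm u \<le> c * norm v"
proof -
  have "(norm u)\<^sup>2 \<le> (LINT z|lebesgue. c\<^sup>2 * (L2_rep v z)\<^sup>2)"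
    unfolding L2_norm_sq
  proof (rule integral_mono_AE[OF L2_rep_integrable])
    show "integrable lebesgue (\<lambda>z. c\<^sup>2 * (L2_rep v z)\<^sup>2)" using L2_rep_integrable by simp
    show "AE z in lebesgue. (L2_rep u z)\<^sup>2 \<le> c\<^sup>2 * (L2_rep v z)\<^sup>2"
      using assms(2)
    proof eventually_elim
      case (elim z)
      then have "\<bar>L2_rep u z\<bar>\<^sup>2 \<le> (c * \<bar>L2_rep v z\<bar>)\<^sup>2" by (rule power_mono) simp
      then show ?case by (simp add: power_mult_distrib)
    qed
  qed
  also have "\<dots> = (c * norm v)\<^sup>2" by (simp add: L2_norm_sq power_mult_distrib)
  finally show ?thesis by (rule power2_le_imp_le) (use assms(1) in simp)
qed

lemma square_integrable_bound:
  assumes "square_integrable g" "f \<in> borel_measurable lebesgue" "AE z in lebesgue. \<bar>f z\<bar> \<le> \<bar>g z\<bar>"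
  shows "square_integrable f"
  unfolding square_integrable_def
proof
  have f[measurable]: "f \<in> borel_measurable lebesgue" by fact
  show "integrable lebesgue (\<lambda>z. (f z)\<^sup>2)"
  proof (rule Bochner_Integration.integrable_bound)
    show "integrable lebesgue (\<lambda>z. (g z)\<^sup>2)" using assms(1) unfolding square_integrable_def by simp
    show "(\<lambda>z. (f z)\<^sup>2) \<in> borel_measurable lebesgue" by measurable
    show "AE z in lebesgue. norm ((f z)\<^sup>2) \<le> norm ((g z)\<^sup>2)"
      using assms(3) by eventually_elim (simp add: abs_le_square_iff)
  qed
qed fact

lemma Omega_sets [measurable, simp]: "Omega T \<in> sets borel" "Omega T \<in> sets lebesgue" "Omega T \<in> sets lborel"
proof -
  show "Omega T \<in> sets borel"
    unfolding Omega_def by (intro borel_Times) simp_all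
  then show "Omega T \<in> sets lebesgue" "Omega T \<in> sets lborel" by simp_all
qed

lemma Omega_emeasure: "emeasure lebesgue (Omega T) < \<infinity>"
proof -
  have "Omega T \<subseteq> cbox (0, 0) (pi, T)" unfolding Omega_def by auto
  then have "emeasure lebesgue (Omega T) \<le> emeasure lebesgue (cbox (0::real, 0::real) (pi, T))"
    by (rule emeasure_mono) simp
  also have "\<dots> < \<infinity>" by (simp add: emeasure_lborel_cbox_eq)
  finally show ?thesis .
qed

lemma AE_Omega: "(AE z in lebesgue_on (Omega T). Q z) \<longleftrightarrow> (AE z in lebesgue. z \<in> Omega T \<longrightarrow> Q z)"
  by (rule AE_restrict_space_iff) simp

lemma square_integrable_Omega_const: "square_integrable (\<lambda>z. if z \<in> Omega T then K else 0)"
  unfolding square_integrable_def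
proof
  show "(\<lambda>z. if z \<in> Omega T then K else 0) \<in> borel_measurable lebesgue" by measurable
  have "integrable lebesgue (\<lambda>z. K\<^sup>2 * indicator (Omega T) z)"
    using Omega_emeasure by (intro integrable_mult_right integrable_real_indicator) simp_all
  moreover have "(\<lambda>z. (if z \<in> Omega T then K else 0)\<^sup>2) = (\<lambda>z. K\<^sup>2 * indicator (Omega T) z)"
    by (auto simp: indicator_def)
  ultimately show "integrable lebesgue (\<lambda>z. (if z \<in> Omega T then K else 0)\<^sup>2)" by simp
qed

lemma HL2_iff: "u \<in> HL2 T \<longleftrightarrow> (AE z in lebesgue. z \<notin> Omega T \<longrightarrow> L2_rep u z = 0)"
  unfolding HL2_def by simp

lemma HL2_subspace: "subspace (HL2 T)"
  unfolding subspace_def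
proof (intro conjI ballI allI)
  show "0 \<in> HL2 T" unfolding HL2_iff using L2_rep_zero by eventually_elim simp
  show "u + v \<in> HL2 T" if "u \<in> HL2 T" "v \<in> HL2 T" for u v
    using that L2_rep_add[of u v] unfolding HL2_iff by eventually_elim simp
  show "c *\<^sub>R u \<in> HL2 T" if "u \<in> HL2 T" for c u
    using that L2_rep_scale[of c u] unfolding HL2_iff by eventually_elim simp
qed

text \<open>The Riesz-Fischer argument for a sequence with geometric rate: almost everywhere
  convergence from an integrable weighted series, then Fatou's lemma for the rate.\<close>

lemma L2_fast_Cauchy:
  fixes t :: "nat \<Rightarrow> L2"
  assumes d: "\<And>k m. k \<le> m \<Longrightarrow> norm (t m - t k) \<le> (1/4) ^ k" and H: "\<And>k. t k \<in> HL2 T"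
  obtains u where "u \<in> HL2 T" "\<And>k. norm (u - t k) \<le> (1/4) ^ k"
proof -
  let ?f = "\<lambda>k z. L2_rep (t k) z"
  \<comment> \<open>The squared norms are at most \<open>(1/16) ^ k\<close>, so the series stays
    summable with weight \<open>p = 2 ^ k\<close>; the weight in turn gives absolute summability of
    the increments \<open>a\<close>, by
    \<open>\<bar>a\<bar> \<le> 1 / p + p a\<^sup>2\<close>.\<close>
  have "(\<integral>\<^sup>+z. (suminf (\<lambda>k. ennreal (2 ^ k * (L2_rep (t (Suc k) - t k) z)\<^sup>2))) \<partial>lebesgue)
      = suminf (\<lambda>k. ennreal (2 ^ k) * ennreal ((norm (t (Suc k) - t k))\<^sup>2))"
    by (subst nn_integral_suminf) (simp_all add: ennreal_mult nn_integral_cmult L2_norm_nn)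
  also have "\<dots> \<le> suminf (\<lambda>k. ennreal ((1/8) ^ k))"
  proof (rule suminf_le)
    fix k
    have "(norm (t (Suc k) - t k))\<^sup>2 \<le> ((1/4) ^ k)\<^sup>2"
      using d[of k "Suc k"] by (intro power_mono) simp_all
    then have "2 ^ k * (norm (t (Suc k) - t k))\<^sup>2 \<le> 2 ^ k * ((1/4) ^ k)\<^sup>2" by simp
    also have "2 ^ k * ((1/4) ^ k)\<^sup>2 = ((1/8) ^ k :: real)"
      by (simp add: power_mult_distrib[symmetric] power2_eq_square)
    finally show "ennreal (2 ^ k) * ennreal ((norm (t (Suc k) - t k))\<^sup>2) \<le> ennreal ((1/8) ^ k)"
      by (simp add: ennreal_mult[symmetric] ennreal_leI)
  qed simp_all
  also have "\<dots> < \<infinity>"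
  proof -
    have "summable (\<lambda>k. (1/8 :: real) ^ k)" by (rule summable_geometric) simp
    then have "suminf (\<lambda>k. ennreal ((1/8) ^ k)) = ennreal (suminf (\<lambda>k. (1/8) ^ k))"
      by (intro suminf_ennreal2) simp_all
    then show ?thesis by simp
  qed
  finally have fin: "(\<integral>\<^sup>+z. (suminf (\<lambda>k. ennreal (2 ^ k * (L2_rep (t (Suc k) - t k) z)\<^sup>2))) \<partial>lebesgue) \<noteq> \<infinity>"
    by simp
  have "AE z in lebesgue. suminf (\<lambda>k. ennreal (2 ^ k * (L2_rep (t (Suc k) - t k) z)\<^sup>2)) \<noteq> \<infinity>"
    by (rule nn_integral_PInf_AE[OF _ fin]) measurable
  moreover have "AE z in lebesgue. \<forall>k. L2_rep (t (Suc k) - t k) z = ?f (Suc k) z - ?f k z"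
    unfolding AE_all_countable using L2_rep_diff by blast
  ultimately have conv: "AE z in lebesgue. convergent (\<lambda>k. ?f k z)"
  proof eventually_elim
    case (elim z)
    define a where "a k = ?f (Suc k) z - ?f k z" for k
    have "suminf (\<lambda>k. ennreal (2 ^ k * (a k)\<^sup>2)) \<noteq> \<infinity>" using elim unfolding a_def by simp
    then have s1: "summable (\<lambda>k. 2 ^ k * (a k)\<^sup>2)"
      unfolding infinity_ennreal_def by (intro summable_suminf_not_top) simp_all
    have "summable a"
    proof (rule summable_comparison_test')
      show "summable (\<lambda>k. (1/2) ^ k + 2 ^ k * (a k)\<^sup>2)"
        by (intro summable_add s1 summable_geometric) simp
      fix k :: nat
      show "norm (a k) \<le> (1/2) ^ k + 2 ^ k * (a k)\<^sup>2"
      proof -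
        define p where "p = (2::real) ^ k"
        have p: "0 < p" "(1/2) ^ k = 1 / p" unfolding p_def by (simp_all add: power_one_over)
        have "0 \<le> (p * \<bar>a k\<bar> - 1)\<^sup>2 + p * \<bar>a k\<bar>" using p by simp
        then have "p * \<bar>a k\<bar> \<le> 1 + p * (p * (a k)\<^sup>2)"
          by (simp add: power2_eq_square algebra_simps)
        then have "p * \<bar>a k\<bar> \<le> p * (1 / p + p * (a k)\<^sup>2)" using p by (simp add: distrib_left)
        then have "\<bar>a k\<bar> \<le> 1 / p + p * (a k)\<^sup>2" using p by simp
        then show ?thesis using p unfolding p_def by simp
      qed
    qed
    then have "summable (\<lambda>k. ?f (Suc k) z - ?f k z)" unfolding a_def .
    then have "convergent (\<lambda>n. \<Sum>k<n. ?f (Suc k) z - ?f k z)" by (simp add: summable_iff_convergent)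
    then have "convergent (\<lambda>n. ?f n z - ?f 0 z)" by (simp add: sum_lessThan_telescope[of "\<lambda>k. L2_rep (t k) z"])
    then have "convergent (\<lambda>n. (?f n z - ?f 0 z) + ?f 0 z)" by (intro convergent_add convergent_const)
    then show ?case by simp
  qed
  define f where "f z = lim (\<lambda>k. ?f k z)" for z
  have fm[measurable]: "f \<in> borel_measurable lebesgue"
    unfolding f_def by (rule borel_measurable_lim_metric) measurable
  have lim: "AE z in lebesgue. (\<lambda>k. ?f k z) \<longlonglongrightarrow> f z"
    using conv unfolding f_def by eventually_elim (simp add: convergent_LIMSEQ_iff)
  have fatou: "(\<integral>\<^sup>+z. ennreal ((f z - ?f n z)\<^sup>2) \<partial>lebesgue) \<le> ennreal (((1/4) ^ n)\<^sup>2)" for n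
  proof -
    have "(\<integral>\<^sup>+z. ennreal ((f z - ?f n z)\<^sup>2) \<partial>lebesgue)
        = (\<integral>\<^sup>+z. liminf (\<lambda>k. ennreal ((?f k z - ?f n z)\<^sup>2)) \<partial>lebesgue)"
    proof (rule nn_integral_cong_AE)
      show "AE z in lebesgue. ennreal ((f z - ?f n z)\<^sup>2) = liminf (\<lambda>k. ennreal ((?f k z - ?f n z)\<^sup>2))"
        using lim
      proof eventually_elim
        case (elim z)
        then have "(\<lambda>k. ennreal ((?f k z - ?f n z)\<^sup>2)) \<longlonglongrightarrow> ennreal ((f z - ?f n z)\<^sup>2)"
          by (intro tendsto_intros)
        from lim_imp_Liminf[OF _ this] show ?case by simp
      qed
    qed
    also have "\<dots> \<le> liminf (\<lambda>k. \<integral>\<^sup>+z. ennreal ((?f k z - ?f n z)\<^sup>2) \<partial>lebesgue)"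
      by (rule nn_integral_liminf) measurable
    also have "\<dots> \<le> ennreal (((1/4) ^ n)\<^sup>2)"
    proof (rule Liminf_le)
      show "\<forall>\<^sub>F k in sequentially. (\<integral>\<^sup>+z. ennreal ((?f k z - ?f n z)\<^sup>2) \<partial>lebesgue) \<le> ennreal (((1/4) ^ n)\<^sup>2)"
        using eventually_ge_at_top[of n]
      proof eventually_elim
        case (elim k)
        have "(\<integral>\<^sup>+z. ennreal ((?f k z - ?f n z)\<^sup>2) \<partial>lebesgue) = (\<integral>\<^sup>+z. ennreal ((L2_rep (t k - t n) z)\<^sup>2) \<partial>lebesgue)"
          by (rule nn_integral_cong_AE) (use L2_rep_diff[of "t k" "t n"] in eventually_elim, simp)
        also have "\<dots> = ennreal ((norm (t k - t n))\<^sup>2)" by (rule L2_norm_nn)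
        also have "\<dots> \<le> ennreal (((1/4) ^ n)\<^sup>2)"
          using d[OF elim] by (intro ennreal_leI power_mono) simp_all
        finally show ?case .
      qed
    qed simp
    finally show ?thesis .
  qed
  have sq: "square_integrable (\<lambda>z. f z - ?f n z)" for n
    unfolding square_integrable_def
  proof
    show "(\<lambda>z. f z - ?f n z) \<in> borel_measurable lebesgue" by measurable
    show "integrable lebesgue (\<lambda>z. (f z - ?f n z)\<^sup>2)"
    proof (rule integrableI_nonneg)
      show "(\<integral>\<^sup>+z. ennreal ((f z - ?f n z)\<^sup>2) \<partial>lebesgue) < \<infinity>"
        using fatou[of n] by (rule le_less_trans) simp
      show "(\<lambda>z. (f z - ?f n z)\<^sup>2) \<in> borel_measurable lebesgue" by measurable
    qed simp
  qed
  have sqf: "square_integrable f"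
    using square_integrable_add[OF sq[of 0] L2_rep_square_integrable[of "t 0"]] by simp
  define u where "u = L2_class f"
  have u: "AE z in lebesgue. L2_rep u z = f z" unfolding u_def by (rule L2_rep_class[OF sqf])
  have "AE z in lebesgue. \<forall>k. z \<notin> Omega T \<longrightarrow> ?f k z = 0"
    unfolding AE_all_countable using H unfolding HL2_iff by blast
  then have "u \<in> HL2 T"
    unfolding HL2_iff using u lim
  proof eventually_elim
    case (elim z)
    show ?case
    proof
      assume "z \<notin> Omega T"
      then have "(\<lambda>k. 0) \<longlonglongrightarrow> f z" using elim by simp
      then have "f z = 0" using LIMSEQ_unique tendsto_const by blast
      then show "L2_rep u z = 0" using elim by simp
    qed
  qed
  moreover have "norm (u - t n) \<le> (1/4) ^ n" for n
  proof -
    have "ennreal ((norm (u - t n))\<^sup>2) = (\<integral>\<^sup>+z. ennreal ((f z - ?f n z)\<^sup>2) \<partial>lebesgue)"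
      unfolding L2_norm_nn[symmetric]
      by (rule nn_integral_cong_AE) (use u L2_rep_diff[of u "t n"] in eventually_elim, simp)
    also have "\<dots> \<le> ennreal (((1/4) ^ n)\<^sup>2)" by (rule fatou)
    finally have "(norm (u - t n))\<^sup>2 \<le> ((1/4) ^ n)\<^sup>2" by simp
    then show ?thesis by (rule power2_le_imp_le) simp
  qed
  ultimately show ?thesis using that by blast
qed

lemma HL2_complete: "complete (HL2 T)"
  unfolding complete_def
proof (intro allI impI)
  fix s assume s: "(\<forall>n. s n \<in> HL2 T) \<and> Cauchy s"
  have "\<exists>N. \<forall>m\<ge>N. \<forall>n\<ge>N. norm (s m - s n) < (1/4) ^ k" for k
    using s metric_CauchyD[of s "(1/4) ^ k"] by (simp add: dist_norm)
  then obtain N where N: "\<And>k m n. m \<ge> N k \<Longrightarrow> n \<ge> N k \<Longrightarrow> norm (s m - s n) < (1/4) ^ k" by metis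
  \<comment> \<open>The maximum puts \<open>r m\<close> beyond every threshold \<open>N k\<close>
    with \<open>k \<le> m\<close>, which gives the subsequence the rate required by
    \<open>L2_fast_Cauchy\<close>.\<close>
  define r where "r k = Max (N ` {..k})" for k
  have r: "N k \<le> r m" if "k \<le> m" for k m
    unfolding r_def using that by (intro Max_ge) auto
  obtain u where u: "u \<in> HL2 T" "\<And>k. norm (u - s (r k)) \<le> (1/4) ^ k"
  proof (rule L2_fast_Cauchy[of "\<lambda>k. s (r k)" T])
    show "norm (s (r m) - s (r k)) \<le> (1/4) ^ k" if "k \<le> m" for k m
      using N[of k "r m" "r k"] r[OF that] r[of k k] by simp
  qed (use s in auto)
  have "s \<longlonglongrightarrow> u"
  proof (rule metric_LIMSEQ_I)
    fix e :: real assume "0 < e"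
    then obtain k where k: "(1/4 :: real) ^ k < e / 2" using real_arch_pow_inv[of "e / 2" "1/4"] by auto
    have "dist (s n) u < e" if "n \<ge> N k" for n
    proof -
      have "norm (s n - u) \<le> norm (s n - s (r k)) + norm (s (r k) - u)"
        using norm_triangle_ineq[of "s n - s (r k)" "s (r k) - u"] by simp
      also have "\<dots> < (1/4) ^ k + (1/4) ^ k"
        using N[OF that r[of k k]] u(2)[of k] by (simp add: norm_minus_commute)
      finally show ?thesis using k by (simp add: dist_norm)
    qed
    then show "\<exists>no. \<forall>n\<ge>no. dist (s n) u < e" by blast
  qed
  then show "\<exists>l\<in>HL2 T. s \<longlonglongrightarrow> l" using u(1) by blast
qed

section \<open>Superposition (Nemytskii) operators and multiplication operators on
  \<open>HL2 T\<close>\<close>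

definition superposition :: "real \<Rightarrow> (real \<times> real \<Rightarrow> real \<Rightarrow> real) \<Rightarrow> L2 \<Rightarrow> L2" where
  "superposition T \<phi> u = L2_class (\<lambda>z. if z \<in> Omega T then \<phi> z (L2_rep u z) else 0)"

lemma superposition_rep:
  assumes "square_integrable (\<lambda>z. if z \<in> Omega T then \<phi> z (L2_rep u z) else 0)"
  shows "AE z in lebesgue. L2_rep (superposition T \<phi> u) z = (if z \<in> Omega T then \<phi> z (L2_rep u z) else 0)"
    and "superposition T \<phi> u \<in> HL2 T"
proof -
  show *: "AE z in lebesgue. L2_rep (superposition T \<phi> u) z = (if z \<in> Omega T then \<phi> z (L2_rep u z) else 0)"
    unfolding superposition_def by (rule L2_rep_class[OF assms])
  show "superposition T \<phi> u \<in> HL2 T"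
    unfolding HL2_iff using * by eventually_elim simp
qed

lemma mult_op_superposition: "mult_op T h = superposition T (\<lambda>z r. h z * r)"
  by (simp add: fun_eq_iff mult_op_def superposition_def)

lemma mult_op_rep:
  assumes h: "h \<in> Linfty (lebesgue_on (Omega T))"
  shows "AE z in lebesgue. L2_rep (mult_op T h u) z = (if z \<in> Omega T then h z * L2_rep u z else 0)"
    and "mult_op T h u \<in> HL2 T"
proof -
  obtain C where hm: "h \<in> borel_measurable (lebesgue_on (Omega T))"
    and C: "AE z in lebesgue. z \<in> Omega T \<longrightarrow> \<bar>h z\<bar> \<le> C"
    using h unfolding Linfty_def AE_Omega by auto
  have [measurable]: "(\<lambda>z. if z \<in> Omega T then h z else 0) \<in> borel_measurable lebesgue"
    using hm by (rule borel_measurable_if_I) simp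
  have "(\<lambda>z. (if z \<in> Omega T then h z else 0) * L2_rep u z) \<in> borel_measurable lebesgue" by measurable
  then have m: "(\<lambda>z. if z \<in> Omega T then h z * L2_rep u z else 0) \<in> borel_measurable lebesgue"
    by (rule measurable_cong[THEN iffD1, rotated]) simp
  have "square_integrable (\<lambda>z. if z \<in> Omega T then h z * L2_rep u z else 0)"
  proof (rule square_integrable_bound[OF square_integrable_scale[OF L2_rep_square_integrable[of u], of C] m])
    show "AE z in lebesgue. \<bar>if z \<in> Omega T then h z * L2_rep u z else 0\<bar> \<le> \<bar>C * L2_rep u z\<bar>"
      using C by eventually_elim (auto simp: abs_mult intro!: mult_right_mono)
  qed
  then show "AE z in lebesgue. L2_rep (mult_op T h u) z = (if z \<in> Omega T then h z * L2_rep u z else 0)"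
    and "mult_op T h u \<in> HL2 T"
    unfolding mult_op_superposition by (intro superposition_rep[of T "\<lambda>z r. h z * r"]; simp)+
qed

lemma mult_op_bounded_self_adjoint:
  assumes h: "h \<in> Linfty (lebesgue_on (Omega T))"
  shows "bounded_self_adjoint_on (HL2 T) (mult_op T h)"
  unfolding bounded_self_adjoint_on_def
proof (intro conjI ballI allI)
  note rep = mult_op_rep(1)[OF h]
  show "mult_op T h u \<in> HL2 T" for u by (rule mult_op_rep(2)[OF h])
  show "mult_op T h (u + v) = mult_op T h u + mult_op T h v" for u v
    by (rule L2_eqI) (use rep[of "u + v"] rep[of u] rep[of v] L2_rep_add[of u v]
        L2_rep_add[of "mult_op T h u" "mult_op T h v"] in eventually_elim, simp add: distrib_left)
  show "mult_op T h (c *\<^sub>R u) = c *\<^sub>R mult_op T h u" for c u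
    by (rule L2_eqI) (use rep[of "c *\<^sub>R u"] rep[of u] L2_rep_scale[of c u]
        L2_rep_scale[of c "mult_op T h u"] in eventually_elim, simp)
  show "\<exists>C. \<forall>u\<in>HL2 T. norm (mult_op T h u) \<le> C * norm u"
  proof -
    obtain C where C: "AE z in lebesgue. z \<in> Omega T \<longrightarrow> \<bar>h z\<bar> \<le> C"
      using h unfolding Linfty_def AE_Omega by auto
    have "norm (mult_op T h u) \<le> max 0 C * norm u" for u
    proof (rule L2_norm_mono)
      show "AE z in lebesgue. \<bar>L2_rep (mult_op T h u) z\<bar> \<le> max 0 C * \<bar>L2_rep u z\<bar>"
        using rep[of u] C by eventually_elim (auto simp: abs_mult intro!: mult_right_mono)
    qed simp
    then show ?thesis by blast
  qed
  show "inner (mult_op T h u) v = inner u (mult_op T h v)" for u v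
    unfolding L2_inner
  proof (rule integral_cong_AE)
    show "AE z in lebesgue. L2_rep (mult_op T h u) z * L2_rep v z = L2_rep u z * L2_rep (mult_op T h v) z"
      using rep[of u] rep[of v] by eventually_elim simp
  qed measurable
qed

lemma mult_op_mono:
  assumes h: "h \<in> Linfty (lebesgue_on (Omega T))" "k \<in> Linfty (lebesgue_on (Omega T))"
    and le: "AE z in lebesgue_on (Omega T). h z \<le> k z"
  shows "inner (mult_op T h u) u \<le> inner (mult_op T k u) u"
  unfolding L2_inner
proof (rule integral_mono_AE)
  show "AE z in lebesgue. L2_rep (mult_op T h u) z * L2_rep u z \<le> L2_rep (mult_op T k u) z * L2_rep u z"
    using mult_op_rep(1)[OF h(1), of u] mult_op_rep(1)[OF h(2), of u] le[unfolded AE_Omega]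
  proof eventually_elim
    case (elim z)
    show ?case
    proof (cases "z \<in> Omega T")
      case True
      then have "h z * (L2_rep u z * L2_rep u z) \<le> k z * (L2_rep u z * L2_rep u z)"
        using elim by (intro mult_right_mono) simp_all
      then show ?thesis using elim True by (simp add: mult.assoc)
    qed (use elim in simp)
  qed
qed (intro square_integrable_mult L2_rep_square_integrable)+

text \<open>Measurability comes from composing a jointly continuous function with
  \<open>z \<mapsto> (z, u z)\<close>; integrability from linear growth in \<open>r\<close>, with
  \<open>\<phi> z 0\<close> bounded on a compact set containing the fundamental domain.\<close>

lemma superposition_square_integrable:
  assumes cont: "continuous_on (({0..pi} \<times> UNIV) \<times> UNIV) (\<lambda>(z, r). \<phi> z r)"
    and lip: "\<And>z r s. z \<in> {0..pi} \<times> UNIV \<Longrightarrow> \<bar>\<phi> z r - \<phi> z s\<bar> \<le> l * \<bar>r - s\<bar>"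
  shows "square_integrable (\<lambda>z. if z \<in> Omega T then \<phi> z (L2_rep u z) else 0)"
proof -
  let ?S = "({0..pi} \<times> UNIV) \<times> UNIV :: ((real \<times> real) \<times> real) set"
  have S: "Omega T \<subseteq> {0..pi} \<times> UNIV" unfolding Omega_def by auto
  have cl: "closed ?S" by (intro closed_Times) auto
  have id: "(\<lambda>z. z) \<in> measurable lebesgue (borel :: (real \<times> real) measure)"
    by (rule measurable_completion) simp
  have "(\<lambda>z. (z, L2_rep u z)) \<in> measurable lebesgue (borel \<Otimes>\<^sub>M borel)"
    by (intro measurable_Pair id L2_rep_measurable)
  then have pair: "(\<lambda>z. (z, L2_rep u z)) \<in> measurable lebesgue (borel :: ((real \<times> real) \<times> real) measure)"
    by (simp add: borel_prod)
  have "(\<lambda>p. indicator ?S p *\<^sub>R (case p of (z, r) \<Rightarrow> \<phi> z r)) \<in> borel_measurable borel"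
    by (rule borel_measurable_continuous_on_indicator[OF _ cont]) (use cl in simp)
  from measurable_compose[OF pair this]
  have "(\<lambda>z. indicator ?S (z, L2_rep u z) *\<^sub>R \<phi> z (L2_rep u z)) \<in> borel_measurable lebesgue" by simp
  then have "(\<lambda>z. if z \<in> Omega T then indicator ?S (z, L2_rep u z) *\<^sub>R \<phi> z (L2_rep u z) else 0) \<in> borel_measurable lebesgue"
    by measurable
  moreover have "(\<lambda>z. if z \<in> Omega T then indicator ?S (z, L2_rep u z) *\<^sub>R \<phi> z (L2_rep u z) else 0)
      = (\<lambda>z. if z \<in> Omega T then \<phi> z (L2_rep u z) else 0)"
    using S by (auto simp: fun_eq_iff)
  ultimately have m: "(\<lambda>z. if z \<in> Omega T then \<phi> z (L2_rep u z) else 0) \<in> borel_measurable lebesgue" by simp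
  have "compact (({0..pi} \<times> {0..T}) \<times> {0::real})" by (intro compact_Times) auto
  then have "bounded ((\<lambda>(z, r). \<phi> z r) ` (({0..pi} \<times> {0..T}) \<times> {0}))"
    by (intro compact_imp_bounded compact_continuous_image continuous_on_subset[OF cont]) auto
  then obtain K where K: "\<And>z. z \<in> {0..pi} \<times> {0..T} \<Longrightarrow> \<bar>\<phi> z 0\<bar> \<le> K"
    unfolding bounded_iff by auto
  have K': "\<bar>\<phi> z 0\<bar> \<le> \<bar>K\<bar>" if "z \<in> Omega T" for z
    using K[of z] that unfolding Omega_def by auto
  have abs_sq: "square_integrable (\<lambda>z. \<bar>L2_rep u z\<bar>)"
    by (rule square_integrable_bound[OF L2_rep_square_integrable[of u]]) simp_all
  show ?thesis
  proof (rule square_integrable_bound[OF square_integrable_add[OF square_integrable_Omega_const[of T "\<bar>K\<bar>"]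
        square_integrable_scale[OF abs_sq, of "\<bar>l\<bar>"]] m], rule AE_I2)
    fix z
    show "\<bar>if z \<in> Omega T then \<phi> z (L2_rep u z) else 0\<bar> \<le> \<bar>(if z \<in> Omega T then \<bar>K\<bar> else 0) + \<bar>l\<bar> * \<bar>L2_rep u z\<bar>\<bar>"
    proof (cases "z \<in> Omega T")
      case True
      have "\<bar>\<phi> z (L2_rep u z) - \<phi> z 0\<bar> \<le> l * \<bar>L2_rep u z - 0\<bar>" by (rule lip) (use True S in auto)
      also have "\<dots> \<le> \<bar>l\<bar> * \<bar>L2_rep u z\<bar>" by (simp add: mult_right_mono)
      finally show ?thesis using K'[OF True] True by simp
    qed simp
  qed
qed

context resolved
begin

text \<open>\<open>E M e\<close> would again be an eigenvector, whose form has the value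
  \<open>ev * (norm (E M e))\<^sup>2\<close>, while \<open>M\<close> lying on one side of
  \<open>ev\<close> forces a strict inequality. The sign \<open>s\<close> selects the side.\<close>

lemma eigenvector_E_zero:
  assumes "(e, ev *\<^sub>R e) \<in> S" and M: "M \<in> sets borel" and "\<And>x. x \<in> M \<Longrightarrow> 0 < s * (x - ev)"
  shows "E M e = 0"
proof (rule ccontr)
  assume n: "E M e \<noteq> 0"
  have e: "e \<in> H" using assms graph_in by auto
  have "(E M e, ev *\<^sub>R E M e) \<in> S" using E_graph[OF assms(1) M] e M by (simp add: E_scale)
  then have "0 < s * (inner (ev *\<^sub>R E M e) (E M e) - ev * (norm (E M e))\<^sup>2)"
    by (rule form_pos[OF _ M]) (use assms(3) n e M in \<open>auto simp: E_idem\<close>)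
  then show False by (simp add: power2_norm_eq_inner)
qed

end

section \<open>The modes of the wave operator\<close>

text \<open>The Hilbert space is real, so each complex mode is replaced by its real and imaginary
  parts, with \<open>c\<close> choosing the cosine. All integers \<open>k\<close> are kept:
  repetitions up to sign and the zero function (sine with \<open>k = 0\<close>) do no harm where
  only totality and the eigenvalue equation are used.\<close>

definition mode_fun :: "real \<Rightarrow> bool \<Rightarrow> nat \<Rightarrow> int \<Rightarrow> real \<times> real \<Rightarrow> real" where
  "mode_fun T c j k z =
     sin (real j * fst z) * (if c then cos else sin) (real_of_int k * (2 * pi / T) * snd z)"

definition mode :: "real \<Rightarrow> bool \<Rightarrow> nat \<Rightarrow> int \<Rightarrow> L2" where
  "mode T c j k = L2_class (\<lambda>z. if z \<in> Omega T then mode_fun T c j k z else 0)"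

lemma mode_fun_measurable [measurable]: "mode_fun T c j k \<in> borel_measurable lebesgue"
proof -
  have "continuous_on UNIV (\<lambda>z::real \<times> real. sin (real j * fst z) * (if c then cos else sin) (w * snd z))" for w
    by (cases c) (auto intro!: continuous_intros)
  then have "mode_fun T c j k \<in> borel_measurable borel"
    unfolding mode_fun_def by (intro borel_measurable_continuous_onI)
  then show ?thesis by (intro measurable_completion) simp
qed

lemma mode_rep: "AE z in lebesgue. L2_rep (mode T c j k) z = (if z \<in> Omega T then mode_fun T c j k z else 0)"
  unfolding mode_def
proof (rule L2_rep_class, rule square_integrable_bound[OF square_integrable_Omega_const[of T 1]])
  show "(\<lambda>z. if z \<in> Omega T then mode_fun T c j k z else 0) \<in> borel_measurable lebesgue"
    by measurable
  have "\<bar>mode_fun T c j k z\<bar> \<le> 1 * 1" for z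
    unfolding mode_fun_def abs_mult by (intro mult_mono) auto
  then show "AE z in lebesgue. \<bar>if z \<in> Omega T then mode_fun T c j k z else 0\<bar> \<le> \<bar>if z \<in> Omega T then 1 else 0\<bar>"
    by (intro AE_I2) simp
qed

lemma mode_in: "mode T c j k \<in> HL2 T"
  unfolding HL2_iff using mode_rep[of T c j k] by eventually_elim simp

lemma inner_mode:
  "integrable (lebesgue_on (Omega T)) (\<lambda>z. L2_rep u z * mode_fun T c j k z)"
  "inner u (mode T c j k) = (LINT z|lebesgue_on (Omega T). L2_rep u z * mode_fun T c j k z)"
proof -
  have ae: "AE z in lebesgue. L2_rep u z * L2_rep (mode T c j k) z = indicator (Omega T) z *\<^sub>R (L2_rep u z * mode_fun T c j k z)"
    using mode_rep[of T c j k] by eventually_elim simp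
  have m: "(\<lambda>z. indicator (Omega T) z *\<^sub>R (L2_rep u z * mode_fun T c j k z)) \<in> borel_measurable lebesgue"
    by measurable
  have "integrable lebesgue (\<lambda>z. L2_rep u z * L2_rep (mode T c j k) z)"
    by (intro square_integrable_mult L2_rep_square_integrable)
  then have "integrable lebesgue (\<lambda>z. indicator (Omega T) z *\<^sub>R (L2_rep u z * mode_fun T c j k z))"
    using ae m by (rule_tac integrable_cong_AE_imp) auto
  then show "integrable (lebesgue_on (Omega T)) (\<lambda>z. L2_rep u z * mode_fun T c j k z)"
    by (subst integrable_restrict_space) simp_all
  have "inner u (mode T c j k) = (LINT z|lebesgue. indicator (Omega T) z *\<^sub>R (L2_rep u z * mode_fun T c j k z))"
    unfolding L2_inner by (rule integral_cong_AE[OF _ m ae]) measurable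
  also have "\<dots> = (LINT z|lebesgue_on (Omega T). L2_rep u z * mode_fun T c j k z)"
    by (rule integral_restrict_space[symmetric]) simp
  finally show "inner u (mode T c j k) = (LINT z|lebesgue_on (Omega T). L2_rep u z * mode_fun T c j k z)" .
qed

lemma fourier_coeff_mode:
  "fourier_coeff T u j k = complex_of_real (2 / (pi * T)) *
     (complex_of_real (inner u (mode T True j k)) - \<i> * complex_of_real (inner u (mode T False j k)))"
proof -
  let ?M = "lebesgue_on (Omega T)"
  let ?c = "\<lambda>z. L2_rep u z * mode_fun T True j k z"
  let ?s = "\<lambda>z. L2_rep u z * mode_fun T False j k z"
  have "(LINT z|?M. complex_of_real (L2_rep u z * sin (real j * fst z)) * cis (- (real_of_int k * (2 * pi / T) * snd z)))
      = (LINT z|?M. complex_of_real (?c z) - \<i> * complex_of_real (?s z))"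
    by (rule Bochner_Integration.integral_cong) (simp_all add: complex_eq_iff mode_fun_def)
  also have "\<dots> = (LINT z|?M. complex_of_real (?c z)) - (LINT z|?M. \<i> * complex_of_real (?s z))"
    by (rule Bochner_Integration.integral_diff)
      (intro integrable_mult_right integrable_of_real inner_mode(1))+
  also have "(LINT z|?M. \<i> * complex_of_real (?s z)) = \<i> * (LINT z|?M. complex_of_real (?s z))"
    by (rule integral_mult_right_zero)
  finally show ?thesis
    unfolding fourier_coeff_def integral_complex_of_real inner_mode(2)[symmetric] by simp
qed

abbreviation wave_eigenvalue :: "real \<Rightarrow> nat \<Rightarrow> int \<Rightarrow> real" where
  "wave_eigenvalue T j k \<equiv> (real j)\<^sup>2 - (2 * pi / T)\<^sup>2 * (real_of_int k)\<^sup>2"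

lemma fourier_coeff_eq_iff:
  assumes "T > 0"
  shows "fourier_coeff T v j k = complex_of_real m * fourier_coeff T u j k \<longleftrightarrow>
    (\<forall>c. inner v (mode T c j k) = m * inner u (mode T c j k))"
proof -
  have "complex_of_real (2 / (pi * T)) \<noteq> 0" using assms by simp
  moreover have "complex_of_real m * (complex_of_real (2 / (pi * T)) * x) = complex_of_real (2 / (pi * T)) * (complex_of_real m * x)" for x
    by simp
  ultimately have "fourier_coeff T v j k = complex_of_real m * fourier_coeff T u j k \<longleftrightarrow>
    complex_of_real (inner v (mode T True j k)) - \<i> * complex_of_real (inner v (mode T False j k)) =
    complex_of_real m * (complex_of_real (inner u (mode T True j k)) - \<i> * complex_of_real (inner u (mode T False j k)))"
    unfolding fourier_coeff_mode by (simp only: mult_cancel_left simp_thms)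
  also have "\<dots> \<longleftrightarrow> (\<forall>c. inner v (mode T c j k) = m * inner u (mode T c j k))"
    by (simp add: complex_eq_iff all_bool_eq)
  finally show ?thesis .
qed

lemma wave_op_iff:
  assumes "T > 0"
  shows "(u, v) \<in> wave_op T \<longleftrightarrow> u \<in> HL2 T \<and> v \<in> HL2 T \<and>
    (\<forall>j\<ge>1. \<forall>k c. inner v (mode T c j k) = wave_eigenvalue T j k * inner u (mode T c j k))"
  unfolding wave_op_def mem_Collect_eq case_prod_conv fourier_coeff_eq_iff[OF assms] ..

text \<open>Self-adjointness is assumed here; in the final theorem it is part of the spectral
  resolution of \<open>A\<close> supplied by the relative Morse index.\<close>

locale wave =
  fixes T b :: real
  assumes T: "T > 0" and sa: "self_adjoint_on (HL2 T) (op_minus (wave_op T) (\<lambda>u. b *\<^sub>R u))"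
begin

abbreviation "A \<equiv> op_minus (wave_op T) (\<lambda>u. b *\<^sub>R u)"

sublocale selfadj "HL2 T" A
  by standard (rule HL2_subspace, rule sa)

lemma A_iff: "(u, s) \<in> A \<longleftrightarrow> (u, s + b *\<^sub>R u) \<in> wave_op T"
  unfolding op_minus_def by (auto simp: algebra_simps)

text \<open>Self-adjointness of \<open>A\<close> makes the modes eigenvectors without any orthogonality relation, and
  total because a vector with vanishing coefficients is an image of \<open>0\<close>.\<close>

lemma mode_eigenvector:
  assumes "1 \<le> j"
  shows "(mode T c j k, (wave_eigenvalue T j k - b) *\<^sub>R mode T c j k) \<in> A"
proof (rule memI)
  show "mode T c j k \<in> HL2 T" by (rule mode_in)
  then show "(wave_eigenvalue T j k - b) *\<^sub>R mode T c j k \<in> HL2 T" by (rule subspace_scale[OF HL2_subspace])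
  fix u s assume "(u, s) \<in> A"
  then have "inner (s + b *\<^sub>R u) (mode T c j k) = wave_eigenvalue T j k * inner u (mode T c j k)"
    using assms unfolding A_iff wave_op_iff[OF T] by simp
  then show "inner s (mode T c j k) = inner u ((wave_eigenvalue T j k - b) *\<^sub>R mode T c j k)"
    by (simp add: inner_add_left left_diff_distrib)
qed

lemma modes_total:
  assumes "w \<in> HL2 T" "\<And>c j k. 1 \<le> j \<Longrightarrow> inner w (mode T c j k) = 0"
  shows "w = 0"
proof -
  have "(0, w) \<in> A"
    unfolding A_iff wave_op_iff[OF T] using assms subspace_0[OF HL2_subspace] by simp
  then show ?thesis using graph_0 by simp
qed

text \<open>The two index hypotheses may bring different resolutions of \<open>A\<close>. On an
  eigenvector the negative projection of any resolution acts according to the sign of the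
  eigenvalue, and the modes are total.\<close>

lemma negative_projection_unique:
  assumes "spectral_resolution (HL2 T) A E" "spectral_resolution (HL2 T) A E'" and u: "u \<in> HL2 T"
  shows "E {..<0} u = E' {..<0} u"
proof -
  interpret R: resolved "HL2 T" A E by standard (rule assms(1))
  interpret R': resolved "HL2 T" A E' by standard (rule assms(2))
  have modes: "E {..<0} e = E' {..<0} e" if "(e, ev *\<^sub>R e) \<in> A" for e ev
  proof -
    have e: "e \<in> HL2 T" using that graph_in by auto
    have compl: "- {..<0::real} = {0..}" by auto
    show ?thesis
    proof (cases "ev < 0")
      case True
      then have "E {0..} e = 0" "E' {0..} e = 0"
        using R.eigenvector_E_zero[OF that, of "{0..}" 1] R'.eigenvector_E_zero[OF that, of "{0..}" 1] by auto
      then show ?thesis using R.E_Compl[of "{..<0}" e] R'.E_Compl[of "{..<0}" e] e compl by simp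
    next
      case False
      then have "E {..<0} e = 0" "E' {..<0} e = 0"
        using R.eigenvector_E_zero[OF that, of "{..<0}" "-1"] R'.eigenvector_E_zero[OF that, of "{..<0}" "-1"] by auto
      then show ?thesis by simp
    qed
  qed
  have "E {..<0} u - E' {..<0} u = 0"
  proof (rule modes_total)
    show "E {..<0} u - E' {..<0} u \<in> HL2 T"
      using u by (intro subspace_diff[OF HL2_subspace] R.E_in R'.E_in) simp_all
    fix c j k assume "1 \<le> (j::nat)"
    then have "E {..<0} (mode T c j k) = E' {..<0} (mode T c j k)" using modes[OF mode_eigenvector] by simp
    then show "inner (E {..<0} u - E' {..<0} u) (mode T c j k) = 0"
      using R.E_sym[of "{..<0}" u "mode T c j k"] R'.E_sym[of "{..<0}" u "mode T c j k"] u mode_in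
      by (simp add: inner_diff_left)
  qed
  then show ?thesis by simp
qed

text \<open>With \<open>2 pi / T = m / n\<close> the eigenvalue times \<open>n\<^sup>2\<close> is
  the integer product \<open>(n j - m \<bar>k\<bar>) (n j + m \<bar>k\<bar>)\<close>. It is nonzero
  because 0 has distance exactly \<open>\<bar>b\<bar>\<close> from \<open>b\<close>, so the second
  factor is at most the absolute value of the product, hence at most
  \<open>2 \<bar>b\<bar> n\<^sup>2\<close>.\<close>

lemma finite_modes:
  assumes "T / pi \<in> \<rat>" "b \<noteq> 0"
  shows "finite {(j, k). 1 \<le> j \<and> \<bar>wave_eigenvalue T j k - b\<bar> < \<bar>b\<bar>}"
proof -
  have "2 * inverse (T / pi) \<in> \<rat>" using assms(1) by (intro Rats_mult Rats_inverse) simp_all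
  then have "2 * pi / T \<in> \<rat>" by (simp add: field_simps)
  then obtain m n :: nat where mn: "n \<noteq> 0" "\<bar>2 * pi / T\<bar> = real m / real n"
    by (rule Rats_abs_nat_div_natE)
  then have \<omega>: "2 * pi / T = real m / real n" using T by simp
  have m: "0 < m" using \<omega> T mn(1) by (cases "m = 0") auto
  define K where "K = nat \<lceil>2 * \<bar>b\<bar> * (real n)\<^sup>2\<rceil>"
  have "{(j, k). 1 \<le> j \<and> \<bar>wave_eigenvalue T j k - b\<bar> < \<bar>b\<bar>} \<subseteq> {..K} \<times> {- int K..int K}"
  proof (rule subrelI)
    fix j k
    assume "(j, k) \<in> {(j, k). 1 \<le> j \<and> \<bar>wave_eigenvalue T j k - b\<bar> < \<bar>b\<bar>}"
    then have near: "\<bar>wave_eigenvalue T j k - b\<bar> < \<bar>b\<bar>" by simp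
    define x where "x = int n * int j - int m * \<bar>k\<bar>"
    define y where "y = int n * int j + int m * \<bar>k\<bar>"
    have "real_of_int (x * y) = (real n)\<^sup>2 * (real j)\<^sup>2 - (real m)\<^sup>2 * (real_of_int k)\<^sup>2"
      unfolding x_def y_def by (simp add: power2_eq_square algebra_simps flip: abs_mult)
    also have "\<dots> = (real n)\<^sup>2 * wave_eigenvalue T j k"
      unfolding \<omega> using mn(1) by (simp add: right_diff_distrib power_divide)
    finally have xy: "real_of_int (x * y) = (real n)\<^sup>2 * wave_eigenvalue T j k" .
    have "wave_eigenvalue T j k \<noteq> 0" using near by auto
    then have "x * y \<noteq> 0" using xy mn(1) by (metis mult_eq_0_iff of_int_0 of_nat_eq_0_iff power_eq_0_iff)
    then have "1 \<le> \<bar>x\<bar>" by auto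
    moreover have y0: "0 \<le> y" unfolding y_def by simp
    ultimately have "1 * y \<le> \<bar>x\<bar> * y" by (intro mult_right_mono)
    then have "y \<le> \<bar>x * y\<bar>" using y0 by (simp add: abs_mult)
    then have "real_of_int y \<le> \<bar>real_of_int (x * y)\<bar>" by linarith
    also have "\<dots> = (real n)\<^sup>2 * \<bar>wave_eigenvalue T j k\<bar>" unfolding xy by (simp add: abs_mult)
    also have "\<dots> \<le> (real n)\<^sup>2 * (2 * \<bar>b\<bar>)" using near by (intro mult_left_mono) auto
    also have "\<dots> \<le> real K" unfolding K_def by (simp add: mult.commute mult.left_commute of_nat_ceiling)
    finally have yK: "y \<le> int K" by linarith
    have nj: "int j \<le> int n * int j" using mn(1) mult_right_mono[of 1 "int n" "int j"] by simp
    have mk: "\<bar>k\<bar> \<le> int m * \<bar>k\<bar>" using m mult_right_mono[of 1 "int m" "\<bar>k\<bar>"] by simp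
    have j': "int j \<le> int K" using yK nj mk unfolding y_def by linarith
    have k': "\<bar>k\<bar> \<le> int K" using yK nj mk unfolding y_def by linarith
    show "(j, k) \<in> {..K} \<times> {- int K..int K}" using j' k' by auto
  qed
  then show ?thesis by (rule finite_subset) simp
qed

text \<open>Project \<open>u\<close> orthogonally to the span of the finitely many near modes. The
  remainder is orthogonal to these by construction. It is orthogonal to every other mode because the
  middle projection annihilates that mode while fixing \<open>u\<close>, and because eigenvectors
  for different eigenvalues are orthogonal.\<close>

lemma finite_middle_part:
  assumes "T / pi \<in> \<rat>" "b \<noteq> 0" and E: "spectral_resolution (HL2 T) A E"
  obtains G where "finite G" "E {-\<bar>b\<bar><..<\<bar>b\<bar>} ` HL2 T \<subseteq> span G"
proof -
  interpret R: resolved "HL2 T" A E by standard (rule E)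
  let ?N = "{(j, k). 1 \<le> j \<and> \<bar>wave_eigenvalue T j k - b\<bar> < \<bar>b\<bar>}"
  define G where "G = (\<lambda>(c, j, k). mode T c j k) ` (UNIV \<times> ?N)"
  have finG: "finite G" unfolding G_def using finite_modes[OF assms(1,2)] by (intro finite_imageI finite_cartesian_product) auto
  have spH: "span G \<subseteq> HL2 T"
    by (rule span_minimal[OF _ HL2_subspace]) (auto simp: G_def mode_in)
  show ?thesis
  proof (rule that[OF finG], rule subsetI)
    fix u assume "u \<in> E {-\<bar>b\<bar><..<\<bar>b\<bar>} ` HL2 T"
    then have u: "u \<in> HL2 T" "E {-\<bar>b\<bar><..<\<bar>b\<bar>} u = u" using R.E_in R.E_idem by auto
    obtain m where m: "m \<in> span G" "\<And>x. x \<in> span G \<Longrightarrow> inner (u - m) x = 0"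
      using span_projection_exists[OF finG, of u] by metis
    have "u - m = 0"
    proof (rule modes_total)
      show "u - m \<in> HL2 T" using u(1) m(1) spH by (intro subspace_diff[OF HL2_subspace]) auto
      fix c j k assume j: "1 \<le> (j::nat)"
      let ?e = "mode T c j k"
      show "inner (u - m) ?e = 0"
      proof (cases "(j, k) \<in> ?N")
        case True
        then have "?e \<in> G" unfolding G_def by (intro image_eqI[of _ _ "(c, j, k)"]) auto
        then show ?thesis using m(2) span_base by blast
      next
        case False
        define ev where "ev = wave_eigenvalue T j k - b"
        have ev: "\<bar>b\<bar> \<le> \<bar>ev\<bar>" using False j unfolding ev_def by auto
        have e: "(?e, ev *\<^sub>R ?e) \<in> A" unfolding ev_def by (rule mode_eigenvector[OF j])
        have "E {-\<bar>b\<bar><..<\<bar>b\<bar>} ?e = 0"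
        proof (cases "0 \<le> ev")
          case True
          then show ?thesis using ev by (intro R.eigenvector_E_zero[OF e, of _ "-1"]) auto
        next
          case False
          then show ?thesis using ev by (intro R.eigenvector_E_zero[OF e, of _ 1]) auto
        qed
        then have "inner u ?e = 0"
          using R.E_sym[of "{-\<bar>b\<bar><..<\<bar>b\<bar>}" u ?e] u mode_in by simp
        moreover have "inner m ?e = 0"
          using m(1)
        proof (induction rule: span_induct_alt)
          case (step a g y)
          obtain c' j' k' where g: "g = mode T c' j' k'" "1 \<le> j'" "\<bar>wave_eigenvalue T j' k' - b\<bar> < \<bar>b\<bar>"
            using step(1) unfolding G_def by auto
          define ev' where "ev' = wave_eigenvalue T j' k' - b"
          have "(g, ev' *\<^sub>R g) \<in> A" unfolding ev'_def g(1) by (rule mode_eigenvector[OF g(2)])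
          from sym[OF this e] have "ev' * inner g ?e = ev * inner g ?e" by simp
          moreover have "ev' \<noteq> ev" using g(3) ev unfolding ev'_def by auto
          ultimately have "inner g ?e = 0" by simp
          then show ?case using step(2) by (simp add: inner_add_left)
        qed simp
        ultimately show ?thesis by (simp add: inner_diff_left)
      qed
    qed
    then show "u \<in> span G" using m(1) by simp
  qed
qed

end

section \<open>The nonlinear wave equation\<close>

text \<open>\<open>edim\<close> is finite only with a finite spanning set, so \<open>dim = 0\<close>
  really means an empty basis.\<close>

lemma nullity_zero_kernel:
  assumes "nullity A B = 0" "(k, 0) \<in> op_minus A B"
  shows "k = 0"
proof -
  let ?V = "{u. (u, 0) \<in> op_minus A B}"
  obtain F where F: "finite F" "?V \<subseteq> span F" and dim0: "dim ?V = 0"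
    using assms(1) unfolding nullity_def edim_def by (auto simp: zero_enat_def split: if_splits)
  obtain K where K: "K \<subseteq> ?V" "independent K" "?V \<subseteq> span K" "card K = dim ?V"
    by (rule basis_exists)
  have "finite K" using independent_span_bound[OF F(1) K(2)] K(1) F(2) by simp
  then have "K = {}" using K(4) dim0 by simp
  then show ?thesis using K(3) assms(2) by auto
qed

lemma has_fredholm_index_cong:
  assumes "has_fredholm_index f V W n" "\<And>x. x \<in> V \<Longrightarrow> f x = f' x"
  shows "has_fredholm_index f' V W n"
proof -
  have "{u \<in> V. f' u = 0} = {u \<in> V. f u = 0}" "f' ` V = f ` V"
    using assms(2) by (auto simp: image_iff)
  then show ?thesis using assms(1) unfolding has_fredholm_index_def by simp
qed

section \<open>Comparing the nonlinearity with multiplication operators\<close>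

lemma L2_norm_bound:
  fixes d u :: L2
  assumes "0 \<le> \<epsilon>" "0 \<le> K"
    and "AE z in lebesgue. \<bar>L2_rep d z\<bar> \<le> \<epsilon> * \<bar>L2_rep u z\<bar> + (if z \<in> Omega T then K else 0)"
  shows "norm d \<le> \<epsilon> * norm u + norm (L2_class (\<lambda>z. if z \<in> Omega T then K else 0))"
proof -
  define a where "a = L2_class (\<lambda>z. \<bar>L2_rep u z\<bar>)"
  define c where "c = L2_class (\<lambda>z. if z \<in> Omega T then K else 0)"
  have "square_integrable (\<lambda>z. \<bar>L2_rep u z\<bar>)"
    by (rule square_integrable_bound[OF L2_rep_square_integrable[of u]]) simp_all
  then have a: "AE z in lebesgue. L2_rep a z = \<bar>L2_rep u z\<bar>" unfolding a_def by (rule L2_rep_class)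
  have c: "AE z in lebesgue. L2_rep c z = (if z \<in> Omega T then K else 0)"
    unfolding c_def by (rule L2_rep_class[OF square_integrable_Omega_const])
  have "norm d \<le> 1 * norm (\<epsilon> *\<^sub>R a + c)"
  proof (rule L2_norm_mono)
    show "AE z in lebesgue. \<bar>L2_rep d z\<bar> \<le> 1 * \<bar>L2_rep (\<epsilon> *\<^sub>R a + c) z\<bar>"
      using assms(3) a c L2_rep_add[of "\<epsilon> *\<^sub>R a" c] L2_rep_scale[of \<epsilon> a]
      by eventually_elim (use assms(1,2) in auto)
  qed simp
  also have "\<dots> \<le> \<epsilon> * norm a + norm c"
    using norm_triangle_ineq[of "\<epsilon> *\<^sub>R a" c] assms(1) by simp
  also have "norm a \<le> 1 * norm u"
    by (rule L2_norm_mono) (simp, use a in eventually_elim, simp)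
  finally show ?thesis using assms(1) unfolding c_def by (simp add: mult_left_mono)
qed

text \<open>The bounds on \<open>g\<close> hold only almost everywhere, hence say nothing about \<open>g\<close> on the graph of a
  function; they transfer to the quotient \<open>\<phi> z r / r\<close> because it is continuous in \<open>r\<close>.\<close>

lemma quotient_bounds:
  fixes \<phi> :: "real \<times> real \<Rightarrow> real \<Rightarrow> real"
  assumes cont: "\<And>z. z \<in> Omega T \<Longrightarrow> continuous_on UNIV (\<phi> z)"
    and g: "AE (z, r) in lebesgue_on (Omega T \<times> UNIV). g1 z \<le> g (z, r) \<and> g (z, r) \<le> g2 z"
    and asym: "\<And>z r. z \<in> Omega T \<Longrightarrow> R \<le> \<bar>r\<bar> \<Longrightarrow> \<bar>\<phi> z r - g (z, r) * r\<bar> \<le> \<epsilon> * \<bar>r\<bar>"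
  shows "AE z in lebesgue. z \<in> Omega T \<longrightarrow> (\<forall>r. R < \<bar>r\<bar> \<longrightarrow>
    (g1 z - \<epsilon>) * r\<^sup>2 \<le> \<phi> z r * r \<and> \<phi> z r * r \<le> (g2 z + \<epsilon>) * r\<^sup>2)"
proof -
  have "Omega T \<times> (UNIV :: real set) \<in> sets borel" by (intro borel_Times) simp_all
  then have "AE p in lebesgue. p \<in> Omega T \<times> UNIV \<longrightarrow> (case p of (z, r) \<Rightarrow> g1 z \<le> g (z, r) \<and> g (z, r) \<le> g2 z)"
    using g by (subst (asm) AE_restrict_space_iff) simp_all
  then have "AE p in lborel \<Otimes>\<^sub>M lborel. p \<in> Omega T \<times> UNIV \<longrightarrow> (case p of (z, r) \<Rightarrow> g1 z \<le> g (z, r) \<and> g (z, r) \<le> g2 z)"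
    unfolding AE_completion_iff lborel_prod .
  \<comment> \<open>Fubini: for almost every \<open>z\<close> the bounds on \<open>g\<close> hold
    for almost every \<open>r\<close>.\<close>
  from lborel_pair.AE_pair[OF this] have "AE z in lborel. AE r in lborel. z \<in> Omega T \<longrightarrow> g1 z \<le> g (z, r) \<and> g (z, r) \<le> g2 z"
    by simp
  then have "AE z in lebesgue. AE r in lborel. z \<in> Omega T \<longrightarrow> g1 z \<le> g (z, r) \<and> g (z, r) \<le> g2 z"
    by (rule AE_completion)
  then show ?thesis
  proof eventually_elim
    case (elim z)
    show ?case
    proof (intro impI allI)
      fix r assume z: "z \<in> Omega T" and r: "R < \<bar>r\<bar>"
      let ?C = "{r. (g1 z - \<epsilon>) * r\<^sup>2 \<le> \<phi> z r * r \<and> \<phi> z r * r \<le> (g2 z + \<epsilon>) * r\<^sup>2}"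
      have "r \<in> ?C"
      \<comment> \<open>A closed set that contains almost every point of an open set contains all of
        it. Writing the bounds multiplied by \<open>r\<^sup>2\<close> treats both signs of
        \<open>r\<close> alike.\<close>
      proof (rule mem_closed_if_AE_lebesgue_open[of "{r. R < \<bar>r\<bar>}"])
        show "open {r::real. R < \<bar>r\<bar>}" by (intro open_Collect_less continuous_intros)
        show "closed ?C"
          by (intro closed_Collect_conj closed_Collect_le continuous_intros cont z)
        show "AE r\<in>{r. R < \<bar>r\<bar>} in lebesgue. r \<in> ?C"
        proof (rule AE_completion)
          show "AE r\<in>{r. R < \<bar>r\<bar>} in lborel. r \<in> ?C"
            using elim
          proof eventually_elim
            case (elim r)
            show ?case
            proof
              assume "r \<in> {r. R < \<bar>r\<bar>}"
              then have "\<bar>\<phi> z r - g (z, r) * r\<bar> * \<bar>r\<bar> \<le> \<epsilon> * \<bar>r\<bar> * \<bar>r\<bar>"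
                using asym[OF z, of r] by (intro mult_right_mono) simp_all
              then have "\<bar>\<phi> z r * r - g (z, r) * r\<^sup>2\<bar> \<le> \<epsilon> * r\<^sup>2"
                by (simp add: abs_mult[symmetric] left_diff_distrib power2_eq_square mult.assoc)
              moreover have "g1 z * r\<^sup>2 \<le> g (z, r) * r\<^sup>2" "g (z, r) * r\<^sup>2 \<le> g2 z * r\<^sup>2"
                using elim z by (auto intro!: mult_right_mono)
              ultimately show "r \<in> ?C" by (simp add: left_diff_distrib distrib_right abs_le_iff)
            qed
          qed
        qed
      qed (use r in simp)
      then show "(g1 z - \<epsilon>) * r\<^sup>2 \<le> \<phi> z r * r \<and> \<phi> z r * r \<le> (g2 z + \<epsilon>) * r\<^sup>2" by simp
    qed
  qed
qed

text \<open>For each \<open>u\<close> separately: where \<open>\<bar>u\<bar>\<close> is large,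
  \<open>h\<close> is the quotient of \<open>\<phi>\<close> by \<open>u\<close> clipped to
  \<open>[g1, g2]\<close>, which moves it by at most \<open>\<epsilon>\<close>; elsewhere
  \<open>h\<close> is \<open>g1\<close>, at a bounded cost that does not depend on
  \<open>u\<close>.\<close>

lemma asymptotically_multiplication:
  fixes \<phi> :: "real \<times> real \<Rightarrow> real \<Rightarrow> real"
  assumes cont: "continuous_on (({0..pi} \<times> UNIV) \<times> UNIV) (\<lambda>(z, r). \<phi> z r)"
    and lip: "\<And>z r s. z \<in> {0..pi} \<times> UNIV \<Longrightarrow> \<bar>\<phi> z r - \<phi> z s\<bar> \<le> l * \<bar>r - s\<bar>"
    and g1: "g1 \<in> Linfty (lebesgue_on (Omega T))" and g2: "g2 \<in> Linfty (lebesgue_on (Omega T))"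
    and g12: "AE z in lebesgue_on (Omega T). g1 z \<le> g2 z"
    and g: "AE (z, r) in lebesgue_on (Omega T \<times> UNIV). g1 z \<le> g (z, r) \<and> g (z, r) \<le> g2 z"
    and asym: "\<exists>R. \<forall>z\<in>Omega T. \<forall>r. R \<le> \<bar>r\<bar> \<longrightarrow> \<bar>\<phi> z r - g (z, r) * r\<bar> \<le> \<epsilon> * \<bar>r\<bar>"
    and \<epsilon>: "0 < \<epsilon>"
  shows "\<exists>M. \<forall>u. \<exists>h \<in> Linfty (lebesgue_on (Omega T)).
    (AE z in lebesgue_on (Omega T). g1 z \<le> h z) \<and> (AE z in lebesgue_on (Omega T). h z \<le> g2 z) \<and>
    norm (superposition T \<phi> u - mult_op T h u) \<le> \<epsilon> * norm u + M"
proof -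
  obtain R0 where R0: "\<And>z r. z \<in> Omega T \<Longrightarrow> R0 \<le> \<bar>r\<bar> \<Longrightarrow> \<bar>\<phi> z r - g (z, r) * r\<bar> \<le> \<epsilon> * \<bar>r\<bar>"
    using asym by blast
  \<comment> \<open>Positivity of \<open>R\<close> makes the division legitimate wherever
    \<open>R < \<bar>u\<bar>\<close>.\<close>
  define R where "R = max R0 1"
  have R: "0 < R" "\<And>z r. z \<in> Omega T \<Longrightarrow> R \<le> \<bar>r\<bar> \<Longrightarrow> \<bar>\<phi> z r - g (z, r) * r\<bar> \<le> \<epsilon> * \<bar>r\<bar>"
    using R0 unfolding R_def by auto
  have Om: "z \<in> {0..pi} \<times> UNIV" if "z \<in> Omega T" for z using that unfolding Omega_def by auto
  have cz: "continuous_on UNIV (\<phi> z)" if "z \<in> Omega T" for z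
  proof -
    have "continuous_on UNIV ((\<lambda>(z, r). \<phi> z r) \<circ> (\<lambda>r. (z, r)))"
      by (intro continuous_on_compose continuous_on_subset[OF cont] continuous_intros) (use Om[OF that] in auto)
    then show ?thesis by (simp add: o_def)
  qed
  have bounds: "AE z in lebesgue. z \<in> Omega T \<longrightarrow> (\<forall>r. R < \<bar>r\<bar> \<longrightarrow>
    (g1 z - \<epsilon>) * r\<^sup>2 \<le> \<phi> z r * r \<and> \<phi> z r * r \<le> (g2 z + \<epsilon>) * r\<^sup>2)"
    by (rule quotient_bounds[OF cz g R(2)])
  obtain C1 where g1m: "g1 \<in> borel_measurable (lebesgue_on (Omega T))"
    and C1: "AE z in lebesgue. z \<in> Omega T \<longrightarrow> \<bar>g1 z\<bar> \<le> C1"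
    using g1 unfolding Linfty_def AE_Omega by auto
  obtain C2 where g2m: "g2 \<in> borel_measurable (lebesgue_on (Omega T))"
    and C2: "AE z in lebesgue. z \<in> Omega T \<longrightarrow> \<bar>g2 z\<bar> \<le> C2"
    using g2 unfolding Linfty_def AE_Omega by auto
  have "compact (({0..pi} \<times> {0..T}) \<times> {0::real})" by (intro compact_Times) auto
  then have "bounded ((\<lambda>(z, r). \<phi> z r) ` (({0..pi} \<times> {0..T}) \<times> {0}))"
    by (intro compact_imp_bounded compact_continuous_image continuous_on_subset[OF cont]) auto
  then obtain K where K: "\<And>z. z \<in> {0..pi} \<times> {0..T} \<Longrightarrow> \<bar>\<phi> z 0\<bar> \<le> K"
    unfolding bounded_iff by auto
  have K': "\<bar>\<phi> z 0\<bar> \<le> K" if "z \<in> Omega T" for z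
    using K[of z] that unfolding Omega_def by auto
  \<comment> \<open>The cost where \<open>\<bar>u\<bar> \<le> R\<close>: the value of
    \<open>\<phi>\<close> at 0, its Lipschitz growth, and the product with
    \<open>h = g1\<close>.\<close>
  define M0 where "M0 = \<bar>K\<bar> + \<bar>l\<bar> * R + \<bar>C1\<bar> * R"
  have M0: "0 \<le> M0" unfolding M0_def using R(1) by simp
  have "\<exists>h \<in> Linfty (lebesgue_on (Omega T)).
    (AE z in lebesgue_on (Omega T). g1 z \<le> h z) \<and> (AE z in lebesgue_on (Omega T). h z \<le> g2 z) \<and>
    norm (superposition T \<phi> u - mult_op T h u) \<le> \<epsilon> * norm u + norm (L2_class (\<lambda>z. if z \<in> Omega T then M0 else 0))" for u
  proof -
    define r where "r = L2_rep u"
    have rm [measurable]: "r \<in> borel_measurable lebesgue" unfolding r_def by measurable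
    have sq: "square_integrable (\<lambda>z. if z \<in> Omega T then \<phi> z (L2_rep u z) else 0)"
      by (rule superposition_square_integrable[OF cont lip])
    define q where "q z = (if z \<in> Omega T then \<phi> z (L2_rep u z) else 0) / r z" for z
    have [measurable]: "(\<lambda>z. if z \<in> Omega T then \<phi> z (L2_rep u z) else 0) \<in> borel_measurable lebesgue"
      using sq unfolding square_integrable_def by (rule conjunct1)
    have qm [measurable]: "q \<in> borel_measurable lebesgue" unfolding q_def by measurable
    define h where "h z = (if R < \<bar>r z\<bar> then max (g1 z) (min (g2 z) (q z)) else g1 z)" for z
    have [measurable]: "r \<in> borel_measurable (lebesgue_on (Omega T))" "q \<in> borel_measurable (lebesgue_on (Omega T))"
      using rm qm by (simp_all add: measurable_restrict_space1)
    note [measurable] = g1m g2m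
    have hm: "h \<in> borel_measurable (lebesgue_on (Omega T))" unfolding h_def by measurable
    have le: "AE z in lebesgue_on (Omega T). g1 z \<le> h z" unfolding h_def by (intro AE_I2) simp
    have ge: "AE z in lebesgue_on (Omega T). h z \<le> g2 z"
      using g12 unfolding h_def by eventually_elim auto
    have hL: "h \<in> Linfty (lebesgue_on (Omega T))"
      unfolding Linfty_def
    proof (intro CollectI conjI hm exI)
      show "AE z in lebesgue_on (Omega T). \<bar>h z\<bar> \<le> max C1 C2"
        using le[unfolded AE_Omega] ge[unfolded AE_Omega] C1 C2 unfolding AE_Omega
        by eventually_elim (auto simp: abs_le_iff le_max_iff_disj)
    qed
    have "AE z in lebesgue. \<bar>L2_rep (superposition T \<phi> u - mult_op T h u) z\<bar> \<le> \<epsilon> * \<bar>L2_rep u z\<bar> + (if z \<in> Omega T then M0 else 0)"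
      using superposition_rep(1)[of T \<phi> u, OF sq] mult_op_rep(1)[OF hL, of u] L2_rep_diff[of "superposition T \<phi> u" "mult_op T h u"]
        bounds C1 g12[unfolded AE_Omega]
    proof eventually_elim
      case (elim z)
      show ?case
      proof (cases "z \<in> Omega T")
        case False
        then show ?thesis using elim \<epsilon> by simp
      next
        case z: True
        then have eq: "L2_rep (superposition T \<phi> u - mult_op T h u) z = \<phi> z (r z) - h z * r z"
          using elim unfolding r_def by simp
        show ?thesis
        proof (cases "R < \<bar>r z\<bar>")
          case True
          then have r0: "r z \<noteq> 0" using R(1) by auto
          have rr: "0 < (r z)\<^sup>2" using r0 by simp
          have q: "q z = \<phi> z (r z) / r z" using z unfolding q_def r_def by simp
          have "(g1 z - \<epsilon>) * (r z)\<^sup>2 \<le> q z * (r z)\<^sup>2" "q z * (r z)\<^sup>2 \<le> (g2 z + \<epsilon>) * (r z)\<^sup>2"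
            using elim(4) z True r0 unfolding q by (simp_all add: power2_eq_square)
          then have "g1 z - \<epsilon> \<le> q z" "q z \<le> g2 z + \<epsilon>" using rr by simp_all
          then have "\<bar>q z - h z\<bar> \<le> \<epsilon>"
            using elim(6) z True \<epsilon> unfolding h_def by (auto simp: abs_le_iff)
          then have "\<bar>q z - h z\<bar> * \<bar>r z\<bar> \<le> \<epsilon> * \<bar>r z\<bar>" by (intro mult_right_mono) simp_all
          moreover have "(q z - h z) * r z = \<phi> z (r z) - h z * r z" using r0 unfolding q by (simp add: left_diff_distrib)
          ultimately have "\<bar>\<phi> z (r z) - h z * r z\<bar> \<le> \<epsilon> * \<bar>r z\<bar>" by (simp add: abs_mult[symmetric])
          then show ?thesis using eq z M0 unfolding r_def by simp
        next
          case False
          have "\<bar>\<phi> z (r z) - \<phi> z 0\<bar> \<le> l * \<bar>r z - 0\<bar>" by (rule lip) (use Om z in simp)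
          also have "\<dots> \<le> \<bar>l\<bar> * R" using False by (intro mult_mono) simp_all
          finally have "\<bar>\<phi> z (r z)\<bar> \<le> \<bar>K\<bar> + \<bar>l\<bar> * R" using K'[OF z] by linarith
          moreover have "\<bar>h z * r z\<bar> \<le> \<bar>C1\<bar> * R"
            using False elim(5) z unfolding h_def abs_mult by (intro mult_mono) auto
          ultimately have "\<bar>\<phi> z (r z) - h z * r z\<bar> \<le> M0" unfolding M0_def by linarith
          moreover have "0 \<le> \<epsilon> * \<bar>L2_rep u z\<bar>" using \<epsilon> by simp
          ultimately show ?thesis using eq z by simp
        qed
      qed
    qed
    then have "norm (superposition T \<phi> u - mult_op T h u) \<le> \<epsilon> * norm u + norm (L2_class (\<lambda>z. if z \<in> Omega T then M0 else 0))"
      using \<epsilon> M0 by (intro L2_norm_bound) simp_all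
    then show ?thesis using hL le ge by blast
  qed
  then show ?thesis by blast
qed

theorem theorem4p1:
  fixes T b lF :: real
    and f :: "real \<times> real \<Rightarrow> real \<Rightarrow> real"
    and g1 g2 :: "real \<times> real \<Rightarrow> real"
    and g :: "(real \<times> real) \<times> real \<Rightarrow> real"
  defines "A \<equiv> op_minus (wave_op T) (\<lambda>u. b *\<^sub>R u)"
    and "fb \<equiv> \<lambda>z u. f z u - b * u"
  assumes "T > 0" and "T / pi \<in> \<rat>"
    and f_periodic: "\<And>x t u. x \<in> {0..pi} \<Longrightarrow> f (x, t + T) u = f (x, t) u"
    and f_cont: "continuous_on (({0..pi} \<times> UNIV) \<times> UNIV) (\<lambda>(z, u). f z u)"
    and "b \<noteq> 0" and "0 < lF" and "lF < \<bar>b\<bar>"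
    and f_lip: "\<And>z u v. z \<in> {0..pi} \<times> UNIV \<Longrightarrow> \<bar>fb z (u + v) - fb z u\<bar> \<le> lF * \<bar>v\<bar>"
    and "g1 \<in> Linfty (lebesgue_on (Omega T))" and "mult_op T g1 \<in> Ls (HL2 T) (- \<bar>b\<bar>) \<bar>b\<bar>"
    and "g2 \<in> Linfty (lebesgue_on (Omega T))" and "mult_op T g2 \<in> Ls (HL2 T) (- \<bar>b\<bar>) \<bar>b\<bar>"
    and "g \<in> Linfty (lebesgue_on (Omega T \<times> UNIV))"
    and "AE z in lebesgue_on (Omega T). g1 z \<le> g2 z"
    and "\<exists>n. has_relative_morse_index (HL2 T) A (mult_op T g1) n \<and>
             has_relative_morse_index (HL2 T) A (mult_op T g2) n"
    and "nullity A (mult_op T g2) = 0"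
    and "AE (z, u) in lebesgue_on (Omega T \<times> UNIV). g1 z \<le> g (z, u) \<and> g (z, u) \<le> g2 z"
    and "\<And>\<epsilon>. \<epsilon> > 0 \<Longrightarrow>
           \<exists>R. \<forall>z\<in>Omega T. \<forall>u. \<bar>u\<bar> \<ge> R \<longrightarrow> \<bar>fb z u - g (z, u) * u\<bar> \<le> \<epsilon> * \<bar>u\<bar>"
  shows "\<exists>u. weak_solution T f u"
proof -
  let ?H = "HL2 T" and ?\<beta> = "\<bar>b\<bar>"
  note T = \<open>T > 0\<close> and g1 = \<open>g1 \<in> Linfty (lebesgue_on (Omega T))\<close> and g2 = \<open>g2 \<in> Linfty (lebesgue_on (Omega T))\<close>
    and g12 = \<open>AE z in lebesgue_on (Omega T). g1 z \<le> g2 z\<close>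
  obtain n where n: "has_relative_morse_index ?H A (mult_op T g1) n" "has_relative_morse_index ?H A (mult_op T g2) n"
    using \<open>\<exists>n. has_relative_morse_index ?H A (mult_op T g1) n \<and> has_relative_morse_index ?H A (mult_op T g2) n\<close> by blast
  obtain E E1 where E: "spectral_resolution ?H A E" and E1: "spectral_resolution ?H (op_minus A (mult_op T g1)) E1"
    and i1: "has_fredholm_index (E {..<0}) (E1 {..<0} ` ?H) (E {..<0} ` ?H) n"
    using n(1) unfolding has_relative_morse_index_def by blast
  \<comment> \<open>A possibly different resolution of \<open>A\<close>; \<open>EE'\<close> below
    identifies its negative projection with that of \<open>E\<close>, so that both indices refer to
    the same map.\<close>
  obtain E' E2 where E': "spectral_resolution ?H A E'" and E2: "spectral_resolution ?H (op_minus A (mult_op T g2)) E2"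
    and i2': "has_fredholm_index (E' {..<0}) (E2 {..<0} ` ?H) (E' {..<0} ` ?H) n"
    using n(2) unfolding has_relative_morse_index_def by blast
  have sa: "self_adjoint_on ?H A" using E unfolding spectral_resolution_def by (rule conjunct1)
  interpret w: wave T b using T sa unfolding A_def by (rule wave.intro)
  interpret R: resolved ?H A E
    unfolding A_def by standard (rule E[unfolded A_def])
  obtain G where G: "finite G" "E {-?\<beta><..<?\<beta>} ` ?H \<subseteq> span G"
    using w.finite_middle_part[OF \<open>T / pi \<in> \<rat>\<close> \<open>b \<noteq> 0\<close> E[unfolded A_def]] by blast
  have \<beta>: "0 < ?\<beta>" using \<open>b \<noteq> 0\<close> by simp
  obtain \<kappa>1 where \<kappa>1: "0 \<le> \<kappa>1" "\<kappa>1 < ?\<beta>" "\<And>u. u \<in> ?H \<Longrightarrow> norm (mult_op T g1 u) \<le> \<kappa>1 * norm u"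
    using Ls_norm_bound[OF HL2_subspace \<open>mult_op T g1 \<in> Ls ?H (- ?\<beta>) ?\<beta>\<close> \<beta>] by metis
  obtain \<kappa>2 where \<kappa>2: "0 \<le> \<kappa>2" "\<kappa>2 < ?\<beta>" "\<And>u. u \<in> ?H \<Longrightarrow> norm (mult_op T g2 u) \<le> \<kappa>2 * norm u"
    using Ls_norm_bound[OF HL2_subspace \<open>mult_op T g2 \<in> Ls ?H (- ?\<beta>) ?\<beta>\<close> \<beta>] by metis
  \<comment> \<open>One constant for both perturbations, still below
    \<open>\<bar>b\<bar>\<close>.\<close>
  define \<kappa> where "\<kappa> = max \<kappa>1 \<kappa>2"
  have \<kappa>: "norm (mult_op T g1 u) \<le> \<kappa> * norm u" "norm (mult_op T g2 u) \<le> \<kappa> * norm u" if "u \<in> ?H" for u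
    using \<kappa>1(3)[OF that] \<kappa>2(3)[OF that] mult_right_mono[of \<kappa>1 \<kappa> "norm u"] mult_right_mono[of \<kappa>2 \<kappa> "norm u"]
    unfolding \<kappa>_def by auto
  have EE': "E' {..<0} u = E {..<0} u" if "u \<in> ?H" for u
    by (rule w.negative_projection_unique[OF E'[unfolded A_def] E[unfolded A_def] that])
  interpret gap ?H A E ?\<beta> G
    by standard (rule HL2_complete \<beta> G)+
  interpret p1: pert ?H A E ?\<beta> G "mult_op T g1" E1 \<kappa>
    by standard (use mult_op_bounded_self_adjoint[OF g1] \<kappa> \<kappa>1 \<kappa>2 E1 in \<open>auto simp: \<kappa>_def\<close>)
  interpret p2: pert ?H A E ?\<beta> G "mult_op T g2" E2 \<kappa>
    by standard (use mult_op_bounded_self_adjoint[OF g2] \<kappa> \<kappa>1 \<kappa>2 E2 in \<open>auto simp: \<kappa>_def\<close>)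
  have EH: "E' {..<0} ` ?H = E {..<0} ` ?H" using EE' by (rule image_cong[OF refl])
  have i2: "has_fredholm_index (E {..<0}) (E2 {..<0} ` ?H) (E {..<0} ` ?H) n"
    using has_fredholm_index_cong[OF i2'[unfolded EH]] EE' p2.N_in by blast
  interpret gap_pair ?H A E ?\<beta> G "mult_op T g1" E1 "mult_op T g2" E2 \<kappa> n
  proof
    show "inner (mult_op T g1 u) u \<le> inner (mult_op T g2 u) u" for u
      by (rule mult_op_mono[OF g1 g2 g12])
    show "k = 0" if "k \<in> Domain A" "R.app k = mult_op T g2 k" for k
    proof (rule nullity_zero_kernel[OF \<open>nullity A (mult_op T g2) = 0\<close>])
      show "(k, 0) \<in> op_minus A (mult_op T g2)"
        using R.app_graph[OF that(1)] that(2) unfolding op_minus_def by auto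
    qed
  qed (rule i1 i2)+
  have fb_cont: "continuous_on (({0..pi} \<times> UNIV) \<times> UNIV) (\<lambda>(z, r). fb z r)"
  proof -
    have "continuous_on (({0..pi} \<times> UNIV) \<times> UNIV) (\<lambda>p. (case p of (z, r) \<Rightarrow> f z r) - b * snd p)"
      by (intro continuous_intros f_cont)
    then show ?thesis unfolding fb_def by (simp add: case_prod_beta)
  qed
  have fb_lip: "\<bar>fb z r - fb z s\<bar> \<le> lF * \<bar>r - s\<bar>" if "z \<in> {0..pi} \<times> UNIV" for z r s
    using f_lip[OF that, of s "r - s"] by simp
  define F where "F = superposition T fb"
  have rep: "AE z in lebesgue. L2_rep (F u) z = (if z \<in> Omega T then fb z (L2_rep u z) else 0)"
    and FH: "F u \<in> ?H" for u
  proof -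
    have "square_integrable (\<lambda>z. if z \<in> Omega T then fb z (L2_rep u z) else 0)"
      by (rule superposition_square_integrable[OF fb_cont fb_lip])
    then show "AE z in lebesgue. L2_rep (F u) z = (if z \<in> Omega T then fb z (L2_rep u z) else 0)" "F u \<in> ?H"
      unfolding F_def by (rule superposition_rep)+
  qed
  have "\<exists>u\<in>Domain A. R.app u = F u"
  proof (rule existence)
    show "0 \<le> lF" "lF < ?\<beta>" using \<open>0 < lF\<close> \<open>lF < \<bar>b\<bar>\<close> by simp_all
    show "F u \<in> ?H" for u by (rule FH)
    show "norm (F u - F v) \<le> lF * norm (u - v)" for u v
    proof (rule L2_norm_mono)
      show "AE z in lebesgue. \<bar>L2_rep (F u - F v) z\<bar> \<le> lF * \<bar>L2_rep (u - v) z\<bar>"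
        using rep[of u] rep[of v] L2_rep_diff[of u v] L2_rep_diff[of "F u" "F v"]
      proof eventually_elim
        case (elim z)
        show ?case
        proof (cases "z \<in> Omega T")
          case True
          then have "z \<in> {0..pi} \<times> UNIV" unfolding Omega_def by auto
          then show ?thesis using elim True fb_lip[of z "L2_rep u z" "L2_rep v z"] by simp
        next
          case False
          then show ?thesis using elim \<open>0 < lF\<close> by simp
        qed
      qed
    qed (use \<open>0 < lF\<close> in simp)
    fix \<epsilon> :: real assume \<epsilon>: "0 < \<epsilon>"
    obtain M where M: "\<And>u. \<exists>h \<in> Linfty (lebesgue_on (Omega T)).
      (AE z in lebesgue_on (Omega T). g1 z \<le> h z) \<and> (AE z in lebesgue_on (Omega T). h z \<le> g2 z) \<and>
      norm (superposition T fb u - mult_op T h u) \<le> \<epsilon> * norm u + M"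
      using asymptotically_multiplication[OF fb_cont fb_lip g1 g2 g12
        \<open>AE (z, u) in lebesgue_on (Omega T \<times> UNIV). g1 z \<le> g (z, u) \<and> g (z, u) \<le> g2 z\<close> assms(20)[OF \<epsilon>] \<epsilon>]
      by blast
    show "\<exists>M. \<forall>u\<in>?H. \<exists>B. bounded_self_adjoint_on ?H B \<and>
      (\<forall>w\<in>?H. inner (mult_op T g1 w) w \<le> inner (B w) w \<and> inner (B w) w \<le> inner (mult_op T g2 w) w) \<and>
      norm (F u - B u) \<le> \<epsilon> * norm u + M"
    proof (intro exI[of _ M] ballI)
      fix u assume "u \<in> ?H"
      obtain h where h: "h \<in> Linfty (lebesgue_on (Omega T))"
        "AE z in lebesgue_on (Omega T). g1 z \<le> h z" "AE z in lebesgue_on (Omega T). h z \<le> g2 z"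
        "norm (superposition T fb u - mult_op T h u) \<le> \<epsilon> * norm u + M"
        using M[of u] by blast
      show "\<exists>B. bounded_self_adjoint_on ?H B \<and>
        (\<forall>w\<in>?H. inner (mult_op T g1 w) w \<le> inner (B w) w \<and> inner (B w) w \<le> inner (mult_op T g2 w) w) \<and>
        norm (F u - B u) \<le> \<epsilon> * norm u + M"
        using mult_op_bounded_self_adjoint[OF h(1)] mult_op_mono[OF g1 h(1,2)] mult_op_mono[OF h(1) g2 h(3)] h(4)
        unfolding F_def by (intro exI[of _ "mult_op T h"] conjI ballI)
    qed
  qed
  then obtain u where u: "u \<in> Domain A" "R.app u = F u" by blast
  have "(u, F u) \<in> A" using R.app_graph[OF u(1)] u(2) by simp
  \<comment> \<open>Undoing the shift by \<open>b\<close> turns \<open>fb\<close> back into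
    \<open>f\<close>.\<close>
  then have "(u, F u + b *\<^sub>R u) \<in> wave_op T" unfolding A_def by (simp add: w.A_iff)
  moreover have "AE z in lebesgue_on (Omega T). L2_rep (F u + b *\<^sub>R u) z = f z (L2_rep u z)"
    unfolding AE_Omega using rep[of u] L2_rep_add[of "F u" "b *\<^sub>R u"] L2_rep_scale[of b u]
    by eventually_elim (simp add: fb_def)
  ultimately show ?thesis unfolding weak_solution_def by blast
qed

end
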